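(* Let $x$ be an abstract vector variable and let $Y,Y'$ be finite sets of abstract vector variables not containing $x$. Every bijection $\tau:Y\to Y'$ induces a radial-algebra isomorphism $R_{\mathbb B}(\{x\}\cup Y)\to R_{\mathbb B}(\{x\}\cup Y')$ (fixing $x$ and sending $y\mapsto\tau(y)$) that intertwines $\partial^{Y,\mathrm R}_{x,q}$ and $\partial^{Y',\mathrm R}_{x,q}$. In particular, the operator $\partial^{Y,\mathrm R}_{x,q}$ is independent of the ordering of $Y$ used to write the exterior basis.
   Context: **Radial algebra.** For a set $S$ of abstract vector variables, $R(S)$ is the associative unital $\mathbb R$-algebra generated by $S$ subject to $[\{u,v\},w]=0$ for all $u,v,w\in S$, where $\{a,b\}=ab+ba$, $[a,b]=ab-ba$. The wedge is the antisymmetrized product $u_1\wedge\cdots\wedge u_p=\frac1{p!}\sum_{\pi}\operatorname{sgn}(\pi)u_{\pi(1)}\cdots u_{\pi(p)}$ (empty wedge $=1$). **Coefficients.** $q,Q$ are algebraically independent indeterminates, $\mathbb B=\mathbb R[q,q^{-1},Q,(1-q)^{-1}]$, $R_{\mathbb B}(S)=\mathbb B\otimes_{\mathbb R}R(S)$. For integers $n,a$: $[n]_q=\frac{1-q^n}{1-q}$, $q^{m+a}:=Qq^a$, $[m+a]_q:=\frac{1-Qq^a}{1-q}$ ($m$ is only a formal symbol). **Scalars.** For a finite set $Y=\{y_1,\dots,y_N\}$ (with a chosen ordering), $r=x^2$, $s_i=\{x,y_i\}$, $c_{ij}=\{y_i,y_j\}=c_{ji}$ are central and $\mathcal A_x(Y)=\mathbb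 B[r,s_1,\dots,s_N,c_{ij}:1\le i\le j\le N]$ is a polynomial algebra. For $I=\{i_1<\cdots<i_p\}\subset\{1,\dots,N\}$, $y_I=y_{i_1}\wedge\cdots\wedge y_{i_p}$, $y_\varnothing=1$. It is known that $R_{\mathbb B}(\{x\}\cup Y)=\bigoplus_I y_I\mathcal A_x(Y)\oplus\bigoplus_I(x\wedge y_I)\mathcal A_x(Y)$, free over $\mathcal A_x(Y)$ on the elements $y_I,\ x\wedge y_I$. **Jackson operators.** For a scalar variable $u$ and parameter $P$: $\delta^{(u)}_Pf=\frac{f(u)-f(Pu)}{(1-P)u}$, $T^{(u)}_Pf(u)=f(Pu)$. The scalar-input operator is $$\partial^{\mathrm{sc},Y}_{x,q}A=(1+q)\,x\,\delta^{(r)}_{q^2}A+2\sum_{i=1}^N y_i\,T^{(r)}_{q^2}\delta^{(s_i)}_qA,\qquad A\in\mathcal A_x(Y).$$ **Finite relative right $q$-vector derivative.** $\partial^{Y,\mathrm R}_{x,q}$ is the $\mathbb B$-linear operator on $R_{\mathbb B}(\{x\}\cup Y)$ defined, for $p=|I|$ and $A,B\in\mathcal A_x(Y)$, by $$\partial^{Y,\mathrm R}_{x,q}(y_IA)=y_I\,\partial^{\mathrm{sc},Y}_{x,q}(A),\qquad \partial^{Y,\mathrm R}_{x,q}((x\wedge y_I)B)=(-1)^p[m-p]_q\,y_IB+q^{m-p}(x\wedge y_I)\,\partial^{\mathrm{sc},Y}_{x,q}(B).$$ *)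

theory Defs
  imports
    "HOL-Algebra.QuotRing"
    "HOL-Library.Poly_Mapping"
    "HOL-Combinatorics.Permutations"
    "HOL-Computational_Algebra.Polynomial"
    "HOL-Computational_Algebra.Fraction_Field"
begin

text \<open>
  The coefficient ring \<open>\<real>[q, 1/q, Q, 1/(1 - q)]\<close> is the subring generated by the displayed
  elements in the field of fractions of \<open>\<real>[q][Q]\<close> (inner variable \<open>q\<close>, outer variable \<open>Q\<close>).
\<close>

type_synonym ratfun = "real poly poly fract"

definition rf_const :: "real \<Rightarrow> ratfun" where
  "rf_const t = Fract [:[:t:]:] 1"

definition rf_q :: ratfun where
  "rf_q = Fract [:[:0, 1:]:] 1"

definition rf_Q :: ratfun where
  "rf_Q = Fract [:0, 1:] 1"

inductive_set coeff_set :: "ratfun set" where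
  const: "rf_const t \<in> coeff_set"
| q: "rf_q \<in> coeff_set"
| q_inverse: "inverse rf_q \<in> coeff_set"
| Q: "rf_Q \<in> coeff_set"
| one_minus_q_inverse: "inverse (1 - rf_q) \<in> coeff_set"
| add: "a \<in> coeff_set \<Longrightarrow> b \<in> coeff_set \<Longrightarrow> a + b \<in> coeff_set"
| mult: "a \<in> coeff_set \<Longrightarrow> b \<in> coeff_set \<Longrightarrow> a * b \<in> coeff_set"

lemma rf_const_simps:
  "rf_const 0 = 0" "rf_const 1 = 1"
  "rf_const (s + t) = rf_const s + rf_const t"
  "rf_const (s * t) = rf_const s * rf_const t"
  "rf_const (- t) = - rf_const t"
  by (simp_all add: rf_const_def Zero_fract_def One_fract_def one_pCons)

lemma coeff_set_0: "0 \<in> coeff_set"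
  using coeff_set.const[of 0] by (simp add: rf_const_simps)

lemma coeff_set_1: "1 \<in> coeff_set"
  using coeff_set.const[of 1] by (simp add: rf_const_simps)

lemma coeff_set_uminus: "a \<in> coeff_set \<Longrightarrow> - a \<in> coeff_set"
  using coeff_set.mult[OF coeff_set.const[of "- 1"], of a] by (simp add: rf_const_simps)

lemma coeff_set_diff: "a \<in> coeff_set \<Longrightarrow> b \<in> coeff_set \<Longrightarrow> a - b \<in> coeff_set"
  using coeff_set.add[OF _ coeff_set_uminus, of a b] by simp

lemma coeff_set_q_powi: "rf_q powi a \<in> coeff_set"
proof -
  have "x ^ n \<in> coeff_set" if "x \<in> coeff_set" for x and n :: nat
    by (induction n) (auto intro: coeff_set_1 coeff_set.mult that)
  then show ?thesis
    by (auto simp: power_int_def coeff_set.q coeff_set.q_inverse)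
qed

typedef coeff_ring = coeff_set
  using coeff_set_0 by blast

setup_lifting type_definition_coeff_ring

instantiation coeff_ring :: "{idom, real_algebra_1}"
begin

lift_definition zero_coeff_ring :: coeff_ring is 0 by (rule coeff_set_0)
lift_definition one_coeff_ring :: coeff_ring is 1 by (rule coeff_set_1)
lift_definition plus_coeff_ring :: "coeff_ring \<Rightarrow> coeff_ring \<Rightarrow> coeff_ring" is "(+)"
  by (rule coeff_set.add)
lift_definition times_coeff_ring :: "coeff_ring \<Rightarrow> coeff_ring \<Rightarrow> coeff_ring" is "(*)"
  by (rule coeff_set.mult)
lift_definition uminus_coeff_ring :: "coeff_ring \<Rightarrow> coeff_ring" is uminus
  by (rule coeff_set_uminus)
lift_definition minus_coeff_ring :: "coeff_ring \<Rightarrow> coeff_ring \<Rightarrow> coeff_ring" is "(-)"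
  by (rule coeff_set_diff)
lift_definition scaleR_coeff_ring :: "real \<Rightarrow> coeff_ring \<Rightarrow> coeff_ring"
  is "\<lambda>t a. rf_const t * a"
  by (intro coeff_set.mult coeff_set.const)

instance
  by standard (transfer; simp add: algebra_simps rf_const_simps)+

end

lift_definition q_par :: coeff_ring is rf_q by (rule coeff_set.q)

text \<open>With \<open>m\<close> a formal symbol: \<open>qm_power a\<close> is \<open>q\<^bsup>m+a\<^esup> = Q q\<^sup>a\<close>, and
  \<open>qm_number a\<close> is \<open>[m+a]\<^sub>q\<close>.\<close>

lift_definition qm_power :: "int \<Rightarrow> coeff_ring" is "\<lambda>a. rf_Q * rf_q powi a"
  by (intro coeff_set.mult coeff_set.Q coeff_set_q_powi)

lift_definition qm_number :: "int \<Rightarrow> coeff_ring"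
  is "\<lambda>a. (1 - rf_Q * rf_q powi a) / (1 - rf_q)"
  unfolding divide_inverse
  by (intro coeff_set.mult coeff_set_diff coeff_set_1 coeff_set.Q coeff_set_q_powi
      coeff_set.one_minus_q_inverse)

text \<open>
  Words over an alphabet.  The free monoid is written additively only because the
  convolution product on \<open>poly_mapping\<close> asks for an additive index monoid; with it
  \<open>'v word \<Rightarrow>\<^sub>0 'k\<close> is the free associative unital \<open>'k\<close>-algebra on \<open>'v\<close>.
\<close>

typedef 'v word = "UNIV :: 'v list set"
  morphisms letters Word ..

setup_lifting type_definition_word

instantiation word :: (type) monoid_add
begin

lift_definition zero_word :: "'v word" is "[]" .
lift_definition plus_word :: "'v word \<Rightarrow> 'v word \<Rightarrow> 'v word" is "(@)" .

instance
  by standard (transfer; simp)+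

end

type_synonym ('v, 'k) free_alg = "'v word \<Rightarrow>\<^sub>0 'k"

definition scalar :: "'k::comm_ring_1 \<Rightarrow> ('v, 'k) free_alg" where
  "scalar c = Poly_Mapping.single 0 c"

definition var :: "'v \<Rightarrow> ('v, 'k::comm_ring_1) free_alg" where
  "var v = Poly_Mapping.single (Word [v]) 1"

definition anticomm :: "'a::ring \<Rightarrow> 'a \<Rightarrow> 'a" where
  "anticomm a b = a * b + b * a"

definition comm :: "'a::ring \<Rightarrow> 'a \<Rightarrow> 'a" where
  "comm a b = a * b - b * a"

definition free_algebra :: "'v set \<Rightarrow> ('v, 'k::comm_ring_1) free_alg ring" where
  "free_algebra S =
    \<lparr>carrier = {f. \<forall>w\<in>Poly_Mapping.keys f. set (letters w) \<subseteq> S},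
     monoid.mult = (*), one = 1, zero = 0, add = (+)\<rparr>"

definition radial_relators :: "'v set \<Rightarrow> ('v, 'k::comm_ring_1) free_alg set" where
  "radial_relators S =
    {comm (anticomm (var u) (var v)) (var w) | u v w. u \<in> S \<and> v \<in> S \<and> w \<in> S}"

definition radial_ideal :: "'v set \<Rightarrow> ('v, 'k::comm_ring_1) free_alg set" where
  "radial_ideal S = genideal (free_algebra S) (radial_relators S)"

text \<open>
  The radial algebra on \<open>S\<close> with coefficients in \<open>'k\<close>: for \<open>'k = real\<close> this is \<open>R(S)\<close>, and for
  \<open>'k = coeff_ring\<close> (written \<open>\<BB>\<close>) it is the extension of scalars \<open>\<BB> \<otimes> R(S)\<close>, i.e. the
  \<open>\<BB>\<close>-algebra with the same generators and relations.  Lemma \<open>radial_ideal_base_change\<close> below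
  gives the identification: tensoring \<open>0 \<rightarrow> I \<rightarrow> \<real>\<langle>S\<rangle> \<rightarrow> R(S) \<rightarrow> 0\<close> with \<open>\<BB>\<close> presents
  \<open>\<BB> \<otimes> R(S)\<close> as the quotient of \<open>\<BB>\<langle>S\<rangle>\<close> by the \<open>\<BB>\<close>-span of \<open>I\<close>.
\<close>

definition radial :: "'v set \<Rightarrow> ('v, 'k::comm_ring_1) free_alg set ring" where
  "radial S = free_algebra S Quot radial_ideal S"

text \<open>The class in the radial algebra of an element of the free algebra.\<close>

definition cls :: "'v set \<Rightarrow> ('v, 'k::comm_ring_1) free_alg \<Rightarrow> ('v, 'k) free_alg set" where
  "cls S f = radial_ideal S +>\<^bsub>free_algebra S\<^esub> f"

definition extend_scalars :: "('v, real) free_alg \<Rightarrow> ('v, 'k::{comm_ring_1, real_algebra_1}) free_alg"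
  where "extend_scalars f = Poly_Mapping.map of_real f"

lemma free_algebra_simps [simp]:
  "f \<in> carrier (free_algebra S) \<longleftrightarrow> (\<forall>w\<in>Poly_Mapping.keys f. set (letters w) \<subseteq> S)"
  "a \<otimes>\<^bsub>free_algebra S\<^esub> b = a * b" "a \<oplus>\<^bsub>free_algebra S\<^esub> b = a + b"
  "\<one>\<^bsub>free_algebra S\<^esub> = 1" "\<zero>\<^bsub>free_algebra S\<^esub> = 0"
  by (simp_all add: free_algebra_def)

lemma ring_free_algebra: "ring (free_algebra S :: ('v, 'k::comm_ring_1) free_alg ring)"
proof (unfold_locales, goal_cases)
  case (2 x y z) show ?case by (simp add: add.assoc)
next
  case 3 show ?case by simp
next
  case (1 x y)
  then show ?case using Poly_Mapping.keys_add[of x y] by auto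
next
  case (4 x) show ?case by simp
next
  case (5 x) show ?case by simp
next
  case (6 x y) show ?case by (simp add: add.commute)
next
  case 7
  show ?case
    by (auto simp: Units_def simp del: free_algebra_simps(1))
      (auto intro!: bexI[of _ "- _"])
next
  case (8 x y)
  then show ?case using Poly_Mapping.keys_mult[of x y]
    by (fastforce simp: plus_word.rep_eq)
next
  case (9 x y z) show ?case by (simp add: mult.assoc)
next
  case 10 show ?case by (simp add: zero_word.rep_eq)
qed (simp_all add: distrib_left distrib_right)

inductive_set scalar_span ::
  "('v, real) free_alg set \<Rightarrow> ('v, 'k::{comm_ring_1, real_algebra_1}) free_alg set"
  for J where
  zero: "0 \<in> scalar_span J"
| add: "f \<in> J \<Longrightarrow> g \<in> scalar_span J \<Longrightarrow> scalar c * extend_scalars f + g \<in> scalar_span J"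

lemma free_alg_expand: "f = (\<Sum>w\<in>Poly_Mapping.keys f. Poly_Mapping.single w (Poly_Mapping.lookup f w))"
  by (rule poly_mapping_eqI)
    (auto simp: lookup_sum lookup_single when_def in_keys_iff sum.delta)

lemma lookup_extend_scalars [simp]:
  "Poly_Mapping.lookup (extend_scalars f) w = of_real (Poly_Mapping.lookup f w)"
  by (auto simp: extend_scalars_def Poly_Mapping.map.rep_eq when_def)

lemma extend_scalars_simps:
  "extend_scalars 0 = 0" "extend_scalars 1 = 1"
  "extend_scalars (f + g) = extend_scalars f + extend_scalars g"
  "extend_scalars (f - g) = extend_scalars f - extend_scalars g"
  "extend_scalars (Poly_Mapping.single w c) = Poly_Mapping.single w (of_real c)"
  "extend_scalars (var v) = var v"
  by (auto intro!: poly_mapping_eqI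
      simp: lookup_add lookup_minus lookup_single lookup_one when_def var_def)

lemma extend_scalars_sum: "extend_scalars (sum h A) = (\<Sum>a\<in>A. extend_scalars (h a))"
  by (induction A rule: infinite_finite_induct) (simp_all add: extend_scalars_simps)

lemma extend_scalars_mult:
  fixes f g :: "('b, real) free_alg"
  shows "(extend_scalars (f * g) :: ('b, 'a::{comm_ring_1, real_algebra_1}) free_alg) =
    extend_scalars f * extend_scalars g"
proof -
  define F where "F h w = Poly_Mapping.single w (Poly_Mapping.lookup h w)"
    for h :: "('b, real) free_alg" and w
  have *: "extend_scalars (F f v * F g w) =
      (extend_scalars (F f v) * extend_scalars (F g w) :: ('b, 'a) free_alg)" for v w
    by (simp add: F_def mult_single extend_scalars_simps)
  have "f * g = (\<Sum>v\<in>Poly_Mapping.keys f. \<Sum>w\<in>Poly_Mapping.keys g. F f v * F g w)"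
    using arg_cong2[OF free_alg_expand[of f] free_alg_expand[of g], of "(*)"]
    by (simp add: F_def sum_product)
  then have "(extend_scalars (f * g) :: ('b, 'a) free_alg) =
      (\<Sum>v\<in>Poly_Mapping.keys f. \<Sum>w\<in>Poly_Mapping.keys g.
        extend_scalars (F f v) * extend_scalars (F g w))"
    by (simp add: extend_scalars_sum *)
  also have "\<dots> = extend_scalars f * extend_scalars g"
    using arg_cong[OF free_alg_expand[of f], of "extend_scalars :: _ \<Rightarrow> ('b, 'a) free_alg"]
      arg_cong[OF free_alg_expand[of g], of "extend_scalars :: _ \<Rightarrow> ('b, 'a) free_alg"]
    by (simp add: extend_scalars_sum sum_product F_def)
  finally show ?thesis .
qed

lemma keys_extend_scalars_subset:
  "Poly_Mapping.keys (extend_scalars f) \<subseteq> Poly_Mapping.keys f"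
  by (auto simp: in_keys_iff)

lemma scalar_central:
  fixes f :: "('v, 'k::comm_ring_1) free_alg"
  shows "scalar c * f = f * scalar c"
proof -
  have "scalar c * Poly_Mapping.single w b = Poly_Mapping.single w b * scalar c" for w :: "'v word" and b
    by (simp add: scalar_def mult_single mult.commute)
  then show ?thesis
    by (subst (1 2) free_alg_expand[of f]) (simp add: sum_distrib_left sum_distrib_right)
qed

lemma scalar_mult: "scalar (a * b) = scalar a * scalar b"
  by (simp add: scalar_def mult_single)

lemma scalar_span_sum_closed:
  "a \<in> scalar_span J \<Longrightarrow> b \<in> scalar_span J \<Longrightarrow> a + b \<in> scalar_span J"
  by (induction rule: scalar_span.induct) (auto simp: add.assoc intro: scalar_span.intros)

lemma radial_relators_carrier: "radial_relators S \<subseteq> carrier (free_algebra S)"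
proof -
  interpret ring "free_algebra S :: ('a, 'b) free_alg ring" by (rule ring_free_algebra)
  have v: "var u \<in> carrier (free_algebra S)" if "u \<in> S" for u
    using that by (auto simp: var_def Word_inverse)
  have m: "a * b \<in> carrier (free_algebra S)"
    if "a \<in> carrier (free_algebra S)" "b \<in> carrier (free_algebra S)" for a b :: "('a, 'b) free_alg"
    using m_closed[OF that] by (simp only: free_algebra_simps(2))
  have p: "a + b \<in> carrier (free_algebra S)"
    if "a \<in> carrier (free_algebra S)" "b \<in> carrier (free_algebra S)" for a b :: "('a, 'b) free_alg"
    using a_closed[OF that] by (simp only: free_algebra_simps(3))
  have n: "- b \<in> carrier (free_algebra S)"
    if "b \<in> carrier (free_algebra S)" for b :: "('a, 'b) free_alg"
    using that by simp
  show ?thesis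
    unfolding radial_relators_def comm_def anticomm_def diff_conv_add_uminus
    by (blast intro: v m p n)
qed

lemma ideal_radial_ideal: "ideal (radial_ideal S) (free_algebra S)"
  unfolding radial_ideal_def
  by (intro ring.genideal_ideal ring_free_algebra radial_relators_carrier)

lemma ideal_free_algebraI:
  assumes "J \<subseteq> carrier (free_algebra S)" "0 \<in> J" "\<And>a b. a \<in> J \<Longrightarrow> b \<in> J \<Longrightarrow> a + b \<in> J"
    and l: "\<And>a f. a \<in> J \<Longrightarrow> f \<in> carrier (free_algebra S) \<Longrightarrow> f * a \<in> J"
    and r: "\<And>a f. a \<in> J \<Longrightarrow> f \<in> carrier (free_algebra S) \<Longrightarrow> a * f \<in> J"
  shows "ideal J (free_algebra S :: ('v, 'k::comm_ring_1) free_alg ring)"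
proof -
  interpret ring "free_algebra S :: ('v, 'k) free_alg ring" by (rule ring_free_algebra)
  have neg: "- a \<in> J" if "a \<in> J" for a
    using l[OF that, of "- 1"] by (simp add: zero_word.rep_eq)
  have inv: "\<ominus>\<^bsub>free_algebra S\<^esub> a = - a" if "a \<in> J" for a
    by (rule minus_equality) (use assms(1) that in \<open>auto simp del: free_algebra_simps(1)\<close>,
        use assms(1) neg[OF that] in blast)
  show ?thesis
  proof (rule idealI[OF ring_axioms])
    show "subgroup J (add_monoid (free_algebra S))"
    proof (rule add.subgroupI)
      show "\<ominus>\<^bsub>free_algebra S\<^esub> a \<in> J" if "a \<in> J" for a
        using neg[OF that] inv[OF that] by simp
    qed (use assms in auto)
  qed (use l r in \<open>simp_all del: free_algebra_simps(1)\<close>)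
qed

lemma radial_ideal_base_change:
  "(radial_ideal S :: ('v, 'k::{comm_ring_1, real_algebra_1}) free_alg set) =
     scalar_span (radial_ideal S)"
proof
  let ?F = "free_algebra S :: ('v, 'k) free_alg ring"
  let ?FR = "free_algebra S :: ('v, real) free_alg ring"
  let ?I = "radial_ideal S :: ('v, 'k) free_alg set"
  let ?IR = "radial_ideal S :: ('v, real) free_alg set"
  let ?J = "scalar_span ?IR :: ('v, 'k) free_alg set"
  interpret F: ring ?F by (rule ring_free_algebra)
  interpret FR: ring ?FR by (rule ring_free_algebra)
  interpret I: ideal ?I ?F by (rule ideal_radial_ideal)
  interpret IR: ideal ?IR ?FR by (rule ideal_radial_ideal)
  have ext: "extend_scalars f \<in> carrier ?F" if "f \<in> carrier ?FR" for f
    using that keys_extend_scalars_subset[of f] by auto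
  have sc: "scalar c \<in> carrier ?F" for c
    by (auto simp: scalar_def zero_word.rep_eq)
  note IF = I.I_l_closed[simplified free_algebra_simps(2)]
    I.I_r_closed[simplified free_algebra_simps(2)]
  note IRF = IR.I_l_closed[simplified free_algebra_simps(2)]
    IR.I_r_closed[simplified free_algebra_simps(2)]
  have Fm: "a * b \<in> carrier ?F" if "a \<in> carrier ?F" "b \<in> carrier ?F" for a b
    using F.m_closed[OF that] by (simp only: free_algebra_simps(2))
  have Fa: "a + b \<in> carrier ?F" if "a \<in> carrier ?F" "b \<in> carrier ?F" for a b
    using F.a_closed[OF that] by (simp only: free_algebra_simps(3))
  have Ia: "a + b \<in> ?I" if "a \<in> ?I" "b \<in> ?I" for a b
    using additive_subgroup.a_closed[OF I.is_additive_subgroup that] by (simp only: free_algebra_simps(3))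
  have IRa: "a + b \<in> ?IR" if "a \<in> ?IR" "b \<in> ?IR" for a b
    using additive_subgroup.a_closed[OF IR.is_additive_subgroup that] by (simp only: free_algebra_simps(3))
  have J_carrier: "?J \<subseteq> carrier ?F"
  proof
    fix a assume "a \<in> ?J"
    then show "a \<in> carrier ?F"
    proof induction
      case zero then show ?case by simp
    next
      case (add f g c)
      then show ?case using IR.a_subset
        by (intro Fa Fm sc ext) (auto simp del: free_algebra_simps(1))
    qed
  qed
  have elem: "scalar c * extend_scalars f \<in> ?J" if "f \<in> ?IR" for c f
    using scalar_span.add[OF that scalar_span.zero, of c] by simp
  have sumJ: "sum h A \<in> ?J" if "\<And>a. a \<in> A \<Longrightarrow> h a \<in> ?J" for h :: "'v word \<Rightarrow> _" and A
    using that
    by (induction A rule: infinite_finite_induct) (auto intro: scalar_span.zero scalar_span_sum_closed)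
  have mono: "Poly_Mapping.single w b = scalar b * extend_scalars (Poly_Mapping.single w 1)"
    for w :: "'v word" and b :: 'k
    by (simp add: scalar_def extend_scalars_simps mult_single)
  have gen: "scalar b * extend_scalars h * (scalar c * extend_scalars f)
      = scalar (b * c) * extend_scalars (h * f)" for b c :: 'k and h f :: "('v, real) free_alg"
    by (metis (no_types, lifting) extend_scalars_mult mult.assoc scalar_central scalar_mult)
  have word: "Poly_Mapping.single w 1 \<in> carrier ?FR" if "h \<in> carrier ?F" "w \<in> Poly_Mapping.keys h"
    for w and h
    using that by auto
  have "ideal ?J ?F"
  proof (rule ideal_free_algebraI[OF J_carrier scalar_span.zero scalar_span_sum_closed])
    fix a h assume "a \<in> ?J" and h: "h \<in> carrier ?F"
    then show "h * a \<in> ?J"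
    proof induction
      case zero then show ?case by (simp add: scalar_span.zero)
    next
      case (add f g c)
      have "h * (scalar c * extend_scalars f) \<in> ?J"
        by (subst free_alg_expand[of h], unfold sum_distrib_right mono gen)
          (intro sumJ elem IRF add word[OF h])
      then show ?case using add
        by (simp add: distrib_left scalar_span_sum_closed del: free_algebra_simps(1))
    qed
  next
    fix a h assume "a \<in> ?J" and h: "h \<in> carrier ?F"
    then show "a * h \<in> ?J"
    proof induction
      case zero then show ?case by (simp add: scalar_span.zero)
    next
      case (add f g c)
      have "scalar c * extend_scalars f * h \<in> ?J"
        by (subst free_alg_expand[of h], unfold sum_distrib_left mono gen)
          (intro sumJ elem IRF add word[OF h])
      then show ?case using add
        by (simp add: distrib_right scalar_span_sum_closed del: free_algebra_simps(1))
    qed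
  qed
  moreover have "radial_relators S \<subseteq> ?J"
  proof
    fix a :: "('v, 'k) free_alg" assume "a \<in> radial_relators S"
    then obtain u v w where S: "u \<in> S" "v \<in> S" "w \<in> S"
      and a: "a = comm (anticomm (var u) (var v)) (var w)"
      by (auto simp: radial_relators_def)
    let ?f = "comm (anticomm (var u) (var v)) (var w) :: ('v, real) free_alg"
    have "?f \<in> radial_relators S" using S by (auto simp: radial_relators_def)
    then have "?f \<in> ?IR"
      unfolding radial_ideal_def
      using ring.genideal_self[OF ring_free_algebra radial_relators_carrier] by blast
    from elem[OF this, of 1] show "a \<in> ?J"
      by (simp add: a comm_def anticomm_def extend_scalars_simps extend_scalars_mult scalar_def)
  qed
  ultimately show "?I \<subseteq> ?J"
    unfolding radial_ideal_def by (rule F.genideal_minimal)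
  let ?K = "{f \<in> carrier ?FR. extend_scalars f \<in> ?I}"
  have FRm: "a * b \<in> carrier ?FR" if "a \<in> carrier ?FR" "b \<in> carrier ?FR" for a b
    using FR.m_closed[OF that] by (simp only: free_algebra_simps(2))
  have FRa: "a + b \<in> carrier ?FR" if "a \<in> carrier ?FR" "b \<in> carrier ?FR" for a b
    using FR.a_closed[OF that] by (simp only: free_algebra_simps(3))
  have I0: "0 \<in> ?I" using I.zero_closed by simp
  have "ideal ?K ?FR"
    by (rule ideal_free_algebraI)
      (use I0 in \<open>auto simp del: free_algebra_simps(1)
          simp: extend_scalars_simps extend_scalars_mult
          intro: FRm FRa IF Ia ext FR.zero_closed[simplified free_algebra_simps(5)]\<close>)
  moreover have "radial_relators S \<subseteq> ?K"
  proof
    fix a :: "('v, real) free_alg" assume a': "a \<in> radial_relators S"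
    then obtain u v w where S: "u \<in> S" "v \<in> S" "w \<in> S"
      and a: "a = comm (anticomm (var u) (var v)) (var w)"
      by (auto simp: radial_relators_def)
    let ?f = "comm (anticomm (var u) (var v)) (var w) :: ('v, 'k) free_alg"
    have "?f \<in> radial_relators S" using S by (auto simp: radial_relators_def)
    then have "?f \<in> ?I"
      unfolding radial_ideal_def
      using F.genideal_self[OF radial_relators_carrier] by blast
    moreover have "extend_scalars a = ?f"
      by (simp add: a comm_def anticomm_def extend_scalars_simps extend_scalars_mult)
    ultimately show "a \<in> ?K" using subsetD[OF radial_relators_carrier a'] by simp
  qed
  ultimately have K: "?IR \<subseteq> ?K"
    unfolding radial_ideal_def by (rule FR.genideal_minimal)
  show "?J \<subseteq> ?I"
  proof
    fix a assume "a \<in> ?J"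
    then show "a \<in> ?I"
    proof induction
      case zero show ?case by (rule I0)
    next
      case (add f g c)
      then show ?case using K by (intro Ia IF(1)[OF _ sc]) auto
    qed
  qed
qed


text \<open>
  Below, products and sums of vector variables are formed in the free algebra and then
  mapped to the radial algebra by \<open>cls\<close>.
\<close>

definition wedge :: "'v list \<Rightarrow> ('v, 'k::{comm_ring_1, real_algebra_1}) free_alg" where
  "wedge us = scalar (of_real (1 / fact (length us))) *
    (\<Sum>\<pi> | \<pi> permutes {..<length us}.
       of_int (sign \<pi>) * prod_list (map (\<lambda>i. var (us ! \<pi> i)) [0..<length us]))"

text \<open>
  The scalars.  For an ordering \<open>ys\<close> of \<open>Y\<close> (indices start at 0), the symbols \<open>Sc_r\<close>,
  \<open>Sc_s i\<close>, \<open>Sc_c i j\<close> stand for \<open>r = x\<^sup>2\<close>, \<open>s\<^sub>i = {x, y\<^sub>i}\<close>,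
  \<open>c\<^sub>i\<^sub>j = {y\<^sub>i, y\<^sub>j}\<close> (\<open>i \<le> j\<close>).
\<close>

datatype scalar_sym = Sc_r | Sc_s nat | Sc_c nat nat

type_synonym scalar_poly = "(scalar_sym \<Rightarrow>\<^sub>0 nat) \<Rightarrow>\<^sub>0 coeff_ring"

definition scalar_syms :: "nat \<Rightarrow> scalar_sym list" where
  "scalar_syms N = Sc_r # map Sc_s [0..<N] @ [Sc_c i j. i \<leftarrow> [0..<N], j \<leftarrow> [i..<N]]"

definition scalar_polys :: "nat \<Rightarrow> scalar_poly set" where
  "scalar_polys N =
    {A. \<forall>m\<in>Poly_Mapping.keys A. Poly_Mapping.keys m \<subseteq> set (scalar_syms N)}"

fun scalar_val :: "'v \<Rightarrow> 'v list \<Rightarrow> scalar_sym \<Rightarrow> ('v, coeff_ring) free_alg" where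
  "scalar_val x ys Sc_r = var x ^ 2"
| "scalar_val x ys (Sc_s i) = anticomm (var x) (var (ys ! i))"
| "scalar_val x ys (Sc_c i j) = anticomm (var (ys ! i)) (var (ys ! j))"

text \<open>
  The element of the algebra represented by a scalar polynomial.  The order of the factors in a
  monomial is fixed by \<open>scalar_syms\<close>; it does not matter in the radial algebra, where the
  factors are central.
\<close>

definition scalar_eval :: "'v \<Rightarrow> 'v list \<Rightarrow> scalar_poly \<Rightarrow> ('v, coeff_ring) free_alg" where
  "scalar_eval x ys A = (\<Sum>m\<in>Poly_Mapping.keys A. scalar (Poly_Mapping.lookup A m) *
     prod_list (map (\<lambda>z. scalar_val x ys z ^ Poly_Mapping.lookup m z) (scalar_syms (length ys))))"

definition scale_sym :: "scalar_sym \<Rightarrow> coeff_ring \<Rightarrow> scalar_poly \<Rightarrow> scalar_poly" where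
  "scale_sym u P A = Poly_Mapping.mapp (\<lambda>m c. P ^ Poly_Mapping.lookup m u * c) A"

definition jackson :: "scalar_sym \<Rightarrow> coeff_ring \<Rightarrow> scalar_poly \<Rightarrow> scalar_poly" where
  "jackson u P A = (THE G. Poly_Mapping.single 0 (1 - P) *
     Poly_Mapping.single (Poly_Mapping.single u 1) 1 * G = A - scale_sym u P A)"

definition dsc :: "'v \<Rightarrow> 'v list \<Rightarrow> scalar_poly \<Rightarrow> ('v, coeff_ring) free_alg" where
  "dsc x ys A =
     scalar (1 + q_par) * var x * scalar_eval x ys (jackson Sc_r (q_par ^ 2) A) +
     2 * (\<Sum>i<length ys. var (ys ! i) *
            scalar_eval x ys (scale_sym Sc_r (q_par ^ 2) (jackson (Sc_s i) q_par A)))"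

text \<open>
  The finite relative right \<open>q\<close>-vector derivative, for the ordering \<open>ys\<close> of \<open>Y\<close>.
  The list \<open>nths ys I\<close> is \<open>y\<^sub>i\<close> for \<open>i \<in> I\<close> in increasing order, so \<open>wedge (nths ys I)\<close>
  is \<open>y\<^sub>I\<close>.  Operators are extensional functions on the carrier, so that the defining
  properties determine them as functions.
\<close>

definition is_right_qderiv ::
  "'v \<Rightarrow> 'v list \<Rightarrow> (('v, coeff_ring) free_alg set \<Rightarrow> ('v, coeff_ring) free_alg set) \<Rightarrow> bool" where
  "is_right_qderiv x ys D \<longleftrightarrow>
    (let S = insert x (set ys); R = radial S in
      D \<in> carrier R \<rightarrow>\<^sub>E carrier R \<and>
      (\<forall>a\<in>carrier R. \<forall>b\<in>carrier R. D (a \<oplus>\<^bsub>R\<^esub> b) = D a \<oplus>\<^bsub>R\<^esub> D b) \<and>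
      (\<forall>c. \<forall>a\<in>carrier R. D (cls S (scalar c) \<otimes>\<^bsub>R\<^esub> a) = cls S (scalar c) \<otimes>\<^bsub>R\<^esub> D a) \<and>
      (\<forall>I A. I \<subseteq> {..<length ys} \<longrightarrow> A \<in> scalar_polys (length ys) \<longrightarrow>
        D (cls S (wedge (nths ys I) * scalar_eval x ys A)) =
          cls S (wedge (nths ys I) * dsc x ys A)) \<and>
      (\<forall>I B. I \<subseteq> {..<length ys} \<longrightarrow> B \<in> scalar_polys (length ys) \<longrightarrow>
        D (cls S (wedge (x # nths ys I) * scalar_eval x ys B)) =
          cls S (scalar ((- 1) ^ card I * qm_number (- int (card I))) *
                   wedge (nths ys I) * scalar_eval x ys B +
                 scalar (qm_power (- int (card I))) *
                   wedge (x # nths ys I) * dsc x ys B)))"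

definition right_qderiv ::
  "'v \<Rightarrow> 'v list \<Rightarrow> ('v, coeff_ring) free_alg set \<Rightarrow> ('v, coeff_ring) free_alg set" where
  "right_qderiv x ys = (THE D. is_right_qderiv x ys D)"

definition is_ordering :: "'v list \<Rightarrow> 'v set \<Rightarrow> bool" where
  "is_ordering ys Y \<longleftrightarrow> distinct ys \<and> set ys = Y"

end

theory Submission
  imports Defs
begin

text \<open>
  The derivative is given by formulas on the free \<open>A\<^sub>x(Y)\<close>-basis \<open>y\<^sub>I\<close>, \<open>x \<and> y\<^sub>I\<close>, so it exists and is
  unique once these elements are known to be independent and to span.  Both rest on
  \<open>v (u\<^sub>1 \<and> \<dots> \<and> u\<^sub>p) = v \<and> u\<^sub>1 \<and> \<dots> \<and> u\<^sub>p + 1/2 \<Sum>\<^sub>k (- 1)\<^bsup>k - 1\<^esup> {v, u\<^sub>k} (u\<^sub>1 \<and> \<dots> omit u\<^sub>k \<dots> \<and> u\<^sub>p)\<close>.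
  It shows that the span of the basis is closed under left multiplication by vectors.  It also
  shows that, when a vector \<open>v\<close> acts on the exterior algebra over the scalar polynomials as
  exterior plus interior multiplication by \<open>v\<close>, a wedge product sends \<open>1\<close> to itself, which gives
  independence.  Reordering \<open>Y\<close> changes \<open>y\<^sub>I\<close> and \<open>x \<and> y\<^sub>I\<close> by the same sign and permutes the scalar
  variables, so the derivative of one ordering satisfies the formulas for the other; along a
  bijection the formulas are transported literally, and uniqueness does the rest.
\<close>

text \<open>\<open>right_qderiv\<close> is a \<open>THE\<close>, so nothing can be said about it,
  even for one ordering, before existence and uniqueness are known. The obstacle is that
  \<open>wedge\<close> averages over all permutations, whereas the product of a vector with a wedge
  is recursive in the factors. Therefore \<open>qwedge\<close> is defined by that recursion, shown
  to be alternating, and then identified with the average: a product of vectors differs from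
  \<open>qwedge\<close> only by terms invariant under some transposition, and these average to zero.
  Independence cannot be read off from generators and relations; it needs a module on which the
  relations hold. The form of the Clifford module is generic: its entries are the scalar variables
  themselves, up to the factor 1/2 forced by \<open>{u, v} = 2 b(u, v)\<close>. A scalar polynomial
  then acts as multiplication by itself, so the image of 1 shows both the exterior coordinate and
  the polynomial standing there. This is where algebraic independence of the scalars comes
  from.\<close>

lemma poly_mapping_expand:
  fixes p :: "'a \<Rightarrow>\<^sub>0 'b::comm_monoid_add"
  shows
  "p = (\<Sum>k\<in>Poly_Mapping.keys p. Poly_Mapping.single k (Poly_Mapping.lookup p k))"
  by (rule poly_mapping_eqI)
    (auto simp: lookup_sum lookup_single when_def in_keys_iff sum.delta)

text \<open>The single case is asked only for monomials of the given \<open>p\<close>, with any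
  coefficient, so a condition on the words of \<open>p\<close> is available there, while the sum
  case stays unrestricted.\<close>

lemma poly_mapping_keys_induct [case_names zero single add]:
  fixes p :: "'a \<Rightarrow>\<^sub>0 'b::comm_monoid_add"
  assumes "P 0" "\<And>k c. k \<in> Poly_Mapping.keys p \<Longrightarrow> P (Poly_Mapping.single k c)"
    and add: "\<And>f g. P f \<Longrightarrow> P g \<Longrightarrow> P (f + g)"
  shows "P p"
proof -
  have "P (\<Sum>k\<in>A. Poly_Mapping.single k (Poly_Mapping.lookup p k))"
    if "A \<subseteq> Poly_Mapping.keys p" for A
    using that assms by (induction A rule: infinite_finite_induct) auto
  from this[OF subset_refl] show ?thesis
    by (simp flip: poly_mapping_expand)
qed

section \<open>Words and scalars in the free algebra\<close>

lemma zero_eq_Word: "0 = Word []"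
  by (simp add: zero_word_def)

lemma Word_plus: "Word us + Word vs = Word (us @ vs)"
  by (simp add: plus_word_def Word_inverse)

lemma single_eq_scalar_prod:
  fixes w :: "'v word" and c :: "'k::comm_ring_1"
  shows "Poly_Mapping.single w c = scalar c * prod_list (map var (letters w))"
proof -
  have "prod_list (map var us) = (Poly_Mapping.single (Word us) 1 :: ('v, 'k) free_alg)"
    for us :: "'v list"
    by (induction us) (simp_all add: var_def mult_single Word_plus flip: zero_eq_Word)
  then show ?thesis
    by (simp add: scalar_def mult_single letters_inverse)
qed

lemma scalar_simps:
  "scalar 0 = 0" "scalar 1 = 1" "scalar (a + b) = scalar a + scalar b"
  "scalar (a - b) = scalar a - scalar b" "scalar (- a) = - scalar a"
  by (simp_all add: scalar_def single_add single_diff single_uminus)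

subsection \<open>The radial algebra on all variables\<close>

text \<open>The relations among all variables of the type are imposed at once, which makes the quotient
  a type; \<open>rad_of_eq_iff_cls_eq\<close> shows that it contains every \<open>radial S\<close>.\<close>

inductive_set rad_null :: "('v, 'k::comm_ring_1) free_alg set" where
  relator: "comm (anticomm (var u) (var v)) (var w) \<in> rad_null"
| zero: "0 \<in> rad_null"
| add: "a \<in> rad_null \<Longrightarrow> b \<in> rad_null \<Longrightarrow> a + b \<in> rad_null"
| lmult: "a \<in> rad_null \<Longrightarrow> f * a \<in> rad_null"
| rmult: "a \<in> rad_null \<Longrightarrow> a * f \<in> rad_null"

lemma rad_null_uminus: "a \<in> rad_null \<Longrightarrow> - a \<in> rad_null"
  using rad_null.lmult[of a "- 1"] by simp

lemma rad_null_diff: "a \<in> rad_null \<Longrightarrow> b \<in> rad_null \<Longrightarrow> a - b \<in> rad_null"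
  using rad_null.add[OF _ rad_null_uminus, of a b] by simp

quotient_type (overloaded) ('v, 'k) rad = "('v, 'k::comm_ring_1) free_alg" / "\<lambda>f g. f - g \<in> rad_null"
proof (rule equivpI)
  show "reflp (\<lambda>f g. f - g \<in> rad_null)"
    by (simp add: reflp_def rad_null.zero)
  show "symp (\<lambda>f g. f - g \<in> rad_null)"
    using rad_null_uminus by (fastforce simp: symp_def)
  show "transp (\<lambda>f g. f - g \<in> rad_null)"
    using rad_null.add by (fastforce simp: transp_def)
qed

instantiation rad :: (type, comm_ring_1) ring
begin

lift_definition zero_rad :: "('a, 'b) rad" is 0 .
lift_definition plus_rad :: "('a, 'b) rad \<Rightarrow> ('a, 'b) rad \<Rightarrow> ('a, 'b) rad" is "(+)"
  using rad_null.add by (fastforce simp: algebra_simps)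
lift_definition uminus_rad :: "('a, 'b) rad \<Rightarrow> ('a, 'b) rad" is uminus
  using rad_null_uminus by fastforce
lift_definition minus_rad :: "('a, 'b) rad \<Rightarrow> ('a, 'b) rad \<Rightarrow> ('a, 'b) rad" is "(-)"
  using rad_null_diff by (fastforce simp: algebra_simps)
lift_definition times_rad :: "('a, 'b) rad \<Rightarrow> ('a, 'b) rad \<Rightarrow> ('a, 'b) rad" is "(*)"
proof -
  fix f f' g g' :: "('a, 'b) free_alg"
  assume "f - f' \<in> rad_null" "g - g' \<in> rad_null"
  then have "(f - f') * g + f' * (g - g') \<in> rad_null"
    by (intro rad_null.intros)
  then show "f * g - f' * g' \<in> rad_null"
    by (simp add: algebra_simps)
qed

instance
  by standard (transfer; simp add: algebra_simps rad_null.zero)+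

end

definition rad_of :: "('v, 'k::comm_ring_1) free_alg \<Rightarrow> ('v, 'k) rad" where
  "rad_of = abs_rad"

lemma rad_of_hom:
  "rad_of 0 = 0" "rad_of (f + g) = rad_of f + rad_of g" "rad_of (f - g) = rad_of f - rad_of g"
  "rad_of (- f) = - rad_of f" "rad_of (f * g) = rad_of f * rad_of g"
  by (simp_all add: rad_of_def zero_rad_def plus_rad.abs_eq minus_rad.abs_eq uminus_rad.abs_eq
      times_rad.abs_eq)

lemma rad_of_eq_iff: "rad_of f = rad_of g \<longleftrightarrow> f - g \<in> rad_null"
  by (simp add: rad_of_def rad.abs_eq_iff)

lemma rad_of_surj: obtains f where "z = rad_of f"
  using rad.abs_induct[of "\<lambda>z. \<exists>f. z = rad_of f" z] by (auto simp: rad_of_def)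

text \<open>\<open>ring_1\<close> would include \<open>0 \<noteq> 1\<close>, and nontriviality of
  the quotient becomes visible only through the Clifford action; \<open>monoid_mult\<close> supplies
  the unit without it.\<close>

instantiation rad :: (type, "{comm_ring_1, real_algebra_1}") "{real_algebra, monoid_mult}"
begin

definition one_rad :: "('a, 'b) rad" where
  "one_rad = rad_of 1"

definition scaleR_rad :: "real \<Rightarrow> ('a, 'b) rad \<Rightarrow> ('a, 'b) rad" where
  "scaleR_rad t z = rad_of (scalar (of_real t)) * z"

instance
proof
  fix a b :: real and x y :: "('a, 'b) rad"
  obtain f where f: "x = rad_of f" by (rule rad_of_surj)
  show "1 * x = x" "x * 1 = x"
    by (simp_all add: one_rad_def f flip: rad_of_hom)
  show "a *\<^sub>R (x + y) = a *\<^sub>R x + a *\<^sub>R y" "(a + b) *\<^sub>R x = a *\<^sub>R x + b *\<^sub>R x"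
    "a *\<^sub>R b *\<^sub>R x = (a * b) *\<^sub>R x" "a *\<^sub>R x * y = a *\<^sub>R (x * y)"
    by (simp_all add: scaleR_rad_def algebra_simps scalar_simps scalar_mult rad_of_hom)
  show "1 *\<^sub>R x = x"
    by (simp add: scaleR_rad_def f scalar_simps flip: rad_of_hom)
  obtain g where g: "y = rad_of g" by (rule rad_of_surj)
  have "f * (scalar (of_real a) * g) = scalar (of_real a) * (f * g)"
    by (metis mult.assoc scalar_central)
  then show "x * a *\<^sub>R y = a *\<^sub>R (x * y)"
    by (simp add: scaleR_rad_def f g flip: rad_of_hom)
qed

end

subsection \<open>Alternating functions and the wedge product\<close>

text \<open>\<open>contract b v F [u\<^sub>1, \<dots>, u\<^sub>p] = \<Sum>\<^sub>k (- 1)\<^bsup>k - 1\<^esup> b v u\<^sub>k F [\<dots>, u\<^sub>k omitted, \<dots>]\<close>\<close>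

primrec contract :: "('v \<Rightarrow> 'v \<Rightarrow> 'r::ring) \<Rightarrow> 'v \<Rightarrow> ('v list \<Rightarrow> 'r) \<Rightarrow> 'v list \<Rightarrow> 'r" where
  "contract b v F [] = 0"
| "contract b v F (u # us) = b v u * F us - contract b v (\<lambda>l. F (u # l)) us"

lemma contract_cong_sub:
  assumes "\<And>l. Suc (length l) = length us \<Longrightarrow> F l = G l"
  shows "contract b v F us = contract b v G us"
  using assms
proof (induction us arbitrary: F G)
  case (Cons u us)
  have "contract b v (\<lambda>l. F (u # l)) us = contract b v (\<lambda>l. G (u # l)) us"
    by (rule Cons.IH, rule Cons.prems) simp
  moreover have "F us = G us"
    by (rule Cons.prems) simp
  ultimately show ?case by simp
qed simp

text \<open>Lets the definition of \<open>qwedge\<close> pass itself to \<open>contract\<close>: the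
  termination proof sees that the function is called only on lists shorter than
  \<open>vs\<close>.\<close>

lemma contract_cong [fundef_cong]:
  assumes "us = vs" "\<And>l. length l < length vs \<Longrightarrow> F l = G l"
  shows "contract b v F us = contract b v G vs"
  unfolding assms(1) by (rule contract_cong_sub, rule assms(2)) simp

lemma contract_uminus: "contract b v (\<lambda>l. - F l) us = - contract b v F us"
  by (induction us arbitrary: F) (simp_all add: algebra_simps)

lemma contract_diff: "contract b v (\<lambda>l. F l - G l) us = contract b v F us - contract b v G us"
  by (induction us arbitrary: F G) (simp_all add: algebra_simps)

lemma contract_scaleR:
  fixes F :: "'v list \<Rightarrow> 'r::real_algebra"
  shows "contract b v (\<lambda>l. t *\<^sub>R F l) us = t *\<^sub>R contract b v F us"
  by (induction us arbitrary: F) (simp_all add: algebra_simps)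

lemma contract_mult_left:
  assumes "\<And>u v. b u v * z = z * b u v"
  shows "contract b v (\<lambda>l. z * F l) us = z * contract b v F us"
proof (induction us arbitrary: F)
  case (Cons u us)
  have "b v u * (z * F us) = z * (b v u * F us)"
    by (metis assms mult.assoc)
  then show ?case using Cons by (simp add: algebra_simps)
qed simp

text \<open>A new head \<open>w\<close> contributes
  \<open>b u w * contract b v F us - b v w * contract b u F us\<close>, which is antisymmetric in
  \<open>u\<close> and \<open>v\<close>; the remaining term is a double contraction of the
  tail.\<close>

lemma contract_anticommute:
  assumes "\<And>u v z. b u v * z = z * b u v"
  shows "contract b u (contract b v F) us = - contract b v (contract b u F) us"
proof (induction us arbitrary: F)
  case (Cons w us)
  show ?case
    by (simp add: contract_diff contract_mult_left[OF assms] Cons.IH[of "\<lambda>l. F (w # l)"])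
qed simp

lemma contract_eq_sum:
  fixes F :: "'v list \<Rightarrow> 'r::real_algebra"
  shows "contract b v F us =
    (\<Sum>k<length us. (- 1) ^ k *\<^sub>R (b v (us ! k) * F (take k us @ drop (Suc k) us)))"
proof (induction us arbitrary: F)
  case (Cons u us)
  then show ?case
    by (simp add: sum.lessThan_Suc_shift sum_negf del: sum.lessThan_Suc)
qed simp

section \<open>Alternating functions of lists\<close>

definition alternating :: "('v list \<Rightarrow> 'r::real_vector) \<Rightarrow> bool" where
  "alternating F \<longleftrightarrow> (\<forall>as u v bs. F (as @ u # v # bs) = - F (as @ v # u # bs))"

lemma alternatingD: "alternating F \<Longrightarrow> F (as @ u # v # bs) = - F (as @ v # u # bs)"
  unfolding alternating_def by blast

lemma alternating_prefix: "alternating F \<Longrightarrow> alternating (\<lambda>l. F (as @ l))"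
  unfolding alternating_def by (metis (no_types) append.assoc)

text \<open>Three sign changes: swap \<open>u\<close> past \<open>b\<close>, exchange over the
  shorter gap, swap \<open>v\<close> past \<open>b\<close>.\<close>

lemma alternating_exchange:
  assumes "alternating F"
  shows "F (as @ u # bs @ v # cs) = - F (as @ v # bs @ u # cs)"
proof (induction bs arbitrary: as)
  case Nil
  then show ?case using alternatingD[OF assms, of as u v cs] by simp
next
  case (Cons b bs)
  show ?case
    using Cons[of "as @ [b]"] alternatingD[OF assms, of as u b "bs @ v # cs"]
      alternatingD[OF assms, of as b v "bs @ u # cs"] by simp
qed

lemma alternating_not_distinct:
  fixes F :: "'v list \<Rightarrow> 'r::real_vector"
  assumes "alternating F" "\<not> distinct us"
  shows "F us = 0"
proof -
  obtain as bs cs u where "us = as @ [u] @ bs @ [u] @ cs"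
    using not_distinct_decomp[OF assms(2)] by blast
  then have "F us = - F us"
    using alternating_exchange[OF assms(1), of as u bs u cs] by simp
  then have "2 *\<^sub>R F us = 0"
    by (simp add: scaleR_2 eq_neg_iff_add_eq_0)
  then show ?thesis by simp
qed

lemma alternating_move_to_front:
  "alternating F \<Longrightarrow> F (as @ u # bs) = (- 1) ^ length as *\<^sub>R F (u # as @ bs)"
proof (induction as arbitrary: F)
  case (Cons a as)
  have "F (a # as @ u # bs) = (- 1) ^ length as *\<^sub>R F (a # u # as @ bs)"
    using Cons.IH[OF alternating_prefix[OF Cons.prems, of "[a]"]] by simp
  also have "F (a # u # as @ bs) = - F (u # a # as @ bs)"
    using alternatingD[OF Cons.prems, of "[]" a u "as @ bs"] by simp
  finally show ?case by simp
qed simp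

text \<open>The sign is chosen before \<open>F\<close>. This uniformity gives
  \<open>y\<^sub>I\<close> and \<open>x \<and> y\<^sub>I\<close> the same sign when \<open>Y\<close>
  is reordered, by taking for \<open>F\<close> the wedge and the wedge prefixed with
  \<open>x\<close>.\<close>

lemma alternating_mset:
  assumes "mset us = mset vs"
  obtains \<epsilon> :: real where "\<epsilon> = 1 \<or> \<epsilon> = - 1"
    and "\<And>F :: 'v list \<Rightarrow> 'r::real_vector. alternating F \<Longrightarrow> F us = \<epsilon> *\<^sub>R F vs"
proof -
  have "\<exists>\<epsilon>::real. (\<epsilon> = 1 \<or> \<epsilon> = - 1) \<and>
      (\<forall>F :: 'v list \<Rightarrow> 'r. alternating F \<longrightarrow> F us = \<epsilon> *\<^sub>R F vs)"
    using assms
  proof (induction us arbitrary: vs)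
    case Nil
    then show ?case by (intro exI[of _ 1]) simp
  next
    case (Cons u us)
    then have "u \<in> set vs" by (metis list.set_intros(1) mset_eq_setD)
    then obtain as bs where vs: "vs = as @ u # bs"
      by (meson split_list)
    then have "mset us = mset (as @ bs)" using Cons.prems by simp
    from Cons.IH[OF this] obtain \<epsilon> :: real where \<epsilon>: "\<epsilon> = 1 \<or> \<epsilon> = - 1"
      and IH: "\<And>F :: 'v list \<Rightarrow> 'r. alternating F \<Longrightarrow> F us = \<epsilon> *\<^sub>R F (as @ bs)"
      by blast
    show ?case
    \<comment> \<open>Matching \<open>us\<close> with \<open>as @ bs\<close> costs
      \<open>\<epsilon>\<close>, and bringing \<open>u\<close> to its place behind \<open>as\<close>
      costs one sign for each entry of \<open>as\<close>.\<close>
    proof (intro exI[of _ "\<epsilon> * (- 1) ^ length as"] conjI allI impI)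
      show "\<epsilon> * (- 1) ^ length as = 1 \<or> \<epsilon> * (- 1) ^ length as = - 1"
        using \<epsilon> by (cases "even (length as)") auto
      fix F :: "'v list \<Rightarrow> 'r" assume F: "alternating F"
      from IH[OF alternating_prefix[OF F, of "[u]"]] alternating_move_to_front[OF F, of as u bs]
      show "F (u # us) = (\<epsilon> * (- 1) ^ length as) *\<^sub>R F vs"
        by (simp add: vs flip: power_mult_distrib)
    qed
  qed
  then show thesis using that by blast
qed

text \<open>The terms omitting \<open>u\<close> and \<open>v\<close> trade places with opposite
  signs; in all others the two stay adjacent. The hypothesis on \<open>F\<close> concerns only lists
  shorter by one, because the rule is applied inside the induction on length that proves
  \<open>qwedge\<close> alternating.\<close>

lemma contract_swap_adjacent:
  fixes F :: "'v list \<Rightarrow> 'r::{real_algebra}"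
  assumes "\<And>as u v bs. Suc (length (as @ u # v # bs)) = n \<Longrightarrow> F (as @ u # v # bs) = - F (as @ v # u # bs)"
    and "length (as @ u # v # bs) = n"
  shows "contract b w F (as @ u # v # bs) = - contract b w F (as @ v # u # bs)"
  using assms
proof (induction as arbitrary: F n)
  case Nil
  have "contract b w (\<lambda>l. F (u # v # l)) bs = contract b w (\<lambda>l. - F (v # u # l)) bs"
  proof (rule contract_cong_sub)
    show "F (u # v # l) = - F (v # u # l)" if "Suc (length l) = length bs" for l
      using Nil(1)[of "[]" u v l] Nil(2) that by simp
  qed
  then show ?case by (simp add: contract_uminus algebra_simps)
next
  case (Cons a as)
  have "contract b w (\<lambda>l. F (a # l)) (as @ u # v # bs) = - contract b w (\<lambda>l. F (a # l)) (as @ v # u # bs)"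
  proof (rule Cons.IH[of "n - 1"])
    show "F (a # as @ u # v # bs) = - F (a # as @ v # u # bs)"
      if "Suc (length (as @ u # v # bs)) = n - 1" for as u v bs
      using Cons.prems(1)[of "a # as" u v bs] that by simp
  qed (use Cons.prems(2) in simp)
  with Cons.prems(1)[of as u v bs] Cons.prems(2) show ?case by simp
qed

lemma map_transpose_upt:
  assumes "i < n" "j < n"
  shows "map (\<lambda>k. f (transpose i j k)) [0..<n] =
    (map f [0..<n])[i := map f [0..<n] ! j, j := map f [0..<n] ! i]"
  by (rule nth_equalityI) (use assms in \<open>auto simp: nth_list_update transpose_def\<close>)

lemma alternating_swap:
  assumes F: "alternating F" and "i < length us" "j < length us" "i \<noteq> j"
  shows "F (us[i := us ! j, j := us ! i]) = - F us"
proof -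
  have *: "F (us[i := us ! j, j := us ! i]) = - F us" if "i < j" "j < length us" for i j
  proof -
    define as bs cs where "as = take i us" and "bs = take (j - Suc i) (drop (Suc i) us)"
      and "cs = drop (Suc j) us"
    have "drop (Suc i) us = bs @ us ! j # cs"
      using that id_take_nth_drop[of "j - Suc i" "drop (Suc i) us"] by (simp add: bs_def cs_def)
    then have us: "us = as @ us ! i # bs @ us ! j # cs"
      using that id_take_nth_drop[of i us] by (simp add: as_def)
    have len: "length as = i" "length bs = j - Suc i"
      using that by (auto simp: as_def bs_def)
    have "(as @ a # bs @ b # cs)[i := b, j := a] = as @ b # bs @ a # cs" for a b
    proof -
      have ij: "i = length as" "j = length as + Suc (length bs)" using that len by auto
      show ?thesis unfolding ij by (simp add: list_update_append)
    qed
    then have "us[i := us ! j, j := us ! i] = as @ us ! j # bs @ us ! i # cs"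
      using us by metis
    then show ?thesis
      using us alternating_exchange[OF F] by metis
  qed
  show ?thesis
    using *[of i j] *[of j i] assms by (cases "i < j") (auto simp: list_update_swap)
qed

lemma alternating_permute:
  assumes F: "alternating F" and \<pi>: "\<pi> permutes {..<length us}"
  shows "F (map (\<lambda>i. us ! \<pi> i) [0..<length us]) = real_of_int (sign \<pi>) *\<^sub>R F us"
  using finite_lessThan \<pi>
proof (induction rule: permutes_rev_induct)
  case id
  then show ?case by (simp add: map_nth)
next
  case (swap a b p)
  define vs where "vs = map (\<lambda>i. us ! p i) [0..<length us]"
  have "permutation p" using swap(4) finite_lessThan by (rule permutation_permutes[THEN iffD2, OF exI, OF conjI, rotated])
  then have "sign (p \<circ> transpose a b) = - sign p"
    using swap(3) by (simp add: sign_compose permutation_swap_id sign_swap_id)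
  moreover have "F (map (\<lambda>i. us ! (p \<circ> transpose a b) i) [0..<length us]) = - F vs"
    using alternating_swap[OF F, of a vs b] map_transpose_upt[of a "length us" b "\<lambda>i. us ! p i"] swap
    by (simp add: vs_def)
  ultimately show ?case using swap(5) by (simp only: vs_def) simp
qed

section \<open>Antisymmetrisation over all permutations\<close>

definition antisym_sum :: "('v list \<Rightarrow> 'r::real_vector) \<Rightarrow> 'v list \<Rightarrow> 'r" where
  "antisym_sum F us = (\<Sum>\<pi> | \<pi> permutes {..<length us}.
     real_of_int (sign \<pi>) *\<^sub>R F (map (\<lambda>i. us ! \<pi> i) [0..<length us]))"

lemma antisym_sum_alternating:
  assumes "alternating F"
  shows "antisym_sum F us = fact (length us) *\<^sub>R F us"
proof -
  have "antisym_sum F us = (\<Sum>\<pi> | \<pi> permutes {..<length us}. F us)"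
    unfolding antisym_sum_def
    by (rule sum.cong) (simp_all add: alternating_permute[OF assms] flip: of_int_mult)
  then show ?thesis
    by (simp add: card_permutations scaleR_conv_of_real sum_constant_scaleR)
qed

lemma antisym_sum_add: "antisym_sum (\<lambda>l. F l + G l) us = antisym_sum F us + antisym_sum G us"
  by (simp add: antisym_sum_def scaleR_add_right sum.distrib)

text \<open>Finite sums of functions on lists of length \<open>n\<close>, each invariant under some
  transposition of two positions. The transposition may differ from summand to summand, hence an
  inductive closure instead of a single symmetry; \<open>cong\<close> ignores values at other
  lengths.\<close>

inductive symmetric_part :: "nat \<Rightarrow> ('v list \<Rightarrow> 'r::real_vector) \<Rightarrow> bool" for n where
  swap: "i < j \<Longrightarrow> j < n \<Longrightarrow>
    (\<And>us. length us = n \<Longrightarrow> F (us[i := us ! j, j := us ! i]) = F us) \<Longrightarrow> symmetric_part n F"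
| zero: "symmetric_part n (\<lambda>us. 0)"
| add: "symmetric_part n F \<Longrightarrow> symmetric_part n G \<Longrightarrow> symmetric_part n (\<lambda>us. F us + G us)"
| cong: "symmetric_part n F \<Longrightarrow> (\<And>us. length us = n \<Longrightarrow> G us = F us) \<Longrightarrow> symmetric_part n G"

text \<open>Composing \<open>\<pi>\<close> with the transposition reverses its sign and preserves
  the value of \<open>F\<close>, so the sum equals its own negative.\<close>

lemma antisym_sum_symmetric:
  assumes "symmetric_part n F" "length us = n"
  shows "antisym_sum F us = 0"
  using assms
proof induction
  case (swap i j F)
  let ?t = "\<lambda>\<pi>. \<pi> \<circ> transpose i j"
  have ij: "transpose i j permutes {..<n}"
    using swap by (intro permutes_swap_id) auto
  have "antisym_sum F us = (\<Sum>\<pi> | \<pi> permutes {..<n}.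
     real_of_int (sign (?t \<pi>)) *\<^sub>R F (map (\<lambda>i. us ! (?t \<pi>) i) [0..<n]))"
    unfolding antisym_sum_def swap(4)
    by (rule sum.reindex_bij_witness[of _ ?t ?t])
      (auto simp: comp_assoc intro: permutes_compose[OF ij])
  also have "\<dots> = (\<Sum>\<pi> | \<pi> permutes {..<n}.
     - (real_of_int (sign \<pi>) *\<^sub>R F (map (\<lambda>i. us ! \<pi> i) [0..<n])))"
  proof (rule sum.cong, goal_cases)
    case (2 \<pi>)
    then have "permutation \<pi>" using finite_lessThan permutation_permutes by blast
    then have "sign (?t \<pi>) = - sign \<pi>"
      using swap(1) by (simp add: sign_compose permutation_swap_id sign_swap_id)
    then show ?case
      using swap(3)[of "map (\<lambda>i. us ! \<pi> i) [0..<n]"] map_transpose_upt[of i n j "\<lambda>i. us ! \<pi> i"] swap(1,2)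
      by simp
  qed simp
  also have "\<dots> = - antisym_sum F us"
    by (simp add: antisym_sum_def swap(4) sum_negf)
  finally have "2 *\<^sub>R antisym_sum F us = 0"
    by (simp add: scaleR_2 eq_neg_iff_add_eq_0)
  then show ?case by simp
next
  case zero
  then show ?case by (simp add: antisym_sum_def)
next
  case (add F G)
  then show ?case by (simp add: antisym_sum_add)
next
  case (cong F G)
  have "antisym_sum G us = antisym_sum F us"
    unfolding antisym_sum_def by (rule sum.cong) (simp_all add: cong)
  then show ?case using cong by simp
qed

lemma symmetric_part_sum:
  "(\<And>k. k \<in> A \<Longrightarrow> symmetric_part n (F k)) \<Longrightarrow> symmetric_part n (\<lambda>us. \<Sum>k\<in>A. F k us)"
  by (induction A rule: infinite_finite_induct)
    (auto intro: symmetric_part.zero symmetric_part.add)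

lemma symmetric_part_scaleR:
  "symmetric_part n F \<Longrightarrow> symmetric_part n (\<lambda>us. t *\<^sub>R F us)"
proof (induction rule: symmetric_part.induct)
  case (swap i j F)
  then show ?case by (intro symmetric_part.swap[of i j]) auto
next
  case (add F G)
  then show ?case by (auto simp: scaleR_add_right intro: symmetric_part.add)
next
  case (cong F G)
  show ?case by (rule symmetric_part.cong[OF cong(3)]) (simp add: cong(2))
qed (simp add: symmetric_part.zero)

text \<open>Both positions of the transposition move up by one, past the new head.\<close>

lemma symmetric_part_prefix:
  fixes F :: "'v list \<Rightarrow> 'r::real_algebra"
  shows "symmetric_part n F \<Longrightarrow> symmetric_part (Suc n) (\<lambda>us. g (hd us) * F (tl us))"
proof (induction rule: symmetric_part.induct)
  case (swap i j F)
  show ?case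
  proof (rule symmetric_part.swap[of "Suc i" "Suc j"])
    fix us :: "'v list" assume "length us = Suc n"
    then obtain v vs where us: "us = v # vs" "length vs = n"
      by (cases us) auto
    then show "g (hd (us[Suc i := us ! Suc j, Suc j := us ! Suc i])) *
        F (tl (us[Suc i := us ! Suc j, Suc j := us ! Suc i])) = g (hd us) * F (tl us)"
      using swap(3)[of vs] by simp
  qed (use swap in auto)
next
  case zero
  show ?case by (simp add: symmetric_part.zero)
next
  case (add F G)
  then show ?case by (auto simp: distrib_left intro: symmetric_part.add)
next
  case (cong F G)
  show ?case by (rule symmetric_part.cong[OF cong(3)]) (simp add: cong(2))
qed

text \<open>The term for position \<open>k\<close> of the tail contains the head and that entry only
  through the symmetric \<open>b\<close>, so swapping positions \<open>0\<close> and
  \<open>Suc k\<close> preserves it.\<close>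

lemma symmetric_part_contract:
  fixes F :: "'v list \<Rightarrow> 'r::real_algebra"
  assumes b: "\<And>u v. b u v = b v u"
  shows "symmetric_part (Suc n) (\<lambda>us. contract b (hd us) F (tl us))"
proof (rule symmetric_part.cong)
  show "symmetric_part (Suc n) (\<lambda>us. \<Sum>k<n. (- 1) ^ k *\<^sub>R (b (us ! 0) (us ! Suc k) *
      F (take k (tl us) @ drop (Suc k) (tl us))))"
  proof (intro symmetric_part_sum symmetric_part_scaleR, goal_cases)
    case (1 k)
    show ?case
    proof (rule symmetric_part.swap[of 0 "Suc k"])
      fix us :: "'v list" assume "length us = Suc n"
      then obtain v vs where us: "us = v # vs" "length vs = n"
        by (cases us) auto
      then show "b (us[0 := us ! Suc k, Suc k := us ! 0] ! 0) (us[0 := us ! Suc k, Suc k := us ! 0] ! Suc k) *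
        F (take k (tl (us[0 := us ! Suc k, Suc k := us ! 0])) @
           drop (Suc k) (tl (us[0 := us ! Suc k, Suc k := us ! 0]))) =
        b (us ! 0) (us ! Suc k) * F (take k (tl us) @ drop (Suc k) (tl us))"
        using 1 b by simp
    qed (use 1 in auto)
  qed
  fix us :: "'v list" assume "length us = Suc n"
  then obtain v vs where us: "us = v # vs" "length vs = n"
    by (cases us) auto
  then show "contract b (hd us) F (tl us) = (\<Sum>k<n. (- 1) ^ k *\<^sub>R (b (us ! 0) (us ! Suc k) *
      F (take k (tl us) @ drop (Suc k) (tl us))))"
    by (simp add: contract_eq_sum)
qed

section \<open>The wedge product by recursion\<close>

locale central_anticommutators =
  fixes g :: "'v \<Rightarrow> 'r::{real_algebra, monoid_mult}"
  assumes anticomm_central: "anticomm (g u) (g v) * z = z * anticomm (g u) (g v)"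
begin

abbreviation form :: "'v \<Rightarrow> 'v \<Rightarrow> 'r" where
  "form u v \<equiv> anticomm (g u) (g v)"

lemma form_commute: "form u v = form v u"
  by (simp add: anticomm_def add.commute)

text \<open>Since \<open>form u v\<close> is twice the inner product of the two vectors, half of
  \<open>contract form v\<close> is interior multiplication by \<open>v\<close>; subtracting it from
  the product leaves the exterior part.\<close>

fun qwedge :: "'v list \<Rightarrow> 'r" where
  "qwedge [] = 1"
| "qwedge (v # us) = g v * qwedge us - (1 / 2) *\<^sub>R contract form v qwedge us"

text \<open>In the sum of both sides the single contractions cancel in pairs, the double
  contractions cancel by \<open>contract_anticommute\<close>, and \<open>{g u, g v}\<close> cancels
  against the two halves of \<open>form\<close>.\<close>

lemma qwedge_swap: "qwedge (u # v # us) = - qwedge (v # u # us)"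
proof -
  have c: "contract form u (\<lambda>l. g v * qwedge l - (1 / 2) *\<^sub>R contract form v qwedge l) us =
      g v * contract form u qwedge us - (1 / 2) *\<^sub>R contract form u (contract form v qwedge) us" for u v
    by (simp add: contract_diff contract_scaleR contract_mult_left[OF anticomm_central])
  have "qwedge (u # v # us) + qwedge (v # u # us) = 
    (g u * g v + g v * g u) * qwedge us - (1 / 2) *\<^sub>R (form u v * qwedge us + form v u * qwedge us)"
    by (simp add: c contract_anticommute[of form u v qwedge us, OF anticomm_central] algebra_simps)
  also have "\<dots> = 0"
    by (simp add: form_commute[of v u] flip: scaleR_2) (simp add: anticomm_def)
  finally show ?thesis by (simp only: eq_neg_iff_add_eq_0)
qed

lemma alternating_qwedge: "alternating qwedge"
proof -
  have "qwedge (as @ u # v # bs) = - qwedge (as @ v # u # bs)" for as u v bs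
  proof (induction "length (as @ u # v # bs)" arbitrary: as u v bs rule: less_induct)
    case less
    show ?case
    proof (cases as)
      case Nil
      then show ?thesis using qwedge_swap by simp
    next
      case (Cons a as')
      have "contract form a qwedge (as' @ u # v # bs) = - contract form a qwedge (as' @ v # u # bs)"
        \<comment> \<open>The pair lies in the tail, so the contraction meets only lists shorter by
          two than the whole and the induction hypothesis applies.\<close>
        by (rule contract_swap_adjacent[OF _ refl], rule less(1)) (simp add: Cons)
      then show ?thesis using less[of as' u v bs] by (simp add: Cons)
    qed
  qed
  then show ?thesis unfolding alternating_def by blast
qed

text \<open>By the recursion for \<open>qwedge\<close>, the difference at \<open>v # us\<close> is
  \<open>g v\<close> times the difference at \<open>us\<close> plus half a contraction, and both are
  symmetric parts.\<close>

lemma symmetric_part_prod_minus_qwedge: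
  "symmetric_part n (\<lambda>us. prod_list (map g us) - qwedge us)"
proof (induction n)
  case 0
  show ?case by (rule symmetric_part.cong[OF symmetric_part.zero]) simp
next
  case (Suc n)
  show ?case
  proof (rule symmetric_part.cong[OF symmetric_part.add[OF symmetric_part_prefix[OF Suc]
          symmetric_part_scaleR[OF symmetric_part_contract]]])
    show "form u v = form v u" for u v by (rule form_commute)
    fix us :: "'v list" assume "length us = Suc n"
    then obtain v vs where us: "us = v # vs"
      by (cases us) auto
    then show "prod_list (map g us) - qwedge us =
      g (hd us) * (prod_list (map g (tl us)) - qwedge (tl us)) +
      (1 / 2) *\<^sub>R contract form (hd us) qwedge (tl us)"
      by (simp add: algebra_simps)
  qed
qed

text \<open>Products differ from \<open>qwedge\<close> by terms containing a factor \<open>{u\<^sub>i, u\<^sub>j}\<close>, which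
  antisymmetrisation kills.\<close>

lemma qwedge_eq_antisym_prod:
  "qwedge us = (1 / fact (length us)) *\<^sub>R antisym_sum (\<lambda>l. prod_list (map g l)) us"
proof -
  have "antisym_sum (\<lambda>l. (prod_list (map g l) - qwedge l) + qwedge l) us = antisym_sum qwedge us"
    unfolding antisym_sum_add using antisym_sum_symmetric[OF symmetric_part_prod_minus_qwedge refl]
    by simp
  then show ?thesis
    by (simp add: antisym_sum_alternating[OF alternating_qwedge])
qed

end

subsection \<open>The radial algebra on a subset of the variables\<close>

lemma rad_of_1: "rad_of 1 = 1"
  by (simp add: one_rad_def)

lemma rad_of_scalar_of_real: "rad_of (scalar (of_real t) * f) = t *\<^sub>R rad_of f"
  by (simp add: scaleR_rad_def rad_of_hom)

lemma rad_of_sum: "rad_of (sum h A) = (\<Sum>a\<in>A. rad_of (h a))"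
  by (induction A rule: infinite_finite_induct) (simp_all add: rad_of_hom)

lemma rad_of_prod_list: "rad_of (prod_list xs) = prod_list (map rad_of xs)"
  by (induction xs) (simp_all add: rad_of_hom rad_of_1)

lemma rad_of_power: "rad_of (f ^ n) = rad_of f ^ n"
  by (induction n) (simp_all add: rad_of_hom rad_of_1)

lemma scalar_of_int: "scalar (of_int n) = of_int n"
  by (simp add: scalar_def)

lemma rad_of_of_int: "rad_of (of_int n * f) = real_of_int n *\<^sub>R rad_of f"
  using rad_of_scalar_of_real[of "real_of_int n" f] by (simp add: scalar_of_int)

definition rvar :: "'v \<Rightarrow> ('v, 'k::{comm_ring_1, real_algebra_1}) rad" where
  "rvar v = rad_of (var v)"

definition rscalar :: "'k::{comm_ring_1, real_algebra_1} \<Rightarrow> ('v, 'k) rad" where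
  "rscalar c = rad_of (scalar c)"

lemma rscalar_simps:
  "rscalar 0 = 0" "rscalar 1 = 1" "rscalar (a + b) = rscalar a + rscalar b"
  "rscalar (a * b) = rscalar a * rscalar b" "rscalar (- a) = - rscalar a"
  by (simp_all add: rscalar_def scalar_simps scalar_mult rad_of_hom rad_of_1)

lemma rscalar_central: "rscalar c * z = z * rscalar c"
  by (rule rad_of_surj[of z]) (simp add: rscalar_def scalar_central flip: rad_of_hom)

text \<open>Monomials are built from a scalar at the right end by prefixing vectors, so only left
  multiplication by \<open>rvar v\<close> has to be checked.\<close>

lemma rad_induct [case_names scalar var_mult add]:
  assumes scalar: "\<And>c. P (rscalar c)"
    and var_mult: "\<And>v z. P z \<Longrightarrow> P (rvar v * z)"
    and add: "\<And>y z. P y \<Longrightarrow> P z \<Longrightarrow> P (y + z)"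
  shows "P z"
proof -
  obtain f where z: "z = rad_of f" by (rule rad_of_surj)
  have word: "P (rad_of (Poly_Mapping.single w c))" for w c
  proof -
    have "P (prod_list (map rvar us) * rscalar c)" for us
      by (induction us) (auto simp: mult.assoc intro: assms)
    then show ?thesis
      by (simp add: single_eq_scalar_prod rad_of_hom rad_of_prod_list o_def
          flip: rvar_def rscalar_def rscalar_central)
  qed
  show ?thesis unfolding z
  proof (induction f rule: poly_mapping_keys_induct)
    case zero
    show ?case using scalar[of 0] by (simp add: rscalar_simps rad_of_hom)
  qed (auto simp: word rad_of_hom intro: add)
qed

text \<open>The relators give commutation with single vectors; scalars are central and together with
  the vectors they generate the algebra.\<close>

lemma rvar_anticomm_central: "anticomm (rvar u) (rvar v) * z = z * anticomm (rvar u) (rvar v)"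
proof (induction z rule: rad_induct)
  case (scalar c)
  show ?case by (rule rscalar_central[symmetric])
next
  case (var_mult w z)
  have "comm (anticomm (var u) (var v)) (var w) - 0 \<in> (rad_null :: ('a, 'b) free_alg set)"
    by (simp add: rad_null.relator)
  then have "anticomm (rvar u) (rvar v) * rvar w = (rvar w * anticomm (rvar u) (rvar v) :: ('a, 'b) rad)"
    by (simp only: rad_of_eq_iff[symmetric] comm_def anticomm_def rad_of_hom rvar_def) simp
  from arg_cong[OF this, of "\<lambda>a. a * z"] show ?case
    by (simp add: mult.assoc var_mult)
qed (simp add: algebra_simps)

interpretation rad: central_anticommutators rvar
  by standard (rule rvar_anticomm_central)

lemma rad_of_wedge: "rad_of (wedge us) = rad.qwedge us"
  by (simp add: wedge_def rad.qwedge_eq_antisym_prod antisym_sum_def rad_of_scalar_of_real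
      rad_of_sum rad_of_of_int rad_of_prod_list rvar_def o_def)

section \<open>Setting the variables outside S to zero\<close>

definition restrict_vars :: "'v set \<Rightarrow> ('v, 'k::comm_ring_1) free_alg \<Rightarrow> ('v, 'k) free_alg" where
  "restrict_vars S f = Poly_Mapping.mapp (\<lambda>w c. if set (letters w) \<subseteq> S then c else 0) f"

lemma lookup_restrict_vars:
  "Poly_Mapping.lookup (restrict_vars S f) w =
    (if set (letters w) \<subseteq> S then Poly_Mapping.lookup f w else 0)"
  by (auto simp: restrict_vars_def lookup_mapp when_def in_keys_iff)

lemma restrict_vars_add: "restrict_vars S (f + g) = restrict_vars S f + restrict_vars S g"
  by (rule poly_mapping_eqI) (simp add: lookup_restrict_vars lookup_add)

lemma restrict_vars_diff: "restrict_vars S (f - g) = restrict_vars S f - restrict_vars S g"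
  by (rule poly_mapping_eqI) (simp add: lookup_restrict_vars lookup_minus)

lemma restrict_vars_0: "restrict_vars S 0 = 0"
  by (rule poly_mapping_eqI) (simp add: lookup_restrict_vars)

lemma restrict_vars_single:
  "restrict_vars S (Poly_Mapping.single w c) =
    (if set (letters w) \<subseteq> S then Poly_Mapping.single w c else 0)"
  by (rule poly_mapping_eqI) (auto simp: lookup_restrict_vars lookup_single when_def)

lemma restrict_vars_var: "restrict_vars S (var v) = (if v \<in> S then var v else 0)"
  by (simp add: var_def restrict_vars_single Word_inverse)

text \<open>A concatenation has a letter outside \<open>S\<close> exactly if one of its factors has,
  so killing all such words is multiplicative.\<close>

lemma restrict_vars_mult: "restrict_vars S (f * g) = restrict_vars S f * restrict_vars S g"
proof (induction f rule: poly_mapping_keys_induct)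
  case (single v c)
  show ?case
    by (induction g rule: poly_mapping_keys_induct)
      (auto simp: restrict_vars_0 restrict_vars_add distrib_left mult_single
        restrict_vars_single plus_word.rep_eq)
qed (simp_all add: restrict_vars_0 restrict_vars_add distrib_right)

lemma restrict_vars_id: "f \<in> carrier (free_algebra S) \<Longrightarrow> restrict_vars S f = f"
  by (rule poly_mapping_eqI) (auto simp: lookup_restrict_vars in_keys_iff)

lemma restrict_vars_carrier: "restrict_vars S f \<in> carrier (free_algebra S)"
  by (auto simp: in_keys_iff lookup_restrict_vars split: if_splits)

lemma free_algebra_closed:
  fixes f g :: "('v, 'k::comm_ring_1) free_alg"
  shows "f \<in> carrier (free_algebra S) \<Longrightarrow> g \<in> carrier (free_algebra S) \<Longrightarrow>
      f + g \<in> carrier (free_algebra S)"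
    "f \<in> carrier (free_algebra S) \<Longrightarrow> g \<in> carrier (free_algebra S) \<Longrightarrow>
      f - g \<in> carrier (free_algebra S)"
    "f \<in> carrier (free_algebra S) \<Longrightarrow> g \<in> carrier (free_algebra S) \<Longrightarrow>
      f * g \<in> carrier (free_algebra S)"
    "0 \<in> carrier (free_algebra S)" "1 \<in> carrier (free_algebra S)"
    "scalar c \<in> carrier (free_algebra S)"
    "v \<in> S \<Longrightarrow> var v \<in> carrier (free_algebra S)"
proof -
  assume *: "f \<in> carrier (free_algebra S)" "g \<in> carrier (free_algebra S)"
  interpret ring "free_algebra S :: ('v, 'k) free_alg ring" by (rule ring_free_algebra)
  show "f + g \<in> carrier (free_algebra S)"
    using a_closed[OF *] by (simp only: free_algebra_simps)
  show "f * g \<in> carrier (free_algebra S)"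
    using m_closed[OF *] by (simp only: free_algebra_simps)
  show "f - g \<in> carrier (free_algebra S)"
    unfolding free_algebra_simps
  proof
    fix w assume "w \<in> Poly_Mapping.keys (f - g)"
    then have "w \<in> Poly_Mapping.keys f \<or> w \<in> Poly_Mapping.keys g"
      by (auto simp: in_keys_iff lookup_minus)
    then show "set (letters w) \<subseteq> S" using * by auto
  qed
qed (auto simp: zero_word.rep_eq scalar_def var_def Word_inverse)

lemma free_algebra_sum:
  "(\<And>a. a \<in> A \<Longrightarrow> h a \<in> carrier (free_algebra S)) \<Longrightarrow> sum h A \<in> carrier (free_algebra S)"
  by (induction A rule: infinite_finite_induct)
    (simp_all add: free_algebra_closed del: free_algebra_simps(1))

lemma free_algebra_prod_list:
  "(\<And>a. a \<in> set xs \<Longrightarrow> a \<in> carrier (free_algebra S)) \<Longrightarrow> prod_list xs \<in> carrier (free_algebra S)"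
  by (induction xs) (simp_all add: free_algebra_closed del: free_algebra_simps(1))

lemma free_algebra_power:
  "f \<in> carrier (free_algebra S) \<Longrightarrow> f ^ n \<in> carrier (free_algebra S)"
  by (induction n) (simp_all add: free_algebra_closed del: free_algebra_simps(1))

lemma wedge_carrier:
  assumes "set us \<subseteq> S"
  shows "wedge us \<in> carrier (free_algebra S)"
proof -
  have "var (us ! \<pi> i) \<in> carrier (free_algebra S)"
    if "\<pi> permutes {..<length us}" "i < length us" for \<pi> i
    using that assms permutes_in_image[OF that(1), of i] by (intro free_algebra_closed) auto
  then show ?thesis
    unfolding wedge_def scalar_of_int[symmetric]
    by (intro free_algebra_closed free_algebra_sum free_algebra_prod_list)
      (auto simp del: free_algebra_simps(1))
qed

lemma radial_ideal_simps:
  fixes a b f :: "('v, 'k::comm_ring_1) free_alg"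
  shows
  "(0 :: ('v, 'k) free_alg) \<in> radial_ideal S"
  "a \<in> radial_ideal S \<Longrightarrow> b \<in> radial_ideal S \<Longrightarrow> a + b \<in> radial_ideal S"
  "a \<in> radial_ideal S \<Longrightarrow> f \<in> carrier (free_algebra S) \<Longrightarrow> f * a \<in> radial_ideal S"
  "a \<in> radial_ideal S \<Longrightarrow> f \<in> carrier (free_algebra S) \<Longrightarrow> a * f \<in> radial_ideal S"
proof -
  interpret ideal "radial_ideal S" "free_algebra S :: ('v, 'k) free_alg ring"
    by (rule ideal_radial_ideal)
  show "(0 :: ('v, 'k) free_alg) \<in> radial_ideal S"
    using additive_subgroup.zero_closed[OF is_additive_subgroup] by (simp only: free_algebra_simps)
  show "a \<in> radial_ideal S \<Longrightarrow> b \<in> radial_ideal S \<Longrightarrow> a + b \<in> radial_ideal S"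
    using additive_subgroup.a_closed[OF is_additive_subgroup, of a b] by (simp only: free_algebra_simps)
  show "a \<in> radial_ideal S \<Longrightarrow> f \<in> carrier (free_algebra S) \<Longrightarrow> f * a \<in> radial_ideal S"
    "a \<in> radial_ideal S \<Longrightarrow> f \<in> carrier (free_algebra S) \<Longrightarrow> a * f \<in> radial_ideal S"
    using I_l_closed[of a f] I_r_closed[of a f] by (simp_all only: free_algebra_simps)
qed

text \<open>Every word of a relator contains all of \<open>u\<close>, \<open>v\<close>,
  \<open>w\<close>. With one of them outside \<open>S\<close> the relator is sent to 0; otherwise it
  is fixed and is one of the generators of the ideal.\<close>

lemma restrict_vars_rad_null: "a \<in> rad_null \<Longrightarrow> restrict_vars S a \<in> radial_ideal S"
proof (induction rule: rad_null.induct)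
  case (relator u v w)
  show ?case
  proof (cases "{u, v, w} \<subseteq> S")
    case True
    then have "comm (anticomm (var u) (var v)) (var w) \<in>
        (radial_relators S :: ('a, 'b) free_alg set)"
      by (auto simp: radial_relators_def)
    then have "comm (anticomm (var u) (var v)) (var w) \<in>
        (radial_ideal S :: ('a, 'b) free_alg set)"
      unfolding radial_ideal_def
      using ring.genideal_self[OF ring_free_algebra radial_relators_carrier] by blast
    with True show ?thesis
      by (simp add: comm_def anticomm_def restrict_vars_add restrict_vars_diff restrict_vars_mult
          restrict_vars_var)
  next
    case False
    then have "restrict_vars S (comm (anticomm (var u) (var v)) (var w)) = (0 :: ('a, 'b) free_alg)"
      by (auto simp: comm_def anticomm_def restrict_vars_add restrict_vars_diff restrict_vars_mult
          restrict_vars_var)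
    then show ?thesis by (simp add: radial_ideal_simps)
  qed
qed (simp_all add: restrict_vars_0 restrict_vars_add restrict_vars_mult radial_ideal_simps
    restrict_vars_carrier del: free_algebra_simps(1))

text \<open>A null element over \<open>S\<close> is its own restriction, hence lies in the ideal
  generated over \<open>S\<close> alone: relations that pass through other variables add
  nothing.\<close>

lemma radial_ideal_eq: "radial_ideal S = rad_null \<inter> carrier (free_algebra S)"
proof
  have "ideal (rad_null \<inter> carrier (free_algebra S)) (free_algebra S)"
    by (rule ideal_free_algebraI)
      (auto intro: rad_null.intros free_algebra_closed simp del: free_algebra_simps(1))
  moreover have "radial_relators S \<subseteq> rad_null \<inter> carrier (free_algebra S)"
    using radial_relators_carrier[of S] by (auto simp: radial_relators_def rad_null.relator)
  ultimately show "radial_ideal S \<subseteq> rad_null \<inter> carrier (free_algebra S)"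
    unfolding radial_ideal_def by (rule ring.genideal_minimal[OF ring_free_algebra])
  show "rad_null \<inter> carrier (free_algebra S) \<subseteq> radial_ideal S"
  proof
    fix a assume "a \<in> rad_null \<inter> carrier (free_algebra S)"
    then show "a \<in> radial_ideal S"
      using restrict_vars_rad_null[of a S] restrict_vars_id[of a S] by (simp only: Int_iff)
  qed
qed

text \<open>Turns equality of cosets into equality in the type \<open>rad\<close>, where ring
  arithmetic is available.\<close>

lemma rad_of_eq_iff_cls_eq:
  fixes f g :: "('v, 'k::comm_ring_1) free_alg"
  assumes f: "f \<in> carrier (free_algebra S)" and g: "g \<in> carrier (free_algebra S)"
  shows "cls S f = cls S g \<longleftrightarrow> rad_of f = rad_of g"
proof -
  interpret ideal "radial_ideal S" "free_algebra S :: ('v, 'k) free_alg ring"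
    by (rule ideal_radial_ideal)
  have uminus: "\<ominus>\<^bsub>free_algebra S\<^esub> g = - g"
    by (rule minus_equality) (use g in \<open>simp_all del: free_algebra_simps(1)\<close>, use g in simp)
  have "cls S f = cls S g \<longleftrightarrow> f \<ominus>\<^bsub>free_algebra S\<^esub> g \<in> radial_ideal S"
    unfolding cls_def using quotient_eq_iff_same_a_r_cos[OF ideal_axioms f g] by blast
  also have "f \<ominus>\<^bsub>free_algebra S\<^esub> g = f - g"
    by (simp add: a_minus_def uminus)
  also have "f - g \<in> radial_ideal S \<longleftrightarrow> rad_of f = rad_of g"
    using free_algebra_closed(2)[OF f g] by (simp add: radial_ideal_eq rad_of_eq_iff del: free_algebra_simps(1))
  finally show ?thesis .
qed

lemma radial_simps:
  fixes f g :: "('v, 'k::comm_ring_1) free_alg"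
  shows "carrier (radial S) = cls S ` carrier (free_algebra S :: ('v, 'k) free_alg ring)"
    "f \<in> carrier (free_algebra S) \<Longrightarrow> g \<in> carrier (free_algebra S) \<Longrightarrow>
      cls S f \<oplus>\<^bsub>radial S\<^esub> cls S g = cls S (f + g)"
    "f \<in> carrier (free_algebra S) \<Longrightarrow> g \<in> carrier (free_algebra S) \<Longrightarrow>
      cls S f \<otimes>\<^bsub>radial S\<^esub> cls S g = cls S (f * g)"
    "\<one>\<^bsub>radial S\<^esub> = cls S (1 :: ('v, 'k) free_alg)"
proof -
  interpret ideal "radial_ideal S" "free_algebra S :: ('v, 'k) free_alg ring"
    by (rule ideal_radial_ideal)
  show "carrier (radial S) = cls S ` carrier (free_algebra S :: ('v, 'k) free_alg ring)"
    unfolding radial_def cls_def FactRing_def A_RCOSETS_def' by auto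
  show "\<one>\<^bsub>radial S\<^esub> = cls S (1 :: ('v, 'k) free_alg)"
    unfolding radial_def cls_def FactRing_def by simp
  assume *: "f \<in> carrier (free_algebra S)" "g \<in> carrier (free_algebra S)"
  show "cls S f \<oplus>\<^bsub>radial S\<^esub> cls S g = cls S (f + g)"
    unfolding radial_def cls_def FactRing_def using a_rcos_sum[OF *] by simp
  show "cls S f \<otimes>\<^bsub>radial S\<^esub> cls S g = cls S (f * g)"
    unfolding radial_def cls_def FactRing_def using rcoset_mult_add[OF *] by simp
qed

lemma cls_carrier: "f \<in> carrier (free_algebra S) \<Longrightarrow> cls S f \<in> carrier (radial S)"
  by (simp add: radial_simps del: free_algebra_simps(1))

subsection \<open>The Clifford module\<close>

text \<open>With \<open>e_K\<close> the product of the \<open>e_i\<close> for \<open>i\<close> in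
  \<open>K\<close> in increasing order, this is the sign of moving \<open>e_k\<close> from the front
  past the smaller factors.\<close>

definition koszul_sign :: "nat \<Rightarrow> nat set \<Rightarrow> 'a::comm_ring_1" where
  "koszul_sign k K = (- 1) ^ card (K \<inter> {..<k})"

lemma koszul_sign_insert:
  assumes "j \<notin> K"
  shows "koszul_sign k (insert j K) = (if j < k then - koszul_sign k K else koszul_sign k K)"
proof -
  have "insert j K \<inter> {..<k} = (if j < k then insert j (K \<inter> {..<k}) else K \<inter> {..<k})"
    by auto
  then show ?thesis using assms by (simp add: koszul_sign_def)
qed

lemma koszul_sign_remove:
  assumes "j \<in> K"
  shows "koszul_sign k (K - {j}) = (if j < k then - koszul_sign k K else koszul_sign k K :: 'a::comm_ring_1)"
proof -
  have "koszul_sign k K = (if j < k then - koszul_sign k (K - {j}) else koszul_sign k (K - {j}) :: 'a)"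
    using koszul_sign_insert[of j "K - {j}" k] assms by (simp add: insert_absorb)
  then show ?thesis by simp
qed

lemma koszul_sign_square: "koszul_sign k K * (koszul_sign k K * a) = a"
  by (simp add: koszul_sign_def flip: mult.assoc power_add)

text \<open>An element of the exterior algebra is encoded by its coefficients, \<open>F K\<close>
  being that of \<open>e_K\<close>. This is left exterior multiplication by \<open>e_k\<close>;
  \<open>annihilate\<close> is interior multiplication by the dual basis vector.\<close>

definition create :: "nat \<Rightarrow> (nat set \<Rightarrow> 'a::comm_ring_1) \<Rightarrow> nat set \<Rightarrow> 'a" where
  "create k F K = (if k \<in> K then koszul_sign k K * F (K - {k}) else 0)"

definition annihilate :: "nat \<Rightarrow> (nat set \<Rightarrow> 'a::comm_ring_1) \<Rightarrow> nat set \<Rightarrow> 'a" where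
  "annihilate k F K = (if k \<in> K then 0 else koszul_sign k K * F (insert k K))"

lemma create_linear:
  "create k (\<lambda>K. F K + G K) = (\<lambda>K. create k F K + create k G K)"
  "create k (\<lambda>K. c * F K) = (\<lambda>K. c * create k F K)"
  "create k (\<lambda>K. \<Sum>i\<in>A. H i K) = (\<lambda>K. \<Sum>i\<in>A. create k (H i) K)"
  by (auto simp: create_def algebra_simps sum_distrib_left)

lemma annihilate_linear:
  "annihilate k (\<lambda>K. F K + G K) = (\<lambda>K. annihilate k F K + annihilate k G K)"
  "annihilate k (\<lambda>K. c * F K) = (\<lambda>K. c * annihilate k F K)"
  "annihilate k (\<lambda>K. \<Sum>i\<in>A. H i K) = (\<lambda>K. \<Sum>i\<in>A. annihilate k (H i) K)"
  by (auto simp: annihilate_def algebra_simps sum_distrib_left)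

lemma create_create: "create j (create k F) K = - create k (create j F) K"
  by (cases j k rule: linorder_cases)
    (auto simp: create_def koszul_sign_remove Diff_insert2[symmetric] insert_commute
      simp flip: Diff_insert)

lemma annihilate_annihilate: "annihilate j (annihilate k F) K = - annihilate k (annihilate j F) K"
  by (cases j k rule: linorder_cases)
    (auto simp: annihilate_def koszul_sign_insert insert_commute)

text \<open>The canonical anticommutation relations. For \<open>j \<noteq> k\<close> exactly one of
  the two Koszul signs sees the index that the other operator inserts or removes, namely the sign of
  the larger index; this yields the minus.\<close>

lemma annihilate_create:
  "annihilate j (create k F) K = (if j = k then F K else 0) - create k (annihilate j F) K"
proof (cases "j = k")
  case True
  then show ?thesis
    by (auto simp: annihilate_def create_def koszul_sign_insert koszul_sign_remove
        koszul_sign_square insert_absorb)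
next
  case False
  then have "insert j K - {k} = insert j (K - {k})" by auto
  with False show ?thesis
    by (auto simp: annihilate_def create_def koszul_sign_insert koszul_sign_remove)
qed

section \<open>Clifford relations for a symmetric form\<close>

locale clifford_model =
  fixes M :: nat and b :: "nat \<Rightarrow> nat \<Rightarrow> 'a::comm_ring_1"
  assumes b_commute: "b i j = b j i"
begin

definition interior :: "nat \<Rightarrow> (nat set \<Rightarrow> 'a) \<Rightarrow> nat set \<Rightarrow> 'a" where
  "interior v F K = (\<Sum>i\<le>M. b v i * annihilate i F K)"

definition vec_op :: "nat \<Rightarrow> (nat set \<Rightarrow> 'a) \<Rightarrow> nat set \<Rightarrow> 'a" where
  "vec_op v F K = create v F K + interior v F K"

lemma interior_linear:
  "interior k (\<lambda>K. F K + G K) = (\<lambda>K. interior k F K + interior k G K)"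
  "interior k (\<lambda>K. c * F K) = (\<lambda>K. c * interior k F K)"
  by (auto simp: interior_def annihilate_linear algebra_simps sum.distrib sum_distrib_left)

lemma vec_op_linear:
  "vec_op k (\<lambda>K. F K + G K) = (\<lambda>K. vec_op k F K + vec_op k G K)"
  "vec_op k (\<lambda>K. c * F K) = (\<lambda>K. c * vec_op k F K)"
  by (auto simp: vec_op_def[abs_def] create_linear interior_linear algebra_simps)

text \<open>Interior multiplication is an antiderivation. The bound on \<open>u\<close> makes its
  term occur in the sum over \<open>i \<le> M\<close>.\<close>

lemma interior_create:
  assumes "u \<le> M"
  shows "interior v (create u F) K = b v u * F K - create u (interior v F) K"
proof -
  have "interior v (create u F) K =
      (\<Sum>i\<le>M. b v i * (if i = u then F K else 0)) - (\<Sum>i\<le>M. b v i * create u (annihilate i F) K)"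
    by (simp add: interior_def annihilate_create right_diff_distrib sum_subtractf)
  also have "(\<Sum>i\<le>M. b v i * (if i = u then F K else 0)) = b v u * F K"
    using assms by (simp add: if_distrib[of "\<lambda>a. _ * a"] cong: if_cong)
  finally show ?thesis
    by (simp add: interior_def[abs_def] create_linear)
qed

lemma interior_interior: "interior u (interior v F) K = - interior v (interior u F) K"
proof -
  have "interior u (interior v F) K =
      (\<Sum>i\<le>M. \<Sum>j\<le>M. b u i * (b v j * annihilate i (annihilate j F) K))" for u v
    by (simp add: interior_def[abs_def] annihilate_linear sum_distrib_left)
  note * = this
  have "interior v (interior u F) K =
      (\<Sum>j\<le>M. \<Sum>i\<le>M. b v j * (b u i * annihilate j (annihilate i F) K))"
    by (rule *)
  also have "\<dots> = (\<Sum>i\<le>M. \<Sum>j\<le>M. b v j * (b u i * annihilate j (annihilate i F) K))"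
    by (rule sum.swap)
  also have "\<dots> = - interior u (interior v F) K"
    unfolding * sum_negf[symmetric]
    by (intro sum.cong refl, subst annihilate_annihilate) (simp add: algebra_simps)
  finally show ?thesis by simp
qed

text \<open>The purely exterior and purely interior parts cancel, and the mixed ones leave
  \<open>b u v + b v u\<close>.\<close>

lemma vec_op_anticommutator:
  assumes "u \<le> M" "v \<le> M"
  shows "vec_op u (vec_op v F) K + vec_op v (vec_op u F) K = 2 * b u v * F K"
proof -
  have "vec_op u (vec_op v F) K = create u (create v F) K + create u (interior v F) K +
      interior u (create v F) K + interior u (interior v F) K" for u v
    by (simp add: vec_op_def[abs_def] create_linear interior_linear)
  then show ?thesis
    using create_create[of u v F K] interior_interior[of u v F K] b_commute[of v u]
    by (simp add: interior_create assms algebra_simps)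
qed

primrec ext_basis :: "nat list \<Rightarrow> nat set \<Rightarrow> 'a" where
  "ext_basis [] = (\<lambda>K. if K = {} then 1 else 0)"
| "ext_basis (v # us) = create v (ext_basis us)"

text \<open>Both sides obey one recursion: an antiderivation either removes the head
  \<open>u\<close> at the price \<open>b v u\<close> or passes it with a minus sign.\<close>

lemma interior_ext_basis:
  "set us \<subseteq> {..M} \<Longrightarrow> interior v (ext_basis us) K = contract b v (\<lambda>l. ext_basis l K) us"
proof (induction us arbitrary: K)
  case Nil
  show ?case by (auto simp: interior_def annihilate_def intro!: sum.neutral)
next
  case (Cons u us)
  have c: "contract b v (\<lambda>l. a * G l) us = a * contract b v G us" for a G
    by (rule contract_mult_left) (simp add: mult.commute)
  have "create u (interior v (ext_basis us)) K = contract b v (\<lambda>l. create u (ext_basis l) K) us"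
    using Cons c[of 0] by (simp add: create_def c)
  then show ?case
    using Cons.prems by (simp add: interior_create)
qed

lemma ext_basis_sorted:
  "sorted_wrt (<) us \<Longrightarrow> ext_basis us K = (if K = set us then 1 else 0)"
proof (induction us arbitrary: K)
  case (Cons u us)
  then have u: "u \<notin> set us" by auto
  show ?case
  proof (cases "u \<in> K \<and> K - {u} = set us")
    case True
    then have "K = insert u (set us)" by blast
    \<comment> \<open>Sortedness leaves nothing of \<open>K\<close> below \<open>u\<close>, so the
      sign in \<open>create\<close> is 1.\<close>
    then have "K \<inter> {..<u} = {}" using Cons.prems by fastforce
    with True Cons show ?thesis by (auto simp: create_def koszul_sign_def)
  next
    case False
    with Cons u show ?thesis by (auto simp: create_def)
  qed
qed simp

end

lemma half_double: "Poly_Mapping.single 0 (of_real (1 / 2)) * (2 * a) = (a :: scalar_poly)"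
proof -
  have "Poly_Mapping.single 0 (of_real (1 / 2)) * (2 :: scalar_poly) =
      Poly_Mapping.single 0 (of_real (1 / 2 * 2))"
    by (simp only: single_numeral[symmetric] mult_single of_real_mult of_real_numeral add_0)
  then show ?thesis by (simp flip: mult.assoc)
qed

section \<open>Action of the free algebra, and coordinates in the radial algebra\<close>

locale free_alg_clifford_action = clifford_model M b for M and b :: "nat \<Rightarrow> nat \<Rightarrow> scalar_poly" +
  fixes idx :: "'v \<Rightarrow> nat"
  assumes idx_le: "idx v \<le> M"
begin

definition word_act :: "'v list \<Rightarrow> (nat set \<Rightarrow> scalar_poly) \<Rightarrow> nat set \<Rightarrow> scalar_poly" where
  "word_act us = foldr (\<lambda>v. vec_op (idx v)) us"

definition act :: "('v, coeff_ring) free_alg \<Rightarrow> (nat set \<Rightarrow> scalar_poly) \<Rightarrow> nat set \<Rightarrow> scalar_poly" where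
  "act f F K = (\<Sum>w\<in>Poly_Mapping.keys f.
     Poly_Mapping.single 0 (Poly_Mapping.lookup f w) * word_act (letters w) F K)"

lemma word_act_linear:
  "word_act us (\<lambda>K. F K + G K) = (\<lambda>K. word_act us F K + word_act us G K)"
  "word_act us (\<lambda>K. c * F K) = (\<lambda>K. c * word_act us F K)"
  by (induction us) (simp_all add: word_act_def vec_op_linear)

lemma act_linear:
  "act f (\<lambda>K. F K + G K) = (\<lambda>K. act f F K + act f G K)"
  "act f (\<lambda>K. c * F K) = (\<lambda>K. c * act f F K)"
  by (auto simp: act_def word_act_linear algebra_simps sum.distrib sum_distrib_left)

lemma act_0: "act 0 F K = 0"
  by (simp add: act_def)

lemma act_single:
  "act (Poly_Mapping.single w c) F K = Poly_Mapping.single 0 c * word_act (letters w) F K"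
  by (simp add: act_def)

lemma act_add: "act (f + g) F K = act f F K + act g F K"
proof -
  define A where "A = Poly_Mapping.keys f \<union> Poly_Mapping.keys g"
  have *: "act h F K = (\<Sum>w\<in>A. Poly_Mapping.single 0 (Poly_Mapping.lookup h w) * word_act (letters w) F K)"
    if "Poly_Mapping.keys h \<subseteq> A" for h
    unfolding act_def using that
    by (intro sum.mono_neutral_left) (auto simp: A_def in_keys_iff)
  show ?thesis
    by (subst (1 2 3) *) (auto simp: A_def lookup_add single_add algebra_simps sum.distrib
        dest: subsetD[OF Poly_Mapping.keys_add])
qed

lemma act_diff: "act (f - g) F K = act f F K - act g F K"
  using act_add[of "f - g" g F K] by simp

lemma act_mult: "act (f * g) F K = act f (act g F) K"
proof (induction f rule: poly_mapping_keys_induct)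
  case (single v c)
  show ?case
  proof (induction g rule: poly_mapping_keys_induct)
    case zero
    \<comment> \<open>The zero function is written as a multiple of \<open>F\<close>, so that the
      linearity rule applies to it.\<close>
    have "act (Poly_Mapping.single v c) (\<lambda>K. 0 * F K) K = 0"
      unfolding act_linear by simp
    then show ?case by (simp add: act_0[abs_def])
  next
    case (single w d)
    show ?case
      by (simp add: mult_single act_single[abs_def] word_act_linear plus_word.rep_eq)
        (simp add: word_act_def mult_single flip: mult.assoc)
  next
    case (add f g)
    then show ?case by (simp add: distrib_left act_add[abs_def] act_linear)
  qed
qed (simp_all add: act_0 act_add distrib_right)

lemma act_var: "act (var v) F K = vec_op (idx v) F K"
  by (simp add: var_def act_single Word_inverse word_act_def)

lemma act_scalar: "act (scalar c) F K = Poly_Mapping.single 0 c * F K"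
  by (simp add: scalar_def act_single word_act_def zero_word.rep_eq)

lemma act_anticomm: "act (anticomm (var u) (var v)) F K = 2 * b (idx u) (idx v) * F K"
  using vec_op_anticommutator[OF idx_le idx_le]
  by (simp add: anticomm_def act_add act_mult act_var[abs_def])

text \<open>An anticommutator acts as multiplication by a polynomial and so commutes with
  everything. As \<open>rad_null\<close> contains the relators in all variables of the type,
  \<open>idx\<close> has to place every variable among the basis vectors.\<close>

lemma act_rad_null: "a \<in> rad_null \<Longrightarrow> act a F K = 0"
proof (induction arbitrary: F K rule: rad_null.induct)
  case (relator u v w)
  show ?case
    by (simp add: comm_def act_diff act_mult act_anticomm[abs_def] act_linear)
next
  case (lmult a f)
  have "act f (\<lambda>K. 0 * F K) K = 0"
    unfolding act_linear by simp
  moreover have "act a F = (\<lambda>K. 0)"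
    using lmult by auto
  ultimately show ?case by (simp add: act_mult)
qed (simp_all add: act_0 act_add act_mult)

definition vacuum :: "nat set \<Rightarrow> scalar_poly" where
  "vacuum K = (if K = {} then 1 else 0)"

text \<open>The symbol map of Clifford theory: let \<open>z\<close> act on 1 and read the exterior
  coefficients. Null elements act as zero, so all representatives give the same result.\<close>

definition coords :: "('v, coeff_ring) rad \<Rightarrow> nat set \<Rightarrow> scalar_poly" where
  "coords z = act (rep_rad z) vacuum"

lemma coords_rad_of: "coords (rad_of f) = act f vacuum"
proof -
  have "rad_of (rep_rad (rad_of f)) = rad_of f"
    by (simp add: rad_of_def Quotient_abs_rep[OF Quotient_rad])
  then have "rep_rad (rad_of f) - f \<in> rad_null"
    by (simp add: rad_of_eq_iff)
  from act_rad_null[OF this] show ?thesis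
    by (auto simp: coords_def act_diff)
qed

lemma coords_linear:
  "coords (y + z) = (\<lambda>K. coords y K + coords z K)"
  "coords (y - z) = (\<lambda>K. coords y K - coords z K)"
  "coords (rscalar c * z) = (\<lambda>K. Poly_Mapping.single 0 c * coords z K)"
  by (rule rad_of_surj[of y], rule rad_of_surj[of z],
      auto simp: coords_rad_of act_add act_diff act_mult act_scalar rscalar_def simp flip: rad_of_hom)+

lemma coords_0: "coords 0 K = 0"
  using coords_rad_of[of 0] by (simp add: rad_of_hom act_0)

lemma coords_1: "coords 1 = vacuum"
  using coords_rad_of[of "scalar 1"] act_scalar[of 1 vacuum] by (auto simp: rad_of_1 scalar_simps)

lemma coords_rvar_mult: "coords (rvar v * z) = vec_op (idx v) (coords z)"
  by (rule rad_of_surj[of z])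
    (auto simp: coords_rad_of act_mult act_var rvar_def simp flip: rad_of_hom)

lemma coords_anticomm_mult:
  "coords (anticomm (rvar u) (rvar v) * z) K = 2 * b (idx u) (idx v) * coords z K"
proof (rule rad_of_surj[of z])
  fix f assume z: "z = rad_of f"
  have "anticomm (rvar u) (rvar v) * z = rad_of (anticomm (var u) (var v) * f)"
    by (simp add: z rad_of_hom anticomm_def rvar_def)
  then show ?thesis by (simp add: z coords_rad_of act_mult act_anticomm)
qed

text \<open>The factor 2 stems from \<open>{u, v}\<close> acting as \<open>2 * b\<close>; it cancels
  the half in \<open>qwedge\<close>.\<close>

lemma coords_contract:
  "coords (contract (\<lambda>u v. anticomm (rvar u) (rvar v)) v G us) K =
    2 * contract (\<lambda>u v. b (idx u) (idx v)) v (\<lambda>l. coords (G l) K) us"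
  by (induction us arbitrary: G)
    (simp_all add: coords_0 coords_linear coords_anticomm_mult algebra_simps)

lemma contract_map_idx:
  "contract (\<lambda>u v. b (idx u) (idx v)) v (\<lambda>l. G (map idx l)) us = contract b (idx v) G (map idx us)"
  by (induction us arbitrary: G) simp_all

text \<open>Multiplication by \<open>v\<close> has an exterior and an interior part; half the
  contraction is exactly the interior one, so the correction in \<open>qwedge\<close> leaves
  exterior multiplication alone.\<close>

lemma coords_qwedge: "coords (rad.qwedge us) = ext_basis (map idx us)"
proof (induction "length us" arbitrary: us rule: less_induct)
  case less
  show ?case
  proof (cases us)
    case Nil
    then show ?thesis by (auto simp: coords_1 vacuum_def)
  next
    case (Cons v vs)
    have half: "(1 / 2) *\<^sub>R z = rscalar (of_real (1 / 2)) * z" for z :: "('v, coeff_ring) rad"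
      by (simp add: scaleR_rad_def rscalar_def)
    have vs: "coords (rad.qwedge vs) = ext_basis (map idx vs)"
      using less[of vs] Cons by simp
    have "contract (\<lambda>u v. b (idx u) (idx v)) v (\<lambda>l. coords (rad.qwedge l) K) vs =
        contract (\<lambda>u v. b (idx u) (idx v)) v (\<lambda>l. ext_basis (map idx l) K) vs" for K
      by (rule contract_cong_sub) (use less Cons in simp)
    then have "contract (\<lambda>u v. b (idx u) (idx v)) v (\<lambda>l. coords (rad.qwedge l) K) vs =
        interior (idx v) (ext_basis (map idx vs)) K" for K
      using idx_le by (subst interior_ext_basis) (auto simp: contract_map_idx[of v "\<lambda>l. ext_basis l K"])
    then show ?thesis
      unfolding Cons
      by (auto simp: half coords_linear coords_rvar_mult coords_contract vs half_double vec_op_def)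
  qed
qed

end

subsection \<open>Scalar polynomials\<close>

lemma set_scalar_syms:
  "set (scalar_syms N) = insert Sc_r (Sc_s ` {..<N} \<union> {Sc_c i j | i j. i \<le> j \<and> j < N})"
proof -
  have "(\<Union>i\<in>{0..<N}. Sc_c i ` {i..<N}) = {Sc_c i j | i j. i \<le> j \<and> j < N}"
  proof (intro equalityI subsetI)
    fix z assume "z \<in> {Sc_c i j | i j. i \<le> j \<and> j < N}"
    then obtain i j where "z = Sc_c i j" "i \<le> j" "j < N" by blast
    then show "z \<in> (\<Union>i\<in>{0..<N}. Sc_c i ` {i..<N})"
      by (intro UN_I[of i]) auto
  qed auto
  then show ?thesis
    by (simp add: scalar_syms_def lessThan_atLeast0)
qed

lemma distinct_scalar_syms: "distinct (scalar_syms N)"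
proof -
  have "distinct (concat (map (\<lambda>i. map (Sc_c i) [i..<N]) xs))" if "distinct xs" for xs
    using that by (induction xs) (auto simp: distinct_map inj_on_def)
  from this[of "[0..<N]"] show ?thesis
    by (auto simp: scalar_syms_def distinct_map inj_on_def)
qed

section \<open>Evaluation of scalar polynomials in the free algebra\<close>

lemma scalar_val_carrier:
  assumes "z \<in> set (scalar_syms (length ys))"
  shows "scalar_val x ys z \<in> carrier (free_algebra (insert x (set ys)))"
  using assms unfolding set_scalar_syms
  by (auto simp: anticomm_def power2_eq_square simp del: free_algebra_simps(1)
      intro!: free_algebra_closed)

lemma scalar_eval_carrier: "scalar_eval x ys A \<in> carrier (free_algebra (insert x (set ys)))"
  unfolding scalar_eval_def
  by (auto simp del: free_algebra_simps(1)
      intro!: free_algebra_sum free_algebra_closed free_algebra_prod_list free_algebra_power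
        scalar_val_carrier)

lemma dsc_carrier: "dsc x ys A \<in> carrier (free_algebra (insert x (set ys)))"
proof -
  have 2: "2 * f = f + f" for f :: "('a, coeff_ring) free_alg"
    by (rule mult_2)
  show ?thesis
    unfolding dsc_def 2
    by (intro free_algebra_closed free_algebra_sum scalar_eval_carrier) auto
qed

definition scalar_monomial :: "'v \<Rightarrow> 'v list \<Rightarrow> (scalar_sym \<Rightarrow>\<^sub>0 nat) \<Rightarrow> ('v, coeff_ring) free_alg" where
  "scalar_monomial x ys m =
     prod_list (map (\<lambda>z. scalar_val x ys z ^ Poly_Mapping.lookup m z) (scalar_syms (length ys)))"

lemma scalar_eval_superset:
  assumes "finite X" "Poly_Mapping.keys A \<subseteq> X"
  shows "scalar_eval x ys A = (\<Sum>m\<in>X. scalar (Poly_Mapping.lookup A m) * scalar_monomial x ys m)"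
  unfolding scalar_eval_def scalar_monomial_def using assms
  by (intro sum.mono_neutral_left) (auto simp: in_keys_iff scalar_simps)

lemma scalar_eval_add: "scalar_eval x ys (A + B) = scalar_eval x ys A + scalar_eval x ys B"
  by (subst (1 2 3) scalar_eval_superset[of "Poly_Mapping.keys A \<union> Poly_Mapping.keys B"])
    (auto simp: lookup_add scalar_simps algebra_simps sum.distrib dest: subsetD[OF Poly_Mapping.keys_add])

lemma scalar_eval_0: "scalar_eval x ys 0 = 0"
  by (simp add: scalar_eval_def)

lemma scalar_eval_single:
  "scalar_eval x ys (Poly_Mapping.single m c) = scalar c * scalar_monomial x ys m"
  by (subst scalar_eval_superset[of "{m}"]) auto

lemma scalar_eval_scale: "scalar_eval x ys (Poly_Mapping.single 0 c * A) = scalar c * scalar_eval x ys A"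
  by (induction A rule: poly_mapping_keys_induct)
    (simp_all add: scalar_eval_0 scalar_eval_add scalar_eval_single mult_single scalar_mult
      mult.assoc distrib_left)

section \<open>Jackson operators on coefficients\<close>

lemma lookup_scale_sym:
  "Poly_Mapping.lookup (scale_sym u P A) m = P ^ Poly_Mapping.lookup m u * Poly_Mapping.lookup A m"
  by (auto simp: scale_sym_def lookup_mapp when_def in_keys_iff)

lemma lookup_single_mult:
  fixes A :: "'a::cancel_comm_monoid_add \<Rightarrow>\<^sub>0 'b::comm_ring_1"
  shows "Poly_Mapping.lookup (Poly_Mapping.single k c * A) (k + m) = c * Poly_Mapping.lookup A m"
  by (induction A rule: poly_mapping_keys_induct)
    (simp_all add: mult_single lookup_single when_def lookup_add distrib_left)

lemma lookup_single_mult_eq_0: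
  fixes A :: "'a::cancel_comm_monoid_add \<Rightarrow>\<^sub>0 'b::comm_ring_1"
  assumes "\<And>m. l \<noteq> k + m"
  shows "Poly_Mapping.lookup (Poly_Mapping.single k c * A) l = 0"
  by (induction A rule: poly_mapping_keys_induct)
    (use assms in \<open>auto simp add: mult_single lookup_single when_def lookup_add distrib_left\<close>)

text \<open>\<open>(1 - P\<^bsup>n + 1\<^esup>) / (1 - P)\<close> is the coefficient of \<open>u\<^sup>n\<close> in the Jackson derivative of \<open>u\<^bsup>n + 1\<^esup>\<close>.\<close>

lemma lookup_jackson:
  assumes "P \<noteq> 1"
  shows "Poly_Mapping.lookup (jackson u P A) m =
    (\<Sum>i\<le>Poly_Mapping.lookup m u. P ^ i) * Poly_Mapping.lookup A (m + Poly_Mapping.single u 1)"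
proof -
  define h where "h m = (\<Sum>i\<le>Poly_Mapping.lookup m u. P ^ i) *
    Poly_Mapping.lookup A (m + Poly_Mapping.single u 1)" for m
  define U where "U = (Poly_Mapping.single u 1 :: scalar_sym \<Rightarrow>\<^sub>0 nat)"
  \<comment> \<open>The shift by \<open>U\<close> is injective, so only finitely many
    \<open>m\<close> are shifted into the support of \<open>A\<close>.\<close>
  have "finite ((\<lambda>m. m + U) -` Poly_Mapping.keys A)"
    by (rule finite_vimageI) (auto simp: inj_on_def)
  then have fin: "finite {m. h m \<noteq> 0}"
    by (rule rev_finite_subset) (auto simp: h_def U_def in_keys_iff)
  define G where "G = Abs_poly_mapping h"
  have G: "Poly_Mapping.lookup G m = h m" for m
    using fin by (simp add: G_def)
  have fac: "Poly_Mapping.single 0 (1 - P) * Poly_Mapping.single (Poly_Mapping.single u 1) 1 =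
      (Poly_Mapping.single U (1 - P) :: scalar_poly)"
    by (simp add: mult_single U_def)
  have eq: "Poly_Mapping.single U (1 - P) * G = A - scale_sym u P A"
  proof (rule poly_mapping_eqI)
    fix m
    show "Poly_Mapping.lookup (Poly_Mapping.single U (1 - P) * G) m =
        Poly_Mapping.lookup (A - scale_sym u P A) m"
    proof (cases "Poly_Mapping.lookup m u = 0")
      case True
      \<comment> \<open>A monomial free of \<open>u\<close> is not a multiple of \<open>U\<close>,
        and its coefficient in \<open>A - scale_sym u P A\<close> vanishes because
        \<open>P ^ 0 = 1\<close>.\<close>
      then have "m \<noteq> U + k" for k
        by (auto simp: U_def lookup_add)
      with True show ?thesis
        by (simp add: lookup_single_mult_eq_0 lookup_minus lookup_scale_sym)
    next
      case False
      then have m: "m = U + (m - U)"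
        by (intro poly_mapping_eqI) (auto simp: U_def lookup_add lookup_minus lookup_single when_def)
      define k where "k = m - U"
      have "(1 - P) * (\<Sum>i\<le>Poly_Mapping.lookup k u. P ^ i) = 1 - P ^ Suc (Poly_Mapping.lookup k u)"
        by (rule sum_gp_basic)
      then have "(1 - P) * h k = (1 - P ^ Suc (Poly_Mapping.lookup k u)) * Poly_Mapping.lookup A (U + k)"
        by (simp add: h_def U_def add.commute flip: mult.assoc)
      moreover have "Poly_Mapping.lookup (U + k) u = Suc (Poly_Mapping.lookup k u)"
        by (simp add: U_def lookup_add)
      ultimately show ?thesis
        by (subst (1 2) m, fold k_def)
          (simp add: lookup_single_mult G lookup_minus lookup_scale_sym, simp add: algebra_simps)
    qed
  qed
  have "jackson u P A = G"
    unfolding jackson_def fac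
  proof (rule the_equality)
    fix G' assume "Poly_Mapping.single U (1 - P) * G' = A - scale_sym u P A"
    \<comment> \<open>The coefficient at \<open>U + m\<close> fixes \<open>1 - P\<close> times the
      coefficient of \<open>G'\<close> at \<open>m\<close>, and the coefficient ring has no zero
      divisors.\<close>
    then have "(1 - P) * Poly_Mapping.lookup G' m = (1 - P) * Poly_Mapping.lookup G m" for m
      using eq lookup_single_mult[of U "1 - P" G' m] lookup_single_mult[of U "1 - P" G m] by simp
    then show "G' = G"
      using assms by (intro poly_mapping_eqI) simp
  qed (rule eq)
  then show ?thesis by (simp add: G h_def)
qed

text \<open>The coefficient formula for \<open>jackson\<close> asks for \<open>P \<noteq> 1\<close>,
  and these two values of \<open>P\<close> are the parameters in \<open>dsc\<close>.\<close>

lemma q_par_powers: "q_par \<noteq> 1" "q_par ^ 2 \<noteq> 1"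
proof -
  have "rf_q = Fract [:[:0, 1:]:] 1" "rf_q * rf_q = Fract [:[:0, 0, 1:]:] 1"
    by (simp_all add: rf_q_def)
  moreover have "Fract [:[:0, 1:]:] 1 \<noteq> (1 :: ratfun)" "Fract [:[:0, 0, 1:]:] 1 \<noteq> (1 :: ratfun)"
    unfolding One_fract_def by (simp_all add: eq_fract one_pCons)
  ultimately have *: "rf_q \<noteq> 1" "rf_q * rf_q \<noteq> 1" by simp_all
  show "q_par \<noteq> 1" by transfer (rule *)
  show "q_par ^ 2 \<noteq> 1" unfolding power2_eq_square by transfer (rule *)
qed

lemma lookup_single_0_mult:
  fixes A :: "'a::cancel_comm_monoid_add \<Rightarrow>\<^sub>0 'b::comm_ring_1"
  shows "Poly_Mapping.lookup (Poly_Mapping.single 0 c * A) m = c * Poly_Mapping.lookup A m"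
  using lookup_single_mult[of 0 c A m] by simp

lemma jackson_linear:
  assumes "P \<noteq> 1"
  shows "jackson u P (A + B) = jackson u P A + jackson u P B"
    "jackson u P (Poly_Mapping.single 0 c * A) = Poly_Mapping.single 0 c * jackson u P A"
  by (rule poly_mapping_eqI, simp add: lookup_jackson[OF assms] lookup_add distrib_left)
    (rule poly_mapping_eqI, simp add: lookup_jackson[OF assms] lookup_single_0_mult mult.left_commute)

lemma scale_sym_linear:
  "scale_sym u P (A + B) = scale_sym u P A + scale_sym u P B"
  "scale_sym u P (Poly_Mapping.single 0 c * A) = Poly_Mapping.single 0 c * scale_sym u P A"
  by (rule poly_mapping_eqI, simp add: lookup_scale_sym lookup_add distrib_left)
    (rule poly_mapping_eqI, simp add: lookup_scale_sym lookup_single_0_mult mult.left_commute)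

lemma dsc_linear:
  "dsc x ys (A + B) = dsc x ys A + dsc x ys B"
  "dsc x ys (Poly_Mapping.single 0 c * A) = scalar c * dsc x ys A"
proof -
  show "dsc x ys (A + B) = dsc x ys A + dsc x ys B"
    by (simp add: dsc_def jackson_linear q_par_powers scale_sym_linear scalar_eval_add
        distrib_left sum.distrib)
  have c: "f * (scalar c * g) = scalar c * (f * g)" for f g :: "('a, coeff_ring) free_alg"
    by (simp only: mult.assoc[symmetric] scalar_central[of c f, symmetric])
  show "dsc x ys (Poly_Mapping.single 0 c * A) = scalar c * dsc x ys A"
    by (simp add: dsc_def jackson_linear q_par_powers scale_sym_linear scalar_eval_scale c
        distrib_left sum_distrib_left)
qed

lemma dsc_0: "dsc x ys 0 = 0"
  using dsc_linear(2)[of x ys 0 0] by (simp add: scalar_simps)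

text \<open>The square \<open>x\<^sup>2\<close> is half of \<open>{x, x}\<close>, so it is central
  for the same reason as the other scalars.\<close>

lemma scalar_val_rad_central: "rad_of (scalar_val x ys z) * w = w * rad_of (scalar_val x ys z)"
proof (cases z)
  case Sc_r
  have "2 *\<^sub>R rad_of (scalar_val x ys z) = anticomm (rvar x) (rvar x)"
    by (simp add: Sc_r power2_eq_square rad_of_hom anticomm_def rvar_def scaleR_2)
  then have "rad_of (scalar_val x ys z) = (1 / 2) *\<^sub>R anticomm (rvar x) (rvar x)"
    by (simp flip: \<open>2 *\<^sub>R rad_of (scalar_val x ys z) = _\<close>)
  then show ?thesis by (simp add: rvar_anticomm_central)
qed (use rvar_anticomm_central in \<open>simp_all add: rad_of_hom anticomm_def rvar_def\<close>)

lemma mult_central: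
  fixes a b :: "'a::semigroup_mult"
  assumes "\<And>w. a * w = w * a" "\<And>w. b * w = w * b"
  shows "a * b * w = w * (a * b)"
proof -
  have "a * b * w = a * (w * b)" by (simp add: mult.assoc assms(2)[of w])
  also have "\<dots> = a * w * b" by (simp add: mult.assoc)
  also have "\<dots> = w * (a * b)" by (simp add: assms(1)[of w] mult.assoc)
  finally show ?thesis .
qed

lemma power_central:
  fixes a :: "'a::monoid_mult"
  assumes "\<And>w. a * w = w * a"
  shows "a ^ n * w = w * a ^ n"
  by (induction n arbitrary: w) (simp, simp only: power_Suc mult_central[OF assms])

lemma prod_list_central:
  fixes f :: "'b \<Rightarrow> 'a::monoid_mult"
  assumes "\<And>z w. f z * w = w * f z"
  shows "prod_list (map f zs) * w = w * prod_list (map f zs)"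
  by (induction zs arbitrary: w)
    (simp, simp only: list.map prod_list.Cons mult_central[OF assms])

text \<open>Makes the order of factors fixed by \<open>scalar_syms\<close> immaterial once the
  scalars are central.\<close>

lemma prod_list_mset_central:
  fixes f :: "'b \<Rightarrow> 'a::monoid_mult"
  assumes "\<And>z w. f z * w = w * f z" and "mset xs = mset ys"
  shows "prod_list (map f xs) = prod_list (map f ys)"
  using assms(2)
proof (induction xs arbitrary: ys)
  case (Cons x xs)
  then have "x \<in> set ys" by (metis list.set_intros(1) mset_eq_setD)
  then obtain as bs where ys: "ys = as @ x # bs"
    by (meson split_list)
  with Cons.prems have "mset xs = mset (as @ bs)" by simp
  from Cons.IH[OF this] have "prod_list (map f (x # xs)) = (f x * prod_list (map f as)) * prod_list (map f bs)"
    by (simp add: mult.assoc)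
  also have "\<dots> = prod_list (map f ys)"
    by (simp only: assms(1)[of x]) (simp add: ys mult.assoc)
  finally show ?case .
qed simp

lemma rad_of_scalar_monomial:
  "rad_of (scalar_monomial x ys m) =
    prod_list (map (\<lambda>z. rad_of (scalar_val x ys z) ^ Poly_Mapping.lookup m z) (scalar_syms (length ys)))"
  by (simp add: scalar_monomial_def rad_of_prod_list o_def rad_of_power)

lemma scalar_val_power_rad_central:
  "rad_of (scalar_val x ys z) ^ n * w = w * rad_of (scalar_val x ys z) ^ n"
  by (rule power_central) (rule scalar_val_rad_central)

lemma scalar_monomial_rad_central:
  "rad_of (scalar_monomial x ys m) * w = w * rad_of (scalar_monomial x ys m)"
  unfolding rad_of_scalar_monomial
  by (rule prod_list_central) (rule scalar_val_power_rad_central)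

lemma scalar_monomial_rad_add:
  "rad_of (scalar_monomial x ys (m + m')) =
    rad_of (scalar_monomial x ys m) * rad_of (scalar_monomial x ys m')"
proof -
  define v where "v z = rad_of (scalar_val x ys z)" for z
  define f where "f m z = v z ^ Poly_Mapping.lookup m z" for m z
  have f: "f m z * w = w * f m z" for m z w
    unfolding f_def v_def by (rule scalar_val_power_rad_central)
  have "prod_list (map (f (m + m')) zs) = prod_list (map (f m) zs) * prod_list (map (f m') zs)" for zs
  proof (induction zs)
    case (Cons z zs)
    have "f (m + m') z = f m z * f m' z"
      by (simp add: f_def lookup_add power_add)
    moreover have "f m' z * (prod_list (map (f m) zs) * p) = prod_list (map (f m) zs) * (f m' z * p)" for p
      by (simp only: mult.assoc[symmetric] f[of m' z "prod_list (map (f m) zs)"])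
    ultimately show ?case
      by (simp add: Cons mult.assoc)
  qed simp
  then show ?thesis
    unfolding rad_of_scalar_monomial by (simp add: f_def[abs_def] v_def)
qed

lemma scalar_eval_rad_central: "rad_of (scalar_eval x ys A) * w = w * rad_of (scalar_eval x ys A)"
proof (induction A rule: poly_mapping_keys_induct)
  case (single m c)
  show ?case
    by (simp only: scalar_eval_single rad_of_hom rscalar_def[symmetric])
      (rule mult_central[OF rscalar_central scalar_monomial_rad_central])
qed (simp_all add: scalar_eval_0 scalar_eval_add rad_of_hom algebra_simps)

text \<open>Multiplicativity comes from commuting factors, hence the passage to \<open>rad\<close>;
  in the free algebra evaluation is merely linear.\<close>

lemma scalar_eval_rad_mult:
  "rad_of (scalar_eval x ys (A * B)) = rad_of (scalar_eval x ys A) * rad_of (scalar_eval x ys B)"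
proof (induction A rule: poly_mapping_keys_induct)
  case (single m c)
  show ?case
  proof (induction B rule: poly_mapping_keys_induct)
    case (single k d)
    let ?m = "rad_of (scalar_monomial x ys m)" and ?k = "rad_of (scalar_monomial x ys k)"
    have "rscalar d * (?m * ?k) = ?m * (rscalar d * ?k)"
      by (simp only: mult.assoc[symmetric] rscalar_central[of d ?m])
    then show ?case
      by (simp add: mult_single scalar_eval_single rad_of_hom scalar_mult scalar_monomial_rad_add
          mult.assoc flip: rscalar_def)
  qed (simp_all add: scalar_eval_0 scalar_eval_add rad_of_hom distrib_left)
qed (simp_all add: scalar_eval_0 scalar_eval_add rad_of_hom distrib_right)

section \<open>The scalar variables as polynomials\<close>

definition sym_poly :: "scalar_sym \<Rightarrow> scalar_poly" where
  "sym_poly z = Poly_Mapping.single (Poly_Mapping.single z 1) 1"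

lemma sym_poly_power: "sym_poly z ^ n = Poly_Mapping.single (Poly_Mapping.single z n) 1"
  by (induction n) (simp_all add: sym_poly_def mult_single flip: single_add)

lemma sym_poly_monomial:
  assumes "Poly_Mapping.keys m \<subseteq> set zs" "distinct zs"
  shows "prod_list (map (\<lambda>z. sym_poly z ^ Poly_Mapping.lookup m z) zs) = Poly_Mapping.single m 1"
proof -
  have "prod_list (map (\<lambda>z. sym_poly z ^ Poly_Mapping.lookup m z) zs) =
      Poly_Mapping.single (sum_list (map (\<lambda>z. Poly_Mapping.single z (Poly_Mapping.lookup m z)) zs)) 1"
    by (induction zs) (simp_all add: sym_poly_power mult_single)
  also have "sum_list (map (\<lambda>z. Poly_Mapping.single z (Poly_Mapping.lookup m z)) zs) =
      (\<Sum>z\<in>set zs. Poly_Mapping.single z (Poly_Mapping.lookup m z))"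
    using assms(2) by (simp add: sum_list_distinct_conv_sum_set)
  also have "\<dots> = (\<Sum>z\<in>Poly_Mapping.keys m. Poly_Mapping.single z (Poly_Mapping.lookup m z))"
    using assms(1) by (intro sum.mono_neutral_right) (auto simp: in_keys_iff)
  also have "\<dots> = m" by (rule poly_mapping_expand[symmetric])
  finally show ?thesis .
qed

lemma scalar_polys_closed:
  "A \<in> scalar_polys N \<Longrightarrow> B \<in> scalar_polys N \<Longrightarrow> A + B \<in> scalar_polys N"
  "A \<in> scalar_polys N \<Longrightarrow> B \<in> scalar_polys N \<Longrightarrow> A * B \<in> scalar_polys N"
  "Poly_Mapping.single 0 c \<in> scalar_polys N"
  "z \<in> set (scalar_syms N) \<Longrightarrow> sym_poly z \<in> scalar_polys N"
proof -
  assume *: "A \<in> scalar_polys N" "B \<in> scalar_polys N"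
  show "A + B \<in> scalar_polys N"
    using * Poly_Mapping.keys_add[of A B] unfolding scalar_polys_def by blast
  show "A * B \<in> scalar_polys N"
  proof -
    have "Poly_Mapping.keys m \<subseteq> set (scalar_syms N)" if m: "m \<in> Poly_Mapping.keys (A * B)" for m
    proof -
      obtain k l where "k \<in> Poly_Mapping.keys A" "l \<in> Poly_Mapping.keys B" "m = k + l"
        using subsetD[OF Poly_Mapping.keys_mult m] by blast
      then show ?thesis
        using * Poly_Mapping.keys_add[of k l] unfolding scalar_polys_def by blast
    qed
    then show ?thesis by (simp add: scalar_polys_def)
  qed
qed (auto simp: scalar_polys_def sym_poly_def)

lemma scalar_eval_sym_poly:
  assumes "z \<in> set (scalar_syms (length ys))"
  shows "scalar_eval x ys (sym_poly z) = scalar_val x ys z"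
proof -
  have "prod_list (map (\<lambda>y. scalar_val x ys y ^ Poly_Mapping.lookup (Poly_Mapping.single z 1) y) zs) =
      (if z \<in> set zs then scalar_val x ys z else 1)" if "distinct zs" for zs
    using that by (induction zs) (auto simp: lookup_single when_def)
  then show ?thesis
    using assms distinct_scalar_syms
    by (simp add: sym_poly_def scalar_eval_single scalar_monomial_def scalar_simps)
qed

text \<open>The Gram matrix of \<open>x\<close> and the \<open>y\<^sub>i\<close>: the relation
  \<open>{u, v} = 2 b(u, v)\<close> forces \<open>s\<^sub>i / 2\<close> and
  \<open>c\<^sub>i\<^sub>j / 2\<close>, while \<open>x\<^sup>2 = b(x, x)\<close> leaves
  \<open>r\<close> whole. \<open>min\<close> and \<open>max\<close> select the symbol
  \<open>Sc_c i j\<close> with \<open>i \<le> j\<close> and make the form symmetric.\<close>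

fun scalar_form :: "nat \<Rightarrow> nat \<Rightarrow> scalar_poly" where
  "scalar_form 0 0 = sym_poly Sc_r"
| "scalar_form 0 (Suc j) = Poly_Mapping.single 0 (of_real (1 / 2)) * sym_poly (Sc_s j)"
| "scalar_form (Suc i) 0 = Poly_Mapping.single 0 (of_real (1 / 2)) * sym_poly (Sc_s i)"
| "scalar_form (Suc i) (Suc j) =
    Poly_Mapping.single 0 (of_real (1 / 2)) * sym_poly (Sc_c (min i j) (max i j))"

text \<open>Basis vector \<open>0\<close> of the model stands for \<open>x\<close>, basis vector \<open>Suc i\<close> for \<open>ys ! i\<close>;
  all other variables are sent to one extra basis vector.\<close>

definition var_index :: "'v \<Rightarrow> 'v list \<Rightarrow> 'v \<Rightarrow> nat" where
  "var_index x ys v = (if v = x then 0 else if v \<in> set ys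
     then Suc (LEAST i. i < length ys \<and> ys ! i = v) else Suc (length ys))"

lemma var_index_nth:
  assumes "distinct ys" "x \<notin> set ys" "i < length ys"
  shows "var_index x ys (ys ! i) = Suc i"
proof -
  have "(LEAST j. j < length ys \<and> ys ! j = ys ! i) = i"
    using assms by (intro Least_equality) (auto simp: nth_eq_iff_index_eq)
  then show ?thesis using assms by (auto simp: var_index_def)
qed

lemma var_index_le: "var_index x ys v \<le> Suc (length ys)"
proof -
  have "(LEAST i. i < length ys \<and> ys ! i = v) < length ys" if "v \<in> set ys"
    using that LeastI_ex[of "\<lambda>i. i < length ys \<and> ys ! i = v"] by (auto simp: in_set_conv_nth)
  then show ?thesis by (auto simp: var_index_def)
qed

lemma scalar_form_commute: "scalar_form i j = scalar_form j i"
  by (cases i; cases j) (auto simp: min.commute max.commute)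

section \<open>The model attached to x and an ordering of Y\<close>

locale radial_model =
  fixes x :: 'v and ys :: "'v list"
  assumes distinct: "distinct ys" and notin: "x \<notin> set ys"
begin

sublocale free_alg_clifford_action "Suc (length ys)" scalar_form "var_index x ys"
  by standard (auto simp: scalar_form_commute intro: var_index_le)

lemma act_scalar_val:
  assumes "z \<in> set (scalar_syms (length ys))"
  shows "act (scalar_val x ys z) F K = sym_poly z * F K"
proof -
  have h: "2 * (Poly_Mapping.single 0 (of_real (1 / 2)) * a) * f = a * f" for a f :: scalar_poly
    using half_double[of a] by (simp add: mult.left_commute)
  have i: "var_index x ys x = 0"
    by (simp add: var_index_def)
  show ?thesis
  proof (cases z)
    case Sc_r
    \<comment> \<open>The action is known for anticommutators; \<open>{x, x} = 2 x\<^sup>2\<close>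
      gives twice the claim, and the coefficient ring contains one half.\<close>
    have "2 * act (scalar_val x ys z) F K = 2 * (sym_poly z * F K)"
      using act_anticomm[of x x F K] Sc_r
      by (simp add: i anticomm_def act_add power2_eq_square)
    from arg_cong[OF this, of "\<lambda>a. Poly_Mapping.single 0 (of_real (1 / 2)) * a"]
    show ?thesis by (simp only: half_double)
  next
    case (Sc_s j)
    then show ?thesis
      using assms distinct notin
      by (auto simp: set_scalar_syms act_anticomm i var_index_nth h)
  next
    case (Sc_c j k)
    then show ?thesis
      using assms distinct notin
      by (auto simp: set_scalar_syms act_anticomm i var_index_nth h min_def max_def)
  qed
qed

lemma act_power:
  assumes "\<And>F K. act f F K = a * F K"
  shows "act (f ^ n) F K = a ^ n * F K"
proof (induction n arbitrary: F K)
  case 0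
  show ?case using act_scalar[of 1 F K] by (simp add: scalar_simps)
next
  case (Suc n)
  then show ?case by (simp add: act_mult assms mult.assoc)
qed

lemma act_scalar_monomial:
  assumes "Poly_Mapping.keys m \<subseteq> set (scalar_syms (length ys))"
  shows "act (scalar_monomial x ys m) F K = Poly_Mapping.single m 1 * F K"
proof -
  have "act (prod_list (map (\<lambda>z. scalar_val x ys z ^ Poly_Mapping.lookup m z) zs)) F K =
      prod_list (map (\<lambda>z. sym_poly z ^ Poly_Mapping.lookup m z) zs) * F K"
    if "set zs \<subseteq> set (scalar_syms (length ys))" for zs
    using that
  proof (induction zs arbitrary: F K)
    case Nil
    show ?case using act_scalar[of 1 F K] by (simp add: scalar_simps)
  next
    case (Cons z zs)
    then show ?case
      by (simp add: act_mult act_power[of _ "sym_poly z"] act_scalar_val mult.assoc)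
  qed
  from this[OF subset_refl] show ?thesis
    by (simp add: scalar_monomial_def sym_poly_monomial[OF assms distinct_scalar_syms])
qed

lemma act_sum: "act (sum h A) F K = (\<Sum>a\<in>A. act (h a) F K)"
  by (induction A rule: infinite_finite_induct) (simp_all add: act_0 act_add)

text \<open>Evaluation runs over \<open>scalar_syms\<close> and drops any other variable, while
  multiplication by \<open>A\<close> keeps it; hence \<open>A\<close> is taken in
  \<open>scalar_polys\<close>.\<close>

lemma act_scalar_eval:
  assumes "A \<in> scalar_polys (length ys)"
  shows "act (scalar_eval x ys A) F K = A * F K"
proof -
  have "act (scalar_eval x ys A) F K =
      (\<Sum>m\<in>Poly_Mapping.keys A. Poly_Mapping.single m (Poly_Mapping.lookup A m) * F K)"
    unfolding scalar_eval_superset[OF finite_keys subset_refl] act_sum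
    by (rule sum.cong)
      (use assms in \<open>auto simp: act_mult act_scalar act_scalar_monomial scalar_polys_def mult_single
        simp flip: mult.assoc\<close>)
  also have "\<dots> = A * F K"
    by (simp flip: sum_distrib_right poly_mapping_expand)
  finally show ?thesis .
qed

text \<open>The scalar factor stands on the right, so it acts on the vacuum before \<open>z\<close>
  does; as a multiplication it then passes through the linear action of \<open>z\<close>.\<close>

lemma coords_mult_scalar_eval:
  assumes "A \<in> scalar_polys (length ys)"
  shows "coords (z * rad_of (scalar_eval x ys A)) K = A * coords z K"
proof (rule rad_of_surj[of z])
  fix f assume z: "z = rad_of f"
  have "act f (act (scalar_eval x ys A) vacuum) = (\<lambda>K. A * act f vacuum K)"
    using act_linear(2)[of f A vacuum] by (simp add: act_scalar_eval[OF assms, abs_def])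
  then show ?thesis
    by (simp add: z coords_rad_of act_mult flip: rad_of_hom)
qed

end

subsection \<open>Existence and uniqueness of the derivative\<close>

text \<open>The defining conditions restated on representatives in the free algebra, so that later
  arguments need not take cosets apart.\<close>

lemma is_right_qderivD:
  assumes "is_right_qderiv x ys D" and S: "S = insert x (set ys)"
  shows "D \<in> carrier (radial S) \<rightarrow>\<^sub>E carrier (radial S)"
    "f \<in> carrier (free_algebra S) \<Longrightarrow> g \<in> carrier (free_algebra S) \<Longrightarrow>
      D (cls S (f + g)) = D (cls S f) \<oplus>\<^bsub>radial S\<^esub> D (cls S g)"
    "f \<in> carrier (free_algebra S) \<Longrightarrow>
      D (cls S (scalar c * f)) = cls S (scalar c) \<otimes>\<^bsub>radial S\<^esub> D (cls S f)"
    "I \<subseteq> {..<length ys} \<Longrightarrow> A \<in> scalar_polys (length ys) \<Longrightarrow>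
      D (cls S (wedge (nths ys I) * scalar_eval x ys A)) = cls S (wedge (nths ys I) * dsc x ys A)"
    "I \<subseteq> {..<length ys} \<Longrightarrow> B \<in> scalar_polys (length ys) \<Longrightarrow>
      D (cls S (wedge (x # nths ys I) * scalar_eval x ys B)) =
        cls S (scalar ((- 1) ^ card I * qm_number (- int (card I))) *
                 wedge (nths ys I) * scalar_eval x ys B +
               scalar (qm_power (- int (card I))) * wedge (x # nths ys I) * dsc x ys B)"
  using assms unfolding is_right_qderiv_def Let_def S[symmetric]
  by (auto simp: cls_carrier radial_simps free_algebra_closed(6) simp del: free_algebra_simps(1)
      simp flip: radial_simps(2,3))

lemma is_right_qderivI:
  assumes S: "S = insert x (set ys)"
    and "D \<in> carrier (radial S) \<rightarrow>\<^sub>E carrier (radial S)"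
    and "\<And>f g. f \<in> carrier (free_algebra S) \<Longrightarrow> g \<in> carrier (free_algebra S) \<Longrightarrow>
      D (cls S (f + g)) = D (cls S f) \<oplus>\<^bsub>radial S\<^esub> D (cls S g)"
    and "\<And>f c. f \<in> carrier (free_algebra S) \<Longrightarrow>
      D (cls S (scalar c * f)) = cls S (scalar c) \<otimes>\<^bsub>radial S\<^esub> D (cls S f)"
    and "\<And>I A. I \<subseteq> {..<length ys} \<Longrightarrow> A \<in> scalar_polys (length ys) \<Longrightarrow>
      D (cls S (wedge (nths ys I) * scalar_eval x ys A)) = cls S (wedge (nths ys I) * dsc x ys A)"
    and "\<And>I B. I \<subseteq> {..<length ys} \<Longrightarrow> B \<in> scalar_polys (length ys) \<Longrightarrow>
      D (cls S (wedge (x # nths ys I) * scalar_eval x ys B)) =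
        cls S (scalar ((- 1) ^ card I * qm_number (- int (card I))) *
                 wedge (nths ys I) * scalar_eval x ys B +
               scalar (qm_power (- int (card I))) * wedge (x # nths ys I) * dsc x ys B)"
  shows "is_right_qderiv x ys D"
  unfolding is_right_qderiv_def Let_def S[symmetric] radial_simps(1)
  using assms(2-)
  by (auto simp: radial_simps free_algebra_closed(6) simp del: free_algebra_simps(1))

context radial_model
begin

abbreviation S :: "'v set" where "S \<equiv> insert x (set ys)"
abbreviation N :: nat where "N \<equiv> length ys"

lemma nths_wedge_carrier:
  "wedge (nths ys I) \<in> carrier (free_algebra S)" "wedge (x # nths ys I) \<in> carrier (free_algebra S)"
  using set_nths_subset[of ys I] by (auto simp del: free_algebra_simps(1) intro!: wedge_carrier)

lemmas carrier_intros = free_algebra_closed free_algebra_sum nths_wedge_carrier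
  scalar_eval_carrier dsc_carrier

text \<open>Indices grow along \<open>nths ys I\<close> and \<open>x\<close> has the smallest index
  0, so every basis element becomes one increasing exterior monomial, without sign.\<close>

lemma coords_wedge_nths:
  assumes "I \<subseteq> {..<N}"
  shows "coords (rad_of (wedge (nths ys I))) K = (if K = Suc ` I then 1 else 0)"
    "coords (rad_of (wedge (x # nths ys I))) K = (if K = insert 0 (Suc ` I) then 1 else 0)"
proof -
  have "map (var_index x ys) ys = map Suc [0..<N]"
    by (rule nth_equalityI) (simp_all add: var_index_nth distinct notin)
  then have m: "map (var_index x ys) (nths ys I) = map Suc (nths [0..<N] I)"
    by (simp flip: nths_map)
  have s: "sorted_wrt (<) (nths [0..<N] I)"
    by (simp add: strict_sorted_iff sorted_nths)
  have set: "set (nths [0..<N] I) = I"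
    using assms by (force simp: set_nths)
  have "var_index x ys x = 0" by (simp add: var_index_def)
  with m s set show
    "coords (rad_of (wedge (nths ys I))) K = (if K = Suc ` I then 1 else 0)"
    "coords (rad_of (wedge (x # nths ys I))) K = (if K = insert 0 (Suc ` I) then 1 else 0)"
    by (simp_all add: rad_of_wedge coords_qwedge ext_basis_sorted sorted_wrt_map
        del: ext_basis.simps rad.qwedge.simps)
qed

text \<open>The prescribed values summed over the basis. The set \<open>I\<close> shifted by one
  carries the coordinate of \<open>y\<^sub>I\<close>, and the same set with 0 added that of
  \<open>x \<and> y\<^sub>I\<close>.\<close>

definition deriv_of_coords :: "(nat set \<Rightarrow> scalar_poly) \<Rightarrow> ('v, coeff_ring) free_alg" where
  "deriv_of_coords F = (\<Sum>I\<in>Pow {..<N}.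
     wedge (nths ys I) * dsc x ys (F (Suc ` I)) +
     (scalar ((- 1) ^ card I * qm_number (- int (card I))) *
        wedge (nths ys I) * scalar_eval x ys (F (insert 0 (Suc ` I))) +
      scalar (qm_power (- int (card I))) *
        wedge (x # nths ys I) * dsc x ys (F (insert 0 (Suc ` I)))))"

lemma deriv_of_coords_carrier: "deriv_of_coords F \<in> carrier (free_algebra S)"
  unfolding deriv_of_coords_def by (intro carrier_intros)

lemma deriv_of_coords_add:
  "deriv_of_coords (\<lambda>K. F K + G K) = deriv_of_coords F + deriv_of_coords G"
  by (simp add: deriv_of_coords_def dsc_linear scalar_eval_add distrib_left algebra_simps
      flip: sum.distrib)

lemma deriv_of_coords_scale:
  "deriv_of_coords (\<lambda>K. Poly_Mapping.single 0 c * F K) = scalar c * deriv_of_coords F"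
proof -
  have c: "f * (scalar c * g) = scalar c * (f * g)" for f g :: "('v, coeff_ring) free_alg"
    by (simp only: mult.assoc[symmetric] scalar_central[of c f, symmetric])
  show ?thesis
    by (simp add: deriv_of_coords_def dsc_linear scalar_eval_scale distrib_left sum_distrib_left c)
qed

lemma deriv_of_coords_delta:
  assumes "I \<subseteq> {..<N}"
  shows "deriv_of_coords (\<lambda>K. if K = Suc ` I then A else 0) = wedge (nths ys I) * dsc x ys A"
    "deriv_of_coords (\<lambda>K. if K = insert 0 (Suc ` I) then A else 0) =
      scalar ((- 1) ^ card I * qm_number (- int (card I))) *
        wedge (nths ys I) * scalar_eval x ys A +
      scalar (qm_power (- int (card I))) * wedge (x # nths ys I) * dsc x ys A"
proof -
  have [simp]: "insert 0 (Suc ` J) \<noteq> Suc ` K" "Suc ` K \<noteq> insert 0 (Suc ` J)"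
    "(Suc ` J = Suc ` K) = (J = K)" "(insert 0 (Suc ` J) = insert 0 (Suc ` K)) = (J = K)" for J K
  proof -
    show "insert 0 (Suc ` J) \<noteq> Suc ` K" "Suc ` K \<noteq> insert 0 (Suc ` J)" by blast+
    show *: "(Suc ` J = Suc ` K) = (J = K)" by (simp add: inj_image_eq_iff)
    show "(insert 0 (Suc ` J) = insert 0 (Suc ` K)) = (J = K)"
      unfolding *[symmetric] by (rule insert_ident) auto
  qed
  have I: "I \<in> Pow {..<N}" using assms by simp
  have d: "(\<Sum>J\<in>Pow {..<N}. if J = I then g J else 0) = g I" for g :: "nat set \<Rightarrow> ('v, coeff_ring) free_alg"
    using I by (simp add: sum.delta')
  show "deriv_of_coords (\<lambda>K. if K = Suc ` I then A else 0) = wedge (nths ys I) * dsc x ys A"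
    unfolding deriv_of_coords_def
    by (subst d[symmetric]) (rule sum.cong, auto simp: dsc_0 scalar_eval_0)
  show "deriv_of_coords (\<lambda>K. if K = insert 0 (Suc ` I) then A else 0) =
      scalar ((- 1) ^ card I * qm_number (- int (card I))) *
        wedge (nths ys I) * scalar_eval x ys A +
      scalar (qm_power (- int (card I))) * wedge (x # nths ys I) * dsc x ys A"
    unfolding deriv_of_coords_def
    \<comment> \<open>The term is to be matched as a function of \<open>card I\<close> and
      \<open>nths ys I\<close>, which guides how \<open>I\<close> is abstracted into the summation
      variable.\<close>
    by (subst d[symmetric, where g = "\<lambda>I. _ (card I) (nths ys I)"]) (rule sum.cong, auto simp: dsc_0 scalar_eval_0)
qed

text \<open>Take coordinates, then apply the prescribed formulas: the result is linear, and on a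
  basis element times a scalar the coordinates reduce the sum to one term.\<close>

lemma ex_right_qderiv: "\<exists>D. is_right_qderiv x ys D"
proof -
  define D where "D = (\<lambda>X\<in>carrier (radial S). cls S (deriv_of_coords (coords (rad_of
    (SOME f. f \<in> carrier (free_algebra S) \<and> cls S f = X)))))"
  have D: "D (cls S f) = cls S (deriv_of_coords (coords (rad_of f)))"
    if f: "f \<in> carrier (free_algebra S)" for f
  proof -
    define f' where "f' = (SOME g. g \<in> carrier (free_algebra S) \<and> cls S g = cls S f)"
    have "f' \<in> carrier (free_algebra S) \<and> cls S f' = cls S f"
      unfolding f'_def by (rule someI[of _ f]) (use f in blast)
    \<comment> \<open>The chosen representative agrees with \<open>f\<close> in \<open>rad\<close>
      and hence has the same coordinates.\<close>
    then have "rad_of f' = rad_of f"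
      using rad_of_eq_iff_cls_eq[OF _ f] by blast
    then show ?thesis
      using f by (simp add: D_def cls_carrier f'_def del: free_algebra_simps(1))
  qed
  have "is_right_qderiv x ys D"
  proof (rule is_right_qderivI[OF refl], goal_cases)
    case 1
    show ?case
      by (auto simp: D_def cls_carrier deriv_of_coords_carrier simp del: free_algebra_simps(1))
  next
    case (2 f g)
    then show ?case
      by (simp add: D free_algebra_closed radial_simps deriv_of_coords_carrier rad_of_hom
          coords_linear deriv_of_coords_add del: free_algebra_simps(1))
  next
    case (3 f c)
    then show ?case
      by (simp add: D free_algebra_closed radial_simps deriv_of_coords_carrier rad_of_hom
          coords_linear(3)[unfolded rscalar_def] deriv_of_coords_scale del: free_algebra_simps(1))
  next
    case (4 I A)
    have "coords (rad_of (wedge (nths ys I) * scalar_eval x ys A)) =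
        (\<lambda>K. if K = Suc ` I then A else 0)"
      using 4 by (auto simp: rad_of_hom coords_mult_scalar_eval coords_wedge_nths)
    with 4 show ?case
      by (subst D) (intro carrier_intros, simp add: deriv_of_coords_delta)
  next
    case (5 I A)
    have "coords (rad_of (wedge (x # nths ys I) * scalar_eval x ys A)) =
        (\<lambda>K. if K = insert 0 (Suc ` I) then A else 0)"
      using 5 by (auto simp: rad_of_hom coords_mult_scalar_eval coords_wedge_nths)
    with 5 show ?case
      by (subst D) (intro carrier_intros, simp add: deriv_of_coords_delta)
  qed
  then show ?thesis by blast
qed

text \<open>Sums are built one term at a time, so that agreement of two operators obeying the
  formulas follows by induction. They are kept in the free algebra, where the formulas are
  stated.\<close>

inductive_set normal_forms :: "('v, coeff_ring) free_alg set" where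
  zero: "0 \<in> normal_forms"
| wedge: "I \<subseteq> {..<N} \<Longrightarrow> A \<in> scalar_polys N \<Longrightarrow> g \<in> normal_forms \<Longrightarrow>
    wedge (nths ys I) * scalar_eval x ys A + g \<in> normal_forms"
| x_wedge: "I \<subseteq> {..<N} \<Longrightarrow> A \<in> scalar_polys N \<Longrightarrow> g \<in> normal_forms \<Longrightarrow>
    wedge (x # nths ys I) * scalar_eval x ys A + g \<in> normal_forms"

definition normal_rad :: "('v, coeff_ring) rad set" where
  "normal_rad = rad_of ` normal_forms"

lemma normal_rad_0: "0 \<in> normal_rad"
  using imageI[OF normal_forms.zero, of rad_of] by (simp add: normal_rad_def rad_of_hom)

lemma normal_rad_add:
  assumes "y \<in> normal_rad" "z \<in> normal_rad"
  shows "y + z \<in> normal_rad"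
proof -
  obtain f g where "f \<in> normal_forms" "g \<in> normal_forms" and yz: "y = rad_of f" "z = rad_of g"
    using assms by (auto simp: normal_rad_def)
  from this(1,2) have "f + g \<in> normal_forms"
    by (induction rule: normal_forms.induct) (auto simp: add.assoc intro: normal_forms.intros)
  then show ?thesis by (auto simp: normal_rad_def yz simp flip: rad_of_hom)
qed

abbreviation ev :: "scalar_poly \<Rightarrow> ('v, coeff_ring) rad" where
  "ev A \<equiv> rad_of (scalar_eval x ys A)"

lemma ev_single_0: "ev (Poly_Mapping.single 0 c) = rscalar c"
proof -
  have "prod_list (map (\<lambda>z. 1) zs) = (1 :: ('v, coeff_ring) free_alg)" for zs :: "scalar_sym list"
    by (induction zs) simp_all
  then have "scalar_monomial x ys 0 = 1"
    by (simp add: scalar_monomial_def)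
  then show ?thesis by (simp add: scalar_eval_single rscalar_def)
qed

text \<open>Real factors are absorbed into the polynomial, so signs and halves are handled with
  closure of \<open>normal_rad\<close> under sums alone.\<close>

lemma scaleR_mult_ev: "t *\<^sub>R (z * ev A) = z * ev (Poly_Mapping.single 0 (of_real t) * A)"
proof -
  have "t *\<^sub>R (z * ev A) = rscalar (of_real t) * z * ev A"
    by (simp add: scaleR_rad_def rscalar_def mult.assoc)
  also have "\<dots> = z * ev (Poly_Mapping.single 0 (of_real t) * A)"
    by (simp add: rscalar_central scalar_eval_rad_mult ev_single_0 mult.assoc)
  finally show ?thesis .
qed

text \<open>A repeated vector makes the wedge vanish. Otherwise its factors can be listed, up to a
  sign, with \<open>x\<close> first and the others in the order of \<open>ys\<close>.\<close>

lemma qwedge_ev_normal: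
  assumes us: "set us \<subseteq> S" and A: "A \<in> scalar_polys N"
  shows "rad.qwedge us * ev A \<in> normal_rad"
proof (cases "distinct us")
  case False
  then have "rad.qwedge us = (0 :: ('v, coeff_ring) rad)"
    by (rule alternating_not_distinct[OF rad.alternating_qwedge])
  then show ?thesis
    using normal_rad_0 by simp
next
  case True
  define I where "I = {i. i < N \<and> ys ! i \<in> set us}"
  define vs where "vs = (if x \<in> set us then x # nths ys I else nths ys I)"
  have I: "I \<subseteq> {..<N}" by (auto simp: I_def)
  have n: "set (nths ys I) = set us - {x}"
    using us notin by (fastforce simp: set_nths I_def in_set_conv_nth)
  have "distinct vs" "set vs = set us"
    using n distinct by (auto simp: vs_def distinct_nthsI)
  then have "mset us = mset vs"
    using True set_eq_iff_mset_eq_distinct by blast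
  then obtain \<epsilon> :: real where
    \<epsilon>: "\<And>F :: 'v list \<Rightarrow> ('v, coeff_ring) rad. alternating F \<Longrightarrow> F us = \<epsilon> *\<^sub>R F vs"
    by (rule alternating_mset[where 'r = "('v, coeff_ring) rad"]) blast
  define B where "B = Poly_Mapping.single 0 (of_real \<epsilon>) * A"
  have B: "B \<in> scalar_polys N" unfolding B_def by (intro scalar_polys_closed A)
  have "rad.qwedge us * ev A = rad_of (wedge vs * scalar_eval x ys B)"
    by (simp add: \<epsilon>[OF rad.alternating_qwedge] scaleR_mult_ev B_def rad_of_hom rad_of_wedge)
  moreover have "wedge vs * scalar_eval x ys B \<in> normal_forms"
    using normal_forms.wedge[OF I B normal_forms.zero] normal_forms.x_wedge[OF I B normal_forms.zero]
    by (simp add: vs_def)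
  ultimately show ?thesis by (auto simp: normal_rad_def)
qed

lemma form_eq_ev:
  assumes "u \<in> S" "v \<in> S"
  obtains P where "P \<in> scalar_polys N" "rad.form u v = ev P"
proof -
  have "\<exists>P. P \<in> scalar_polys N \<and> rad.form u v = ev P" if uv: "u = x" "v \<in> set ys" for u v
  proof -
    obtain i where i: "i < N" "v = ys ! i" using uv by (auto simp: in_set_conv_nth)
    then have "Sc_s i \<in> set (scalar_syms N)" by (auto simp: set_scalar_syms)
    then show ?thesis
      using i uv by (intro exI[of _ "sym_poly (Sc_s i)"])
        (simp add: scalar_polys_closed scalar_eval_sym_poly anticomm_def rad_of_hom rvar_def)
  qed
  note xy = this
  have yy: "\<exists>P. P \<in> scalar_polys N \<and> rad.form u v = ev P" if uv: "u \<in> set ys" "v \<in> set ys"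
  proof -
    obtain i j where ij: "i < N" "u = ys ! i" "j < N" "v = ys ! j"
      using uv by (auto simp: in_set_conv_nth)
    then have "Sc_c (min i j) (max i j) \<in> set (scalar_syms N)" by (auto simp: set_scalar_syms)
    then show ?thesis
      using ij by (intro exI[of _ "sym_poly (Sc_c (min i j) (max i j))"])
        (auto simp: scalar_polys_closed scalar_eval_sym_poly anticomm_def rad_of_hom rvar_def
          min_def max_def add.commute)
  qed
  have xx: "\<exists>P. P \<in> scalar_polys N \<and> rad.form x x = ev P"
  proof -
    have "Sc_r \<in> set (scalar_syms N)" by (auto simp: set_scalar_syms)
    \<comment> \<open>\<open>{x, x}\<close> is twice \<open>r\<close>, whence the sum of two
      copies.\<close>
    then show ?thesis
      by (intro exI[of _ "sym_poly Sc_r + sym_poly Sc_r"] conjI scalar_polys_closed)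
        (simp_all only: scalar_eval_sym_poly scalar_eval_add anticomm_def rad_of_hom
          rvar_def scalar_val.simps power2_eq_square)
  qed
  show thesis
    using assms xx yy xy[of u v] xy[of v u] that unfolding rad.form_commute[of v u]
    by (cases "u = x"; cases "v = x") auto
qed

text \<open>\<open>G\<close> and \<open>A\<close> vary in the induction: removing the head replaces
  \<open>G\<close> by \<open>\<lambda>l. G (u # l)\<close>, and the central factor
  \<open>{v, u}\<close> is moved into \<open>A\<close>.\<close>

lemma contract_ev_normal:
  assumes v: "v \<in> S" and us: "set us \<subseteq> S" and A: "A \<in> scalar_polys N"
    and G: "\<And>l A. set l \<subseteq> S \<Longrightarrow> A \<in> scalar_polys N \<Longrightarrow> G l * ev A \<in> normal_rad"
  shows "contract rad.form v G us * ev A \<in> normal_rad"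
  using us A G
proof (induction us arbitrary: G A)
  case Nil
  show ?case using normal_rad_0 by simp
next
  case (Cons u us)
  define B where "B = Poly_Mapping.single 0 (of_real (- 1)) * A"
  have B: "B \<in> scalar_polys N" unfolding B_def by (intro scalar_polys_closed Cons.prems)
  obtain P where P: "P \<in> scalar_polys N" "rad.form v u = ev P"
    using form_eq_ev[OF v, of u] Cons.prems(1) by auto
  have "G us * ev (P * A) \<in> normal_rad"
    using Cons.prems P by (intro Cons.prems(3) scalar_polys_closed) auto
  moreover have "contract rad.form v (\<lambda>l. G (u # l)) us * ev B \<in> normal_rad"
    using Cons.prems(1) by (intro Cons.IH B Cons.prems(3)) auto
  ultimately have "G us * ev (P * A) + contract rad.form v (\<lambda>l. G (u # l)) us * ev B \<in> normal_rad"
    by (rule normal_rad_add)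
  moreover have "rad.form v u * G us * ev A = G us * ev (P * A)"
    by (simp add: P scalar_eval_rad_mult scalar_eval_rad_central[of _ _ P "G us"] mult.assoc)
  moreover have "contract rad.form v (\<lambda>l. G (u # l)) us * ev B =
      - (contract rad.form v (\<lambda>l. G (u # l)) us * ev A)"
    unfolding B_def scaleR_mult_ev[symmetric] by simp
  ultimately show ?case by (simp add: left_diff_distrib)
qed

lemma rvar_mult_normal:
  assumes v: "v \<in> S" and z: "z \<in> normal_rad"
  shows "rvar v * z \<in> normal_rad"
proof -
  have *: "rvar v * (rad.qwedge us * ev A) \<in> normal_rad"
    if us: "set us \<subseteq> S" and A: "A \<in> scalar_polys N" for us A
  proof -
    define B where "B = Poly_Mapping.single 0 (of_real (1 / 2)) * A"
    have B: "B \<in> scalar_polys N" unfolding B_def by (intro scalar_polys_closed A)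
    have "rvar v * (rad.qwedge us * ev A) = rad.qwedge (v # us) * ev A +
        (1 / 2) *\<^sub>R (contract rad.form v rad.qwedge us * ev A)"
      by (simp add: algebra_simps)
    also have "\<dots> = rad.qwedge (v # us) * ev A + contract rad.form v rad.qwedge us * ev B"
      by (simp only: B_def scaleR_mult_ev)
    also have "\<dots> \<in> normal_rad"
      using v us A B by (intro normal_rad_add qwedge_ev_normal contract_ev_normal) auto
    finally show ?thesis .
  qed
  obtain f where f: "f \<in> normal_forms" and "z = rad_of f"
    using z by (auto simp: normal_rad_def)
  moreover from f have "rvar v * rad_of f \<in> normal_rad"
  proof induction
    case zero
    show ?case using normal_rad_0 by (simp add: rad_of_hom)
  next
    case (wedge I A g)
    then show ?case
      using *[of "nths ys I" A] set_nths_subset[of ys I]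
      by (auto simp: rad_of_hom rad_of_wedge distrib_left intro!: normal_rad_add)
  next
    case (x_wedge I A g)
    then show ?case
      using *[of "x # nths ys I" A] set_nths_subset[of ys I]
      by (auto simp: rad_of_hom rad_of_wedge distrib_left intro!: normal_rad_add
          simp del: rad.qwedge.simps)
  qed
  ultimately show ?thesis by simp
qed

lemma rad_of_normal:
  assumes "f \<in> carrier (free_algebra S)"
  shows "rad_of f \<in> normal_rad"
proof (induction f rule: poly_mapping_keys_induct)
  case zero
  show ?case using normal_rad_0 by (simp add: rad_of_hom)
next
  case (single w c)
  have "prod_list (map rvar us) * rscalar c \<in> normal_rad" if "set us \<subseteq> S" for us
    using that
  proof (induction us)
    case Nil
    \<comment> \<open>A scalar is the empty wedge times a constant polynomial.\<close>
    show ?case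
      using qwedge_ev_normal[of "[]" "Poly_Mapping.single 0 c"]
      by (simp add: scalar_polys_closed ev_single_0)
  next
    case (Cons u us)
    then show ?case by (simp add: mult.assoc rvar_mult_normal)
  qed
  moreover have "set (letters w) \<subseteq> S" using assms single by auto
  ultimately show ?case
    by (simp add: single_eq_scalar_prod rad_of_hom rad_of_prod_list o_def
        flip: rvar_def rscalar_def rscalar_central)
qed (simp add: rad_of_hom normal_rad_add)

lemma right_qderiv_unique:
  assumes D: "is_right_qderiv x ys D" and D': "is_right_qderiv x ys D'"
  shows "D = D'"
proof -
  note D = is_right_qderivD[OF D refl] and D' = is_right_qderivD[OF D' refl]
  have nf: "g \<in> carrier (free_algebra S) \<and> D (cls S g) = D' (cls S g)" if "g \<in> normal_forms" for g
    using that
  proof induction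
    case zero
    \<comment> \<open>The empty wedge with the zero polynomial gives both operators the same value
      at the class of 0.\<close>
    show ?case
      using D(4)[of "{}" 0] D'(4)[of "{}" 0]
      by (simp add: scalar_eval_0 scalar_polys_def)
  next
    case (wedge I A g)
    have "wedge (nths ys I) * scalar_eval x ys A \<in> carrier (free_algebra S)"
      by (intro carrier_intros)
    with wedge show ?case
      by (simp add: D(2,4) D'(2,4) free_algebra_closed del: free_algebra_simps(1))
  next
    case (x_wedge I A g)
    have "wedge (x # nths ys I) * scalar_eval x ys A \<in> carrier (free_algebra S)"
      by (intro carrier_intros)
    with x_wedge show ?case
      by (simp add: D(2,5) D'(2,5) free_algebra_closed del: free_algebra_simps(1))
  qed
  have "D X = D' X" if "X \<in> carrier (radial S)" for X
  proof -
    obtain f where f: "f \<in> carrier (free_algebra S)" "X = cls S f"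
      using \<open>X \<in> carrier (radial S)\<close> unfolding radial_simps by blast
    obtain g where g: "g \<in> normal_forms" "rad_of f = rad_of g"
      using rad_of_normal[OF f(1)] by (auto simp: normal_rad_def)
    then have "cls S f = cls S g"
      using rad_of_eq_iff_cls_eq[of f S g] f nf by blast
    with f nf[OF g(1)] show ?thesis by simp
  qed
  then show ?thesis
    by (rule PiE_ext[OF D(1) D'(1)])
qed

lemma right_qderiv_eqI: "is_right_qderiv x ys D \<Longrightarrow> right_qderiv x ys = D"
  unfolding right_qderiv_def using right_qderiv_unique by (intro the_equality)

lemma is_right_qderiv_right_qderiv: "is_right_qderiv x ys (right_qderiv x ys)"
  using ex_right_qderiv right_qderiv_eqI by metis

end

subsection \<open>Reordering\<close>

text \<open>The substitution of \<open>\<rho> z\<close> for each variable \<open>z\<close>: the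
  double pull-back sends a monomial \<open>m\<close> to \<open>m\<close> composed with the inverse
  of \<open>\<rho>\<close>. Bijectivity of \<open>\<rho>\<close> keeps supports finite and lets the
  pull-back be inverted.\<close>

definition rename_syms :: "(scalar_sym \<Rightarrow> scalar_sym) \<Rightarrow> scalar_poly \<Rightarrow> scalar_poly" where
  "rename_syms \<rho> A = Poly_Mapping.map_key (Poly_Mapping.map_key \<rho>) A"

lemma lookup_map_key: "inj \<rho> \<Longrightarrow> Poly_Mapping.lookup (Poly_Mapping.map_key \<rho> m) z = Poly_Mapping.lookup m (\<rho> z)"
  by (simp add: map_key.rep_eq)

lemma inj_map_key:
  assumes "bij \<rho>"
  shows "inj (Poly_Mapping.map_key \<rho> :: ('b \<Rightarrow>\<^sub>0 'c::zero) \<Rightarrow> 'a \<Rightarrow>\<^sub>0 'c)"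
proof (rule injI, rule poly_mapping_eqI)
  fix m m' :: "'b \<Rightarrow>\<^sub>0 'c" and z
  assume "Poly_Mapping.map_key \<rho> m = Poly_Mapping.map_key \<rho> m'"
  then have "Poly_Mapping.lookup m (\<rho> (inv_into UNIV \<rho> z)) = Poly_Mapping.lookup m' (\<rho> (inv_into UNIV \<rho> z))"
    using assms by (metis bij_is_inj lookup_map_key)
  then show "Poly_Mapping.lookup m z = Poly_Mapping.lookup m' z"
    using assms by (simp add: bij_is_surj surj_f_inv_f)
qed

lemma lookup_rename_syms:
  "bij \<rho> \<Longrightarrow> Poly_Mapping.lookup (rename_syms \<rho> A) m = Poly_Mapping.lookup A (Poly_Mapping.map_key \<rho> m)"
  by (simp add: rename_syms_def lookup_map_key inj_map_key)

lemma rename_syms_add: "rename_syms \<rho> (A + B) = rename_syms \<rho> A + rename_syms \<rho> B" if "bij \<rho>"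
  by (rule poly_mapping_eqI) (simp add: lookup_rename_syms that lookup_add)

lemma map_key_inv: "bij \<rho> \<Longrightarrow> Poly_Mapping.map_key \<rho> (Poly_Mapping.map_key (inv_into UNIV \<rho>) m) = m"
  by (rule poly_mapping_eqI)
    (simp add: lookup_map_key bij_is_inj bij_imp_bij_inv inv_f_f)

lemma rename_syms_single:
  assumes "bij \<rho>"
  shows "rename_syms \<rho> (Poly_Mapping.single m c) =
    Poly_Mapping.single (Poly_Mapping.map_key (inv_into UNIV \<rho>) m) c"
proof -
  have "(Poly_Mapping.map_key \<rho> k = m) = (k = Poly_Mapping.map_key (inv_into UNIV \<rho>) m)" for k
    using map_key_inv[OF assms, of m] inj_map_key[OF assms] by (metis injD)
  note eq = this
  show ?thesis
  proof (rule poly_mapping_eqI)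
    fix k
    show "Poly_Mapping.lookup (rename_syms \<rho> (Poly_Mapping.single m c)) k =
        Poly_Mapping.lookup (Poly_Mapping.single (Poly_Mapping.map_key (inv_into UNIV \<rho>) m) c) k"
      using eq[of k] by (auto simp: lookup_rename_syms assms lookup_single when_def)
  qed
qed

text \<open>By the coefficient formula: the exponent of \<open>\<rho> u\<close> in \<open>m\<close>
  is that of \<open>u\<close> in the pulled-back monomial, and the shift by one variable commutes
  with pulling back.\<close>

lemma jackson_rename_syms:
  assumes "bij \<rho>" "P \<noteq> 1"
  shows "jackson (\<rho> u) P (rename_syms \<rho> A) = rename_syms \<rho> (jackson u P A)"
proof (rule poly_mapping_eqI)
  fix m :: "scalar_sym \<Rightarrow>\<^sub>0 nat"
  have "Poly_Mapping.map_key \<rho> (m + Poly_Mapping.single (\<rho> u) 1) =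
      Poly_Mapping.map_key \<rho> m + Poly_Mapping.single u 1"
    by (rule poly_mapping_eqI)
      (simp add: lookup_map_key bij_is_inj assms lookup_add lookup_single when_def
        inj_eq[OF bij_is_inj[OF assms(1)]])
  then show "Poly_Mapping.lookup (jackson (\<rho> u) P (rename_syms \<rho> A)) m =
      Poly_Mapping.lookup (rename_syms \<rho> (jackson u P A)) m"
    by (simp add: lookup_jackson assms lookup_rename_syms lookup_map_key bij_is_inj)
qed

lemma scale_sym_rename_syms:
  assumes "bij \<rho>"
  shows "scale_sym (\<rho> u) P (rename_syms \<rho> A) = rename_syms \<rho> (scale_sym u P A)"
  by (rule poly_mapping_eqI)
    (simp add: lookup_scale_sym assms lookup_rename_syms lookup_map_key bij_is_inj)

lemma rename_syms_scalar_polys: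
  assumes "bij \<rho>" and \<rho>: "\<rho> ` set (scalar_syms N) = set (scalar_syms N)" and A: "A \<in> scalar_polys N"
  shows "rename_syms \<rho> A \<in> scalar_polys N"
  unfolding scalar_polys_def
proof (intro CollectI ballI subsetI)
  fix m z assume m: "m \<in> Poly_Mapping.keys (rename_syms \<rho> A)" and z: "z \<in> Poly_Mapping.keys m"
  have "Poly_Mapping.map_key \<rho> m \<in> Poly_Mapping.keys A"
    using m by (simp add: in_keys_iff lookup_rename_syms assms(1))
  then have "Poly_Mapping.keys (Poly_Mapping.map_key \<rho> m) \<subseteq> set (scalar_syms N)"
    using A by (simp add: scalar_polys_def)
  moreover have "inv_into UNIV \<rho> z \<in> Poly_Mapping.keys (Poly_Mapping.map_key \<rho> m)"
    using z assms(1) by (simp add: in_keys_iff lookup_map_key bij_is_inj bij_is_surj surj_f_inv_f)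
  ultimately have "\<rho> (inv_into UNIV \<rho> z) \<in> set (scalar_syms N)"
    using \<rho> by blast
  then show "z \<in> set (scalar_syms N)"
    using assms(1) by (simp add: bij_is_surj surj_f_inv_f)
qed

text \<open>\<open>c\<^sub>i\<^sub>j\<close> is carried by the symbol with \<open>i \<le> j\<close>,
  so the images are put in increasing order again. Symbols with \<open>i > j\<close> stay
  decreasing, which makes the map a bijection of the whole type, as \<open>rename_syms\<close>
  requires.\<close>

fun permute_sym :: "(nat \<Rightarrow> nat) \<Rightarrow> scalar_sym \<Rightarrow> scalar_sym" where
  "permute_sym \<pi> Sc_r = Sc_r"
| "permute_sym \<pi> (Sc_s i) = Sc_s (\<pi> i)"
| "permute_sym \<pi> (Sc_c i j) = (if i \<le> j then Sc_c (min (\<pi> i) (\<pi> j)) (max (\<pi> i) (\<pi> j))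
    else Sc_c (max (\<pi> i) (\<pi> j)) (min (\<pi> i) (\<pi> j)))"

lemma permute_sym_inverse:
  assumes "\<And>i. \<pi> (\<pi>' i) = i"
  shows "permute_sym \<pi> (permute_sym \<pi>' z) = z"
proof (cases z)
  case (Sc_c i j)
  have "\<pi>' i \<noteq> \<pi>' j" if "i \<noteq> j" using that assms by metis
  then show ?thesis using Sc_c assms[of i] assms[of j] by (auto simp: min_def max_def)
qed (simp_all add: assms)

lemma bij_permute_sym:
  assumes "\<pi> permutes A"
  shows "bij (permute_sym \<pi>)"
  by (rule bij_betw_byWitness[of _ "permute_sym (inv_into UNIV \<pi>)"])
    (auto simp: permute_sym_inverse permutes_inverses[OF assms])

text \<open>The map is injective and the set finite, so it suffices that no symbol leaves the
  set.\<close>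

lemma permute_sym_scalar_syms:
  assumes \<pi>: "\<pi> permutes {..<N}"
  shows "permute_sym \<pi> ` set (scalar_syms N) = set (scalar_syms N)"
proof (rule card_subset_eq)
  show "permute_sym \<pi> ` set (scalar_syms N) \<subseteq> set (scalar_syms N)"
  proof
    fix z assume "z \<in> permute_sym \<pi> ` set (scalar_syms N)"
    then obtain y where y: "y \<in> set (scalar_syms N)" "z = permute_sym \<pi> y" by blast
    have "\<pi> i < N" if "i < N" for i
      using permutes_in_image[OF \<pi>, of i] that by simp
    with y(1) show "z \<in> set (scalar_syms N)"
      unfolding y(2) set_scalar_syms by (cases y) auto
  qed
  show "card (permute_sym \<pi> ` set (scalar_syms N)) = card (set (scalar_syms N))"
    using bij_permute_sym[OF \<pi>] by (intro card_image inj_on_subset[OF bij_is_inj]) auto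
qed simp

locale reordered_lists =
  fixes x :: 'v and ys :: "'v list" and \<pi> :: "nat \<Rightarrow> nat" and zs :: "'v list"
  assumes \<pi>: "\<pi> permutes {..<length ys}"
    and zs: "zs = map (\<lambda>i. ys ! \<pi> i) [0..<length ys]"
begin

abbreviation \<rho> :: "scalar_sym \<Rightarrow> scalar_sym" where "\<rho> \<equiv> permute_sym \<pi>"

lemma bij_\<rho>: "bij \<rho>"
  using \<pi> by (rule bij_permute_sym)

lemma scalar_val_reorder:
  assumes "z \<in> set (scalar_syms (length ys))"
  shows "scalar_val x zs z = scalar_val x ys (\<rho> z)"
proof (cases z)
  case (Sc_c i j)
  then have "i \<le> j" "i < length ys" "j < length ys"
    using assms by (auto simp: set_scalar_syms)
  then show ?thesis
    by (simp add: Sc_c zs min_def max_def anticomm_def add.commute)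
qed (use assms in \<open>auto simp: set_scalar_syms zs\<close>)

text \<open>Renaming permutes the factors of the monomial; centrality restores their order, so the
  identity lives in \<open>rad\<close>.\<close>

lemma scalar_monomial_reorder:
  "rad_of (scalar_monomial x zs m) =
    rad_of (scalar_monomial x ys (Poly_Mapping.map_key (inv_into UNIV \<rho>) m))"
proof -
  have inj: "inj \<rho>" "inj (inv_into UNIV \<rho>)"
    using bij_\<rho> bij_imp_bij_inv bij_is_inj by blast+
  define g where "g z = rad_of (scalar_val x ys z) ^ Poly_Mapping.lookup m (inv_into UNIV \<rho> z)" for z
  have "rad_of (scalar_monomial x zs m) = prod_list (map (\<lambda>z. g (\<rho> z)) (scalar_syms (length ys)))"
    unfolding rad_of_scalar_monomial
    by (intro arg_cong[of _ _ prod_list] map_cong)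
      (auto simp: g_def zs scalar_val_reorder[unfolded zs] inv_f_f[OF inj(1)])
  also have "\<dots> = prod_list (map g (map \<rho> (scalar_syms (length ys))))"
    by (simp add: o_def)
  also have "\<dots> = prod_list (map g (scalar_syms (length ys)))"
  proof (rule prod_list_mset_central)
    show "g z * w = w * g z" for z w
      unfolding g_def by (rule scalar_val_power_rad_central)
    have "distinct (map \<rho> (scalar_syms (length ys)))"
      using distinct_scalar_syms inj(1) by (simp add: distinct_map inj_on_def inj_def)
    then show "mset (map \<rho> (scalar_syms (length ys))) = mset (scalar_syms (length ys))"
      using set_eq_iff_mset_eq_distinct[OF _ distinct_scalar_syms]
        permute_sym_scalar_syms[OF \<pi>] by (metis set_map)
  qed
  also have "\<dots> = rad_of (scalar_monomial x ys (Poly_Mapping.map_key (inv_into UNIV \<rho>) m))"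
    unfolding rad_of_scalar_monomial by (simp add: g_def[abs_def] lookup_map_key inj)
  finally show ?thesis .
qed

lemma scalar_eval_reorder:
  "rad_of (scalar_eval x zs A) = rad_of (scalar_eval x ys (rename_syms \<rho> A))"
proof (induction A rule: poly_mapping_keys_induct)
  case zero
  have "rename_syms \<rho> 0 = 0"
    by (rule poly_mapping_eqI) (simp add: lookup_rename_syms bij_\<rho>)
  then show ?case by (simp add: scalar_eval_0)
next
  case (single m c)
  then show ?case
    by (simp add: rename_syms_single bij_\<rho> scalar_eval_single rad_of_hom scalar_monomial_reorder)
qed (simp add: rename_syms_add bij_\<rho> scalar_eval_add rad_of_hom)

text \<open>The symbol of \<open>r\<close> is fixed and that of \<open>s\<^sub>i\<close> moves to
  index \<open>\<pi> i\<close>, so the sum over \<open>Y\<close> is reindexed by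
  \<open>\<pi>\<close>.\<close>

lemma dsc_reorder: "rad_of (dsc x zs A) = rad_of (dsc x ys (rename_syms \<rho> A))"
proof -
  have r: "jackson Sc_r P (rename_syms \<rho> A) = rename_syms \<rho> (jackson Sc_r P A)" if "P \<noteq> 1" for P A
    using jackson_rename_syms[OF bij_\<rho> that, of Sc_r A] by simp
  have s: "jackson (Sc_s (\<pi> i)) P (rename_syms \<rho> A) = rename_syms \<rho> (jackson (Sc_s i) P A)" if "P \<noteq> 1" for P A i
    using jackson_rename_syms[OF bij_\<rho> that, of "Sc_s i" A] by simp
  have t: "scale_sym Sc_r P (rename_syms \<rho> A) = rename_syms \<rho> (scale_sym Sc_r P A)" for P A
    using scale_sym_rename_syms[OF bij_\<rho>, of Sc_r P A] by simp
  define h where "h i = rad_of (var (ys ! i)) *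
    rad_of (scalar_eval x ys (scale_sym Sc_r (q_par ^ 2) (jackson (Sc_s i) q_par (rename_syms \<rho> A))))" for i
  have 2: "rad_of (2 * f) = rad_of f + rad_of f" for f :: "('v, coeff_ring) free_alg"
    by (simp add: mult_2 rad_of_hom)
  have len: "length zs = length ys" by (simp add: zs)
  have "(\<Sum>i<length ys. rad_of (var (zs ! i)) *
      rad_of (scalar_eval x zs (scale_sym Sc_r (q_par ^ 2) (jackson (Sc_s i) q_par A)))) =
      (\<Sum>i<length ys. h (\<pi> i))"
    by (rule sum.cong) (simp_all add: h_def scalar_eval_reorder s t q_par_powers zs[THEN arg_cong, of "\<lambda>l. l ! _"])
  also have "\<dots> = (\<Sum>i<length ys. h i)"
    using sum.permute[OF \<pi>, of h] by (simp add: o_def)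
  finally show ?thesis
    by (simp add: dsc_def 2 rad_of_hom rad_of_sum len h_def scalar_eval_reorder r q_par_powers)
qed

end

lemma is_right_qderiv_reorder:
  fixes x :: 'v
  assumes D: "is_right_qderiv x ys D" and dist: "distinct ys" "distinct zs" and set: "set ys = set zs"
    and x: "x \<notin> set ys"
  shows "is_right_qderiv x zs D"
proof -
  have "mset zs = mset ys"
    using dist set set_eq_iff_mset_eq_distinct by metis
  then obtain \<pi> where \<pi>: "\<pi> permutes {..<length ys}" "permute_list \<pi> ys = zs"
    by (rule mset_eq_permutation)
  interpret reordered_lists x ys \<pi> zs
    by standard (use \<pi> in \<open>auto simp: permute_list_def\<close>)
  have len: "length zs = length ys" by (simp add: zs)
  define S where "S = insert x (set ys)"
  have S: "S = insert x (set zs)" by (simp add: S_def set)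
  note D = is_right_qderivD[OF D S_def]
  have carrier: "wedge (nths ys I) \<in> carrier (free_algebra S)" "wedge (x # nths ys I) \<in> carrier (free_algebra S)"
    "wedge (nths zs I) \<in> carrier (free_algebra S)" "wedge (x # nths zs I) \<in> carrier (free_algebra S)"
    "scalar_eval x ys A \<in> carrier (free_algebra S)" "scalar_eval x zs A \<in> carrier (free_algebra S)"
    "dsc x ys A \<in> carrier (free_algebra S)" "dsc x zs A \<in> carrier (free_algebra S)" for I A
    using set_nths_subset[of ys I] set_nths_subset[of zs I]
      scalar_eval_carrier[of x ys A] scalar_eval_carrier[of x zs A]
      dsc_carrier[of x ys A] dsc_carrier[of x zs A]
    by (auto simp del: free_algebra_simps(1) simp: S_def set intro!: wedge_carrier)
  note carrier = carrier free_algebra_closed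
  \<comment> \<open>Position \<open>i\<close> of \<open>zs\<close> is position
    \<open>\<pi> i\<close> of \<open>ys\<close>, so \<open>I\<close> corresponds to its image under
    \<open>\<pi>\<close>. One sign serves both families, with and without \<open>x\<close>, and
    therefore factors out of both terms of the second formula.\<close>
  have wedge: "\<exists>\<epsilon>::real. rad_of (wedge (nths zs I)) = \<epsilon> *\<^sub>R rad_of (wedge (nths ys (\<pi> ` I)) :: ('v, coeff_ring) free_alg)
      \<and> rad_of (wedge (x # nths zs I)) = \<epsilon> *\<^sub>R rad_of (wedge (x # nths ys (\<pi> ` I)) :: ('v, coeff_ring) free_alg)"
    if I: "I \<subseteq> {..<length ys}" for I
  proof -
    have "set (nths zs I) = (\<lambda>i. zs ! i) ` I" "set (nths ys (\<pi> ` I)) = (\<lambda>i. ys ! i) ` \<pi> ` I"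
      using I permutes_in_image[OF \<pi>(1)] by (auto simp: set_nths len)
    moreover have "zs ! i = ys ! \<pi> i" if "i \<in> I" for i
      using that I by (auto simp: zs)
    ultimately have "set (nths zs I) = set (nths ys (\<pi> ` I))"
      by (auto simp: image_image)
    then have "mset (nths zs I) = mset (nths ys (\<pi> ` I))"
      using dist by (metis distinct_nthsI set_eq_iff_mset_eq_distinct)
    then obtain \<epsilon> :: real where
      \<epsilon>: "\<And>F :: 'v list \<Rightarrow> ('v, coeff_ring) rad. alternating F \<Longrightarrow> F (nths zs I) = \<epsilon> *\<^sub>R F (nths ys (\<pi> ` I))"
      by (rule alternating_mset[where 'r = "('v, coeff_ring) rad"]) blast
    from \<epsilon>[OF rad.alternating_qwedge] \<epsilon>[OF alternating_prefix[OF rad.alternating_qwedge, of "[x]"]]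
    show ?thesis by (intro exI[of _ \<epsilon>]) (simp add: rad_of_wedge del: rad.qwedge.simps)
  qed
  have eq: "cls S f = cls S (scalar (of_real \<epsilon>) * g)"
    if "f \<in> carrier (free_algebra S)" "g \<in> carrier (free_algebra S)" "rad_of f = \<epsilon> *\<^sub>R rad_of g" for \<epsilon> f g
    using that by (subst rad_of_eq_iff_cls_eq)
      (simp_all add: free_algebra_closed rad_of_scalar_of_real del: free_algebra_simps(1))
  show ?thesis
  proof (rule is_right_qderivI[OF S], unfold len, goal_cases)
    case 1 show ?case by (rule D(1))
  next
    case 2 then show ?case by (rule D(2))
  next
    case 3 then show ?case by (rule D(3))
  next
    case (4 I A)
    obtain \<epsilon> :: real where \<epsilon>: "rad_of (wedge (nths zs I)) = \<epsilon> *\<^sub>R rad_of (wedge (nths ys (\<pi> ` I)) :: ('v, coeff_ring) free_alg)"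
      using wedge[OF 4(1)] by blast
    have I: "\<pi> ` I \<subseteq> {..<length ys}"
      using 4(1) permutes_in_image[OF \<pi>(1)] by auto
    have A: "rename_syms \<rho> A \<in> scalar_polys (length ys)"
      by (intro rename_syms_scalar_polys bij_\<rho> permute_sym_scalar_syms \<pi> 4)
    have "cls S (wedge (nths zs I) * scalar_eval x zs A) =
        cls S (scalar (of_real \<epsilon>) * (wedge (nths ys (\<pi> ` I)) * scalar_eval x ys (rename_syms \<rho> A)))"
      by (rule eq) (intro carrier, intro carrier, simp add: rad_of_hom \<epsilon> scalar_eval_reorder)
    then have "D (cls S (wedge (nths zs I) * scalar_eval x zs A)) =
        cls S (scalar (of_real \<epsilon>) * (wedge (nths ys (\<pi> ` I)) * dsc x ys (rename_syms \<rho> A)))"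
      by (simp add: D(3,4) I A carrier radial_simps(3) del: free_algebra_simps(1))
    also have "\<dots> = cls S (wedge (nths zs I) * dsc x zs A)"
      by (rule eq[symmetric]) (intro carrier, intro carrier, simp add: rad_of_hom \<epsilon> dsc_reorder)
    finally show ?case .
  next
    case (5 I A)
    obtain \<epsilon> :: real where \<epsilon>: "rad_of (wedge (nths zs I)) = \<epsilon> *\<^sub>R rad_of (wedge (nths ys (\<pi> ` I)) :: ('v, coeff_ring) free_alg)"
      "rad_of (wedge (x # nths zs I)) = \<epsilon> *\<^sub>R rad_of (wedge (x # nths ys (\<pi> ` I)) :: ('v, coeff_ring) free_alg)"
      using wedge[OF 5(1)] by blast
    have I: "\<pi> ` I \<subseteq> {..<length ys}"
      using 5(1) permutes_in_image[OF \<pi>(1)] by auto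
    \<comment> \<open>The degree is unchanged, so \<open>qm_number\<close>, \<open>qm_power\<close>
      and the sign are taken at the same argument for both orderings.\<close>
    have card: "card (\<pi> ` I) = card I"
      by (intro card_image inj_on_subset[OF permutes_inj[OF \<pi>(1)]]) simp
    have A: "rename_syms \<rho> A \<in> scalar_polys (length ys)"
      by (intro rename_syms_scalar_polys bij_\<rho> permute_sym_scalar_syms \<pi> 5)
    have "cls S (wedge (x # nths zs I) * scalar_eval x zs A) =
        cls S (scalar (of_real \<epsilon>) * (wedge (x # nths ys (\<pi> ` I)) * scalar_eval x ys (rename_syms \<rho> A)))"
      by (rule eq) (intro carrier, intro carrier, simp add: rad_of_hom \<epsilon> scalar_eval_reorder)
    then have "D (cls S (wedge (x # nths zs I) * scalar_eval x zs A)) =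
        cls S (scalar (of_real \<epsilon>) *
          (scalar ((- 1) ^ card I * qm_number (- int (card I))) *
             wedge (nths ys (\<pi> ` I)) * scalar_eval x ys (rename_syms \<rho> A) +
           scalar (qm_power (- int (card I))) * wedge (x # nths ys (\<pi> ` I)) * dsc x ys (rename_syms \<rho> A)))"
      by (simp add: D(3,5) I A carrier radial_simps(3) card del: free_algebra_simps(1))
    also have "\<dots> = cls S (scalar ((- 1) ^ card I * qm_number (- int (card I))) *
             wedge (nths zs I) * scalar_eval x zs A +
           scalar (qm_power (- int (card I))) * wedge (x # nths zs I) * dsc x zs A)"
      by (rule eq[symmetric]) (intro carrier, intro carrier,
          simp add: rad_of_hom \<epsilon> dsc_reorder scalar_eval_reorder scaleR_add_right)
    finally show ?case .
  qed
qed

subsection \<open>Substitution of variables\<close>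

definition subst_vars :: "('v \<Rightarrow> 'v) \<Rightarrow> ('v, 'k::comm_ring_1) free_alg \<Rightarrow> ('v, 'k) free_alg" where
  "subst_vars \<sigma> f = (\<Sum>w\<in>Poly_Mapping.keys f.
     Poly_Mapping.single (Word (map \<sigma> (letters w))) (Poly_Mapping.lookup f w))"

lemma subst_vars_0: "subst_vars \<sigma> 0 = 0"
  by (simp add: subst_vars_def)

lemma subst_vars_single:
  "subst_vars \<sigma> (Poly_Mapping.single w c) = Poly_Mapping.single (Word (map \<sigma> (letters w))) c"
  by (simp add: subst_vars_def)

lemma subst_vars_add: "subst_vars \<sigma> (f + g) = subst_vars \<sigma> f + subst_vars \<sigma> g"
proof -
  define A where "A = Poly_Mapping.keys f \<union> Poly_Mapping.keys g"
  have *: "subst_vars \<sigma> h = (\<Sum>w\<in>A. Poly_Mapping.single (Word (map \<sigma> (letters w))) (Poly_Mapping.lookup h w))"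
    if "Poly_Mapping.keys h \<subseteq> A" for h
    unfolding subst_vars_def using that
    by (intro sum.mono_neutral_left) (auto simp: A_def in_keys_iff)
  show ?thesis
    by (subst (1 2 3) *) (auto simp: A_def lookup_add single_add sum.distrib
        dest: subsetD[OF Poly_Mapping.keys_add])
qed

lemma subst_vars_diff: "subst_vars \<sigma> (f - g) = subst_vars \<sigma> f - subst_vars \<sigma> g"
  using subst_vars_add[of \<sigma> "f - g" g] by (simp add: algebra_simps)

lemma subst_vars_mult: "subst_vars \<sigma> (f * g) = subst_vars \<sigma> f * subst_vars \<sigma> g"
proof (induction f rule: poly_mapping_keys_induct)
  case (single v c)
  show ?case
    by (induction g rule: poly_mapping_keys_induct)
      (simp_all add: subst_vars_0 subst_vars_add distrib_left mult_single
        subst_vars_single plus_word.rep_eq Word_plus)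
qed (simp_all add: subst_vars_0 subst_vars_add distrib_right)

lemma subst_vars_scalar: "subst_vars \<sigma> (scalar c) = scalar c"
  by (simp add: scalar_def subst_vars_single zero_eq_Word Word_inverse)

lemma subst_vars_1: "subst_vars \<sigma> 1 = 1"
  using subst_vars_scalar[of \<sigma> 1] by (simp add: scalar_simps)

lemma subst_vars_var: "subst_vars \<sigma> (var v) = var (\<sigma> v)"
  by (simp add: var_def subst_vars_single Word_inverse)

lemma subst_vars_sum: "subst_vars \<sigma> (sum h A) = (\<Sum>a\<in>A. subst_vars \<sigma> (h a))"
  by (induction A rule: infinite_finite_induct) (simp_all add: subst_vars_0 subst_vars_add)

lemma subst_vars_prod_list: "subst_vars \<sigma> (prod_list xs) = prod_list (map (subst_vars \<sigma>) xs)"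
  by (induction xs) (simp_all add: subst_vars_1 subst_vars_mult)

lemma subst_vars_power: "subst_vars \<sigma> (f ^ n) = subst_vars \<sigma> f ^ n"
  by (induction n) (simp_all add: subst_vars_1 subst_vars_mult)

lemma subst_vars_of_int: "subst_vars \<sigma> (of_int n) = of_int n"
  using subst_vars_scalar[of \<sigma> "of_int n"] by (simp only: scalar_of_int)

lemma subst_vars_anticomm:
  "subst_vars \<sigma> (anticomm f g) = anticomm (subst_vars \<sigma> f) (subst_vars \<sigma> g)"
  by (simp add: anticomm_def subst_vars_add subst_vars_mult)

lemmas subst_vars_hom = subst_vars_add subst_vars_diff subst_vars_mult subst_vars_scalar
  subst_vars_1 subst_vars_var subst_vars_sum subst_vars_prod_list subst_vars_power
  subst_vars_of_int subst_vars_anticomm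

lemma subst_vars_rad_null: "a \<in> rad_null \<Longrightarrow> subst_vars \<sigma> a \<in> rad_null"
proof (induction rule: rad_null.induct)
  case (relator u v w)
  show ?case by (simp add: comm_def subst_vars_hom) (simp add: rad_null.relator flip: comm_def)
qed (simp_all add: subst_vars_0 subst_vars_hom rad_null.intros)

lemma subst_vars_carrier:
  assumes "f \<in> carrier (free_algebra S)" "\<sigma> ` S \<subseteq> T"
  shows "subst_vars \<sigma> f \<in> carrier (free_algebra T)"
  unfolding subst_vars_def
  by (rule free_algebra_sum) (use assms in \<open>auto simp: Word_inverse\<close>)

lemma subst_vars_inverse:
  assumes "f \<in> carrier (free_algebra S)" "\<And>v. v \<in> S \<Longrightarrow> \<sigma>' (\<sigma> v) = v"
  shows "subst_vars \<sigma>' (subst_vars \<sigma> f) = f"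
proof (induction f rule: poly_mapping_keys_induct)
  case (single w c)
  then have "set (letters w) \<subseteq> S" using assms(1) by auto
  then have "map (\<sigma>' \<circ> \<sigma>) (letters w) = letters w"
    by (intro map_idI) (use assms(2) in auto)
  then show ?case by (simp add: subst_vars_single Word_inverse letters_inverse)
qed (simp_all add: subst_vars_0 subst_vars_add)

lemma subst_vars_wedge: "subst_vars \<sigma> (wedge us) = wedge (map \<sigma> us)"
proof -
  have "prod_list (map (\<lambda>i. var (\<sigma> (us ! \<pi> i))) [0..<length us]) =
      (prod_list (map (\<lambda>i. var (map \<sigma> us ! \<pi> i)) [0..<length us]) :: ('a, 'b) free_alg)"
    if "\<pi> permutes {..<length us}" for \<pi>
    using permutes_in_image[OF that] by (intro arg_cong[of _ _ prod_list] map_cong) auto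
  then have "(\<Sum>\<pi> | \<pi> permutes {..<length us}.
      of_int (sign \<pi>) * prod_list (map (\<lambda>i. var (\<sigma> (us ! \<pi> i))) [0..<length us])) =
      (\<Sum>\<pi> | \<pi> permutes {..<length us}.
      of_int (sign \<pi>) * prod_list (map (\<lambda>i. var (map \<sigma> us ! \<pi> i)) [0..<length us]) :: ('a, 'b) free_alg)"
    by (intro sum.cong) auto
  then show ?thesis
    by (simp add: wedge_def subst_vars_hom o_def)
qed

text \<open>Scalar variables are numbered by positions, and \<open>map \<sigma>\<close> keeps
  positions; hence the same polynomial serves on both sides, already in the free algebra.\<close>

lemma subst_vars_scalar_eval:
  "subst_vars \<sigma> (scalar_eval x ys A) = scalar_eval (\<sigma> x) (map \<sigma> ys) A"
proof -
  have "subst_vars \<sigma> (scalar_val x ys z) = scalar_val (\<sigma> x) (map \<sigma> ys) z"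
    if "z \<in> set (scalar_syms (length ys))" for z
    using that by (auto simp: set_scalar_syms subst_vars_hom)
  then show ?thesis
    by (simp add: scalar_eval_def subst_vars_hom o_def cong: map_cong)
qed

lemma subst_vars_dsc: "subst_vars \<sigma> (dsc x ys A) = dsc (\<sigma> x) (map \<sigma> ys) A"
proof -
  have "subst_vars \<sigma> 2 = (2 :: ('a, coeff_ring) free_alg)"
    using subst_vars_of_int[of \<sigma> 2] by simp
  then show ?thesis
    by (simp add: dsc_def subst_vars_hom subst_vars_scalar_eval)
qed

section \<open>The isomorphism induced by a bijection of the variables\<close>

definition radial_map ::
  "('v \<Rightarrow> 'v) \<Rightarrow> 'v set \<Rightarrow> 'v set \<Rightarrow> ('v, 'k::comm_ring_1) free_alg set \<Rightarrow> ('v, 'k) free_alg set" where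
  "radial_map \<sigma> S T X = cls T (subst_vars \<sigma> (SOME f. f \<in> carrier (free_algebra S) \<and> cls S f = X))"

text \<open>Substitution maps null elements to null elements, so the class of the result is the same
  for all representatives.\<close>

lemma radial_map_cls:
  assumes f: "f \<in> carrier (free_algebra S)" and \<sigma>: "\<sigma> ` S \<subseteq> T"
  shows "radial_map \<sigma> S T (cls S f) = cls T (subst_vars \<sigma> f)"
proof -
  define f' where "f' = (SOME g. g \<in> carrier (free_algebra S) \<and> cls S g = cls S f)"
  have f': "f' \<in> carrier (free_algebra S) \<and> cls S f' = cls S f"
    unfolding f'_def by (rule someI[of _ f]) (use f in blast)
  then have "rad_of f' = rad_of f"
    using rad_of_eq_iff_cls_eq[OF _ f] by blast
  then have "rad_of (subst_vars \<sigma> f') = rad_of (subst_vars \<sigma> f)"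
    using subst_vars_rad_null[of "f' - f" \<sigma>] by (simp add: rad_of_eq_iff subst_vars_diff)
  then have "cls T (subst_vars \<sigma> f') = cls T (subst_vars \<sigma> f)"
    using f f' \<sigma> by (subst rad_of_eq_iff_cls_eq) (auto intro!: subst_vars_carrier simp del: free_algebra_simps(1))
  then show ?thesis by (simp add: radial_map_def f'_def)
qed

text \<open>Carrying the inverse as a parameter makes the situation symmetric: facts about
  \<open>\<sigma>\<close> are available for \<open>\<sigma>'\<close> through the sublocale that
  exchanges them.\<close>

locale var_bijection =
  fixes \<sigma> \<sigma>' :: "'v \<Rightarrow> 'v" and S T :: "'v set"
  assumes \<sigma>_image: "\<sigma> ` S \<subseteq> T" and \<sigma>'_image: "\<sigma>' ` T \<subseteq> S"
    and \<sigma>'_\<sigma>: "v \<in> S \<Longrightarrow> \<sigma>' (\<sigma> v) = v" and \<sigma>_\<sigma>': "v \<in> T \<Longrightarrow> \<sigma> (\<sigma>' v) = v"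
begin

lemma subst_vars_inv: "f \<in> carrier (free_algebra S) \<Longrightarrow> subst_vars \<sigma>' (subst_vars \<sigma> f) = f"
  by (rule subst_vars_inverse[of _ S]) (assumption, rule \<sigma>'_\<sigma>)

lemma radial_map_carrier:
  "X \<in> carrier (radial S) \<Longrightarrow> radial_map \<sigma> S T X \<in> carrier (radial T)"
  unfolding radial_simps
  by (auto simp: radial_map_cls \<sigma>_image simp del: free_algebra_simps(1)
      intro!: imageI subst_vars_carrier[OF _ \<sigma>_image])

lemma radial_map_inverse:
  "X \<in> carrier (radial S) \<Longrightarrow> radial_map \<sigma>' T S (radial_map \<sigma> S T X) = X"
  unfolding radial_simps
  by (auto simp: radial_map_cls \<sigma>_image \<sigma>'_image subst_vars_carrier subst_vars_inv
      simp del: free_algebra_simps(1))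

lemma radial_map_hom:
  assumes "X \<in> carrier (radial S)" "Y \<in> carrier (radial S)"
  shows "radial_map \<sigma> S T (X \<oplus>\<^bsub>radial S\<^esub> Y) = radial_map \<sigma> S T X \<oplus>\<^bsub>radial T\<^esub> radial_map \<sigma> S T Y"
    "radial_map \<sigma> S T (X \<otimes>\<^bsub>radial S\<^esub> Y) = radial_map \<sigma> S T X \<otimes>\<^bsub>radial T\<^esub> radial_map \<sigma> S T Y"
proof -
  obtain f g where fg: "f \<in> carrier (free_algebra S)" "X = cls S f"
      "g \<in> carrier (free_algebra S)" "Y = cls S g"
    using assms unfolding radial_simps by blast
  moreover have "subst_vars \<sigma> f \<in> carrier (free_algebra T)" "subst_vars \<sigma> g \<in> carrier (free_algebra T)"
    using fg \<sigma>_image by (auto intro!: subst_vars_carrier simp del: free_algebra_simps(1))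
  ultimately show
    "radial_map \<sigma> S T (X \<oplus>\<^bsub>radial S\<^esub> Y) = radial_map \<sigma> S T X \<oplus>\<^bsub>radial T\<^esub> radial_map \<sigma> S T Y"
    "radial_map \<sigma> S T (X \<otimes>\<^bsub>radial S\<^esub> Y) = radial_map \<sigma> S T X \<otimes>\<^bsub>radial T\<^esub> radial_map \<sigma> S T Y"
    by (simp_all add: radial_simps radial_map_cls \<sigma>_image free_algebra_closed subst_vars_hom
        del: free_algebra_simps(1))
qed

end

sublocale var_bijection \<subseteq> inverse: var_bijection \<sigma>' \<sigma> T S
  by standard (simp_all add: \<sigma>_image \<sigma>'_image \<sigma>'_\<sigma> \<sigma>_\<sigma>')

lemma (in var_bijection) radial_map_ring_iso:
  "radial_map \<sigma> S T \<in> ring_iso (radial S) (radial T)"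
proof -
  have "radial_map \<sigma> S T \<in> ring_hom (radial S) (radial T)"
    by (rule ring_hom_memI)
      (simp_all add: radial_map_carrier radial_map_hom radial_simps(4) radial_map_cls
        free_algebra_closed \<sigma>_image subst_vars_1 del: free_algebra_simps(1))
  moreover have "bij_betw (radial_map \<sigma> S T) (carrier (radial S)) (carrier (radial T))"
    by (rule bij_betw_byWitness[of _ "radial_map \<sigma>' T S"])
      (auto simp: radial_map_inverse inverse.radial_map_inverse radial_map_carrier
        inverse.radial_map_carrier)
  ultimately show ?thesis by (simp add: ring_iso_def)
qed

text \<open>Conjugation by the induced isomorphism. Each formula for \<open>map \<sigma> ys\<close>
  is the image under \<open>\<sigma>\<close> of the one for \<open>ys\<close>, with the same index
  set and the same polynomial.\<close>

lemma is_right_qderiv_transport: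
  fixes x :: 'v
  assumes D: "is_right_qderiv x ys D"
    and bij: "var_bijection \<sigma> \<sigma>' S T"
    and S: "S = insert x (set ys)" and T: "T = insert x (set (map \<sigma> ys))" and x: "\<sigma> x = x"
  shows "is_right_qderiv x (map \<sigma> ys)
    (\<lambda>X\<in>carrier (radial T). radial_map \<sigma> S T (D (radial_map \<sigma>' T S X)))"
    (is "is_right_qderiv _ _ ?D'")
proof -
  interpret var_bijection \<sigma> \<sigma>' S T by (rule bij)
  note D = is_right_qderivD[OF D S]
  have D_closed: "D X \<in> carrier (radial S)" if "X \<in> carrier (radial S)" for X
    using D(1) that by auto
  have D': "?D' (cls T f) = radial_map \<sigma> S T (D (cls S (subst_vars \<sigma>' f)))"
    if "f \<in> carrier (free_algebra T)" for f
    using that by (simp add: cls_carrier radial_map_cls \<sigma>'_image del: free_algebra_simps(1))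
  have D'_subst: "?D' (cls T (subst_vars \<sigma> f)) = cls T (subst_vars \<sigma> g)"
    if "f \<in> carrier (free_algebra S)" "g \<in> carrier (free_algebra S)" "D (cls S f) = cls S g" for f g
    using that D'[OF subst_vars_carrier[OF that(1) \<sigma>_image]]
    by (simp add: subst_vars_inv radial_map_cls \<sigma>_image del: free_algebra_simps(1))
  have sub': "subst_vars \<sigma>' f \<in> carrier (free_algebra S)" if "f \<in> carrier (free_algebra T)" for f :: "('v, coeff_ring) free_alg"
    using that \<sigma>'_image by (rule subst_vars_carrier)
  have carrier: "wedge (nths ys I) \<in> carrier (free_algebra S)" "wedge (x # nths ys I) \<in> carrier (free_algebra S)"
    "scalar_eval x ys A \<in> carrier (free_algebra S)" "dsc x ys A \<in> carrier (free_algebra S)" for I A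
    using set_nths_subset[of ys I] scalar_eval_carrier[of x ys A] dsc_carrier[of x ys A]
    by (auto simp del: free_algebra_simps(1) simp: S intro!: wedge_carrier)
  note carrier = carrier free_algebra_closed
  show ?thesis
  proof (rule is_right_qderivI[OF T], goal_cases)
    case 1
    show ?case
      by (auto simp: inverse.radial_map_carrier radial_map_carrier D_closed)
  next
    case (2 f g)
    then show ?case
      by (subst (1 2 3) D')
        (simp_all add: free_algebra_closed subst_vars_hom D(2) sub' radial_map_hom D_closed cls_carrier
          del: free_algebra_simps(1))
  next
    case (3 f c)
    then show ?case
      by (subst (1 2) D')
        (simp_all add: free_algebra_closed subst_vars_hom D(3) sub' radial_map_hom D_closed cls_carrier
          radial_map_cls \<sigma>_image del: free_algebra_simps(1))
  next
    case (4 I A)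
    then have "D (cls S (wedge (nths ys I) * scalar_eval x ys A)) = cls S (wedge (nths ys I) * dsc x ys A)"
      by (intro D(4)) auto
    from D'_subst[OF _ _ this] show ?case
      by (simp add: carrier subst_vars_hom subst_vars_wedge subst_vars_scalar_eval subst_vars_dsc
          x nths_map del: free_algebra_simps(1) restrict_apply')
  next
    case (5 I B)
    then have "D (cls S (wedge (x # nths ys I) * scalar_eval x ys B)) =
        cls S (scalar ((- 1) ^ card I * qm_number (- int (card I))) *
                 wedge (nths ys I) * scalar_eval x ys B +
               scalar (qm_power (- int (card I))) * wedge (x # nths ys I) * dsc x ys B)"
      by (intro D(5)) auto
    from D'_subst[OF _ _ this] show ?case
      by (simp add: carrier subst_vars_hom subst_vars_wedge subst_vars_scalar_eval subst_vars_dsc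
          x nths_map del: free_algebra_simps(1) restrict_apply')
  qed
qed

theorem proposition3p5:
  fixes x :: 'v and Y Y' :: "'v set"
  assumes "finite Y" and "finite Y'" and "x \<notin> Y" and "x \<notin> Y'"
  shows "(\<forall>\<tau>. bij_betw \<tau> Y Y' \<longrightarrow>
      (\<exists>\<phi> \<in> ring_iso (radial (insert x Y)) (radial (insert x Y')).
        (\<forall>c. \<phi> (cls (insert x Y) (scalar c)) = cls (insert x Y') (scalar c)) \<and>
        \<phi> (cls (insert x Y) (var x)) = cls (insert x Y') (var x) \<and>
        (\<forall>y\<in>Y. \<phi> (cls (insert x Y) (var y)) = cls (insert x Y') (var (\<tau> y))) \<and>
        (\<forall>ys ys'. is_ordering ys Y \<longrightarrow> is_ordering ys' Y' \<longrightarrow>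
          (\<forall>a\<in>carrier (radial (insert x Y)).
            \<phi> (right_qderiv x ys a) = right_qderiv x ys' (\<phi> a))))) \<and>
    (\<forall>ys zs. is_ordering ys Y \<longrightarrow> is_ordering zs Y \<longrightarrow>
      right_qderiv x ys = right_qderiv x zs)"
proof (intro conjI allI impI)
  have model: "radial_model x ys" if "is_ordering ys Z" "x \<notin> Z" for ys Z
    using that by unfold_locales (auto simp: is_ordering_def)
  fix ys zs assume ys: "is_ordering ys Y" and zs: "is_ordering zs Y"
  have "is_right_qderiv x zs (right_qderiv x ys)"
    using radial_model.is_right_qderiv_right_qderiv[OF model[OF ys assms(3)]]
    by (rule is_right_qderiv_reorder) (use ys zs assms(3) in \<open>auto simp: is_ordering_def\<close>)
  then show "right_qderiv x ys = right_qderiv x zs"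
    using radial_model.right_qderiv_eqI[OF model[OF zs assms(3)]] by metis
next
  have model: "radial_model x ys" if "is_ordering ys Z" "x \<notin> Z" for ys Z
    using that by unfold_locales (auto simp: is_ordering_def)
  fix \<tau> assume \<tau>: "bij_betw \<tau> Y Y'"
  define S T where "S = insert x Y" and "T = insert x Y'"
  \<comment> \<open>The value of \<open>\<tau>\<close> at \<open>x\<close> is unknown and is
    replaced by \<open>x\<close>; as \<open>x\<close> lies in neither \<open>Y\<close> nor
    \<open>Y'\<close>, this is a bijection from \<open>S\<close> to \<open>T\<close>.\<close>
  define \<sigma> where "\<sigma> = \<tau>(x := x)"
  define \<sigma>' where "\<sigma>' = (inv_into Y \<tau>)(x := x)"
  have bij: "var_bijection \<sigma> \<sigma>' S T"
  proof
    show "\<sigma> ` S \<subseteq> T"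
      using bij_betwE[OF \<tau>] by (auto simp: \<sigma>_def S_def T_def)
    show "\<sigma>' ` T \<subseteq> S"
      using bij_betwE[OF bij_betw_inv_into[OF \<tau>]] by (auto simp: \<sigma>'_def S_def T_def)
    show "\<sigma>' (\<sigma> v) = v" if "v \<in> S" for v
      using that assms(3,4) bij_betwE[OF \<tau>] bij_betw_inv_into_left[OF \<tau>]
      by (auto simp: \<sigma>_def \<sigma>'_def S_def)
    show "\<sigma> (\<sigma>' v) = v" if "v \<in> T" for v
      using that assms(3,4) bij_betwE[OF bij_betw_inv_into[OF \<tau>]] bij_betw_inv_into_right[OF \<tau>]
      by (auto simp: \<sigma>_def \<sigma>'_def T_def)
  qed
  interpret var_bijection \<sigma> \<sigma>' S T by (rule bij)
  let ?\<phi> = "radial_map \<sigma> S T :: ('v, coeff_ring) free_alg set \<Rightarrow> _"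
  have \<phi>: "?\<phi> (cls S f) = cls T (subst_vars \<sigma> f)"
    if "f \<in> carrier (free_algebra S)" for f :: "('v, coeff_ring) free_alg"
    using that \<sigma>_image by (rule radial_map_cls)
  have intertwine: "?\<phi> (right_qderiv x ys a) = right_qderiv x ys' (?\<phi> a)"
    if ys: "is_ordering ys Y" and ys': "is_ordering ys' Y'" and a: "a \<in> carrier (radial S)" for ys ys' a
  proof -
    have map: "map \<sigma> ys = map \<tau> ys"
      using ys assms(3) by (auto simp: \<sigma>_def is_ordering_def)
    have ord: "is_ordering (map \<sigma> ys) Y'"
      using ys \<tau> unfolding map by (auto simp: is_ordering_def bij_betw_def distinct_map)
    let ?D' = "\<lambda>X\<in>carrier (radial T). ?\<phi> (right_qderiv x ys (radial_map \<sigma>' T S X))"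
    have "is_right_qderiv x (map \<sigma> ys) ?D'"
      using radial_model.is_right_qderiv_right_qderiv[OF model[OF ys assms(3)]] bij
      by (rule is_right_qderiv_transport)
        (use ys ord in \<open>auto simp: S_def T_def is_ordering_def \<sigma>_def\<close>)
    \<comment> \<open>The transported operator belongs to the ordering
      \<open>map \<sigma> ys\<close>, whereas \<open>ys'\<close> is any ordering of
      \<open>Y'\<close>; reordering bridges the two.\<close>
    then have "is_right_qderiv x ys' ?D'"
      by (rule is_right_qderiv_reorder) (use ys' ord assms(4) in \<open>auto simp: is_ordering_def\<close>)
    then have "right_qderiv x ys' = ?D'"
      by (rule radial_model.right_qderiv_eqI[OF model[OF ys' assms(4)]])
    then show ?thesis
      using a by (simp add: radial_map_carrier radial_map_inverse)
  qed
  show "\<exists>\<phi> \<in> ring_iso (radial (insert x Y)) (radial (insert x Y')).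
        (\<forall>c. \<phi> (cls (insert x Y) (scalar c)) = cls (insert x Y') (scalar c)) \<and>
        \<phi> (cls (insert x Y) (var x)) = cls (insert x Y') (var x) \<and>
        (\<forall>y\<in>Y. \<phi> (cls (insert x Y) (var y)) = cls (insert x Y') (var (\<tau> y))) \<and>
        (\<forall>ys ys'. is_ordering ys Y \<longrightarrow> is_ordering ys' Y' \<longrightarrow>
          (\<forall>a\<in>carrier (radial (insert x Y)).
            \<phi> (right_qderiv x ys a) = right_qderiv x ys' (\<phi> a)))"
    unfolding S_def[symmetric] T_def[symmetric]
  proof (intro bexI[of _ ?\<phi>] conjI allI ballI impI)
    show "?\<phi> \<in> ring_iso (radial S) (radial T)" by (rule radial_map_ring_iso)
    show "?\<phi> (cls S (scalar c)) = cls T (scalar c)" for c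
      by (simp add: \<phi> free_algebra_closed subst_vars_scalar del: free_algebra_simps(1))
    have "x \<in> S" "\<sigma> x = x" by (simp_all add: S_def \<sigma>_def)
    then show "?\<phi> (cls S (var x)) = cls T (var x)"
      by (simp add: \<phi> free_algebra_closed subst_vars_var del: free_algebra_simps(1))
    show "?\<phi> (cls S (var y)) = cls T (var (\<tau> y))" if "y \<in> Y" for y
    proof -
      have "y \<in> S" "\<sigma> y = \<tau> y" using that assms(3) by (auto simp: S_def \<sigma>_def)
      then show ?thesis
        by (simp add: \<phi> free_algebra_closed subst_vars_var del: free_algebra_simps(1))
    qed
  qed (rule intertwine)
qed

end
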